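(* Fix $n>1$ and $1<p\le q<\infty$ with $\Theta(1):=1+n\left(\frac1q-\frac1p\right)>0$ and $\Theta(1)\,p'<n$, where $\frac1p+\frac1{p'}=1$. Then, given $u\in A_1(\mathbb{R}^n)$, there exists $C>0$, depending only on $n$, $p$, $q$, and $[u]_{A_1}$, such that $$\left(\int_{\mathbb{R}^n}|f(x)|^q u(x)\,dx\right)^{1/q}\le C\,\|g\|_{L^1(\mathbb{R}^n)}^{\Theta(1)/n}\left(\int_{\mathbb{R}^n}|\nabla f(x)|^p\,\mathcal{M}(g)(x)^{-\Theta(1)p/n}\,u(x)^{p/q}\,dx\right)^{1/p}$$ for every $f\in C_0^1(\mathbb{R}^n)$ and every $g\in L^1(\mathbb{R}^n)$.
   Context: $Q$ denotes a cube in $\mathbb{R}^n$ with sides parallel to the coordinate axes, and suprema over $Q$ are over all such cubes. $\mathcal{M}(g)(x)=\sup_{Q\ni x}\frac1{|Q|}\int_Q|g(y)|\,dy$ is the Hardy--Littlewood maximal function. $C_0^1(\mathbb{R}^n)$ is the set of continuously differentiable functions on $\mathbb{R}^n$ vanishing at infinity. A weight is a function $w\in L^1_{\rm loc}(\mathbb{R}^n)$ with $w\ge0$ a.e.; a weight $w$ belongs to $A_1(\mathbb{R}^n)$ if $[w]_{A_1}:=\sup_Q\left(\frac1{|Q|}\int_Q w\right)\left(\operatorname{ess\,inf}_Q w\right)^{-1}<\infty$.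
   Formalization: The formal theorem assumes that g is not zero almost everywhere; for g = 0 a.e. one has M(g) = 0 and the right-hand side is the undefined product 0 · ∞. *)

theory Defs
  imports "HOL-Analysis.Analysis"
begin

text \<open>Real powers of an extended nonnegative number, with the usual values at \<open>0\<close> and
  \<open>\<infinity>\<close>: e.g. \<open>0\<close> and \<open>\<infinity>\<close> to a negative power are \<open>\<infinity>\<close> and \<open>0\<close>.\<close>

definition epowr :: "ennreal \<Rightarrow> real \<Rightarrow> ennreal" where
  "epowr x a =
     (if a = 0 then 1
      else if x = top then (if a > 0 then top else 0)
      else if x = 0 then (if a > 0 then 0 else top)
      else ennreal (enn2real x powr a))"

definition cubes :: "(real ^ 'n) set set" where
  "cubes = {cbox a (\<chi> i. a $ i + l) | a l. l > 0}"

definition average :: "(real ^ 'n) set \<Rightarrow> (real ^ 'n \<Rightarrow> real) \<Rightarrow> ennreal" where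
  "average Q g = (\<integral>\<^sup>+y\<in>Q. ennreal (g y) \<partial>lebesgue) / emeasure lebesgue Q"

definition maximal_fun :: "(real ^ 'n \<Rightarrow> real) \<Rightarrow> real ^ 'n \<Rightarrow> ennreal" where
  "maximal_fun g x = (SUP Q \<in> {Q \<in> cubes. x \<in> Q}. average Q (\<lambda>y. \<bar>g y\<bar>))"

definition gradient :: "(real ^ 'n \<Rightarrow> real) \<Rightarrow> real ^ 'n \<Rightarrow> real ^ 'n" where
  "gradient f x = (\<chi> i. frechet_derivative f (at x) (axis i 1))"

definition C01 :: "(real ^ 'n \<Rightarrow> real) set" where
  "C01 = {f. (\<forall>x. f differentiable (at x)) \<and> continuous_on UNIV (gradient f) \<and>
             (f \<longlongrightarrow> 0) at_infinity}"

lemma C01_GDERIV: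
  assumes "f \<in> C01"
  shows "GDERIV f x :> gradient f x"
proof -
  let ?D = "frechet_derivative f (at x)"
  have D: "(f has_derivative ?D) (at x)"
    using assms frechet_derivative_works by (auto simp: C01_def)
  then have lin: "linear ?D"
    by (rule has_derivative_linear)
  have "?D h = h \<bullet> gradient f x" for h
  proof -
    have "?D h = ?D (\<Sum>i\<in>UNIV. h $ i *\<^sub>R axis i 1)"
      by (simp add: basis_expansion flip: scalar_mult_eq_scaleR)
    also have "\<dots> = (\<Sum>i\<in>UNIV. h $ i * ?D (axis i 1))"
      by (simp add: linear_sum[OF lin] linear_scale[OF lin])
    finally show ?thesis
      by (simp add: inner_vec_def gradient_def)
  qed
  then have "?D = (\<lambda>h. h \<bullet> gradient f x)"
    by blast
  with D show ?thesis
    by (simp add: gderiv_def)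
qed

definition weight :: "(real ^ 'n \<Rightarrow> real) \<Rightarrow> bool" where
  "weight w \<longleftrightarrow> (\<forall>K. compact K \<longrightarrow> set_integrable lebesgue K w) \<and> (AE x in lebesgue. w x \<ge> 0)"

definition ess_inf_on :: "(real ^ 'n) set \<Rightarrow> (real ^ 'n \<Rightarrow> real) \<Rightarrow> ennreal" where
  "ess_inf_on Q w = Sup {c. AE x in lebesgue. x \<in> Q \<longrightarrow> c \<le> ennreal (w x)}"

text \<open>In \<open>ennreal\<close>, \<open>inverse 0 = \<infinity>\<close> and \<open>0 * \<infinity> = 0\<close>. So a cube on which \<open>w\<close> has
  essential infimum \<open>0\<close> but positive average makes the constant infinite, whereas a cube on
  which \<open>w\<close> vanishes almost everywhere contributes \<open>0\<close>.\<close>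

definition A1_const :: "(real ^ 'n \<Rightarrow> real) \<Rightarrow> ennreal" where
  "A1_const w = (SUP Q \<in> cubes. average Q w * inverse (ess_inf_on Q w))"

definition A1 :: "(real ^ 'n \<Rightarrow> real) set" where
  "A1 = {w. weight w \<and> A1_const w < top}"

end

theory Submission
  imports Defs
begin

text \<open>
  Averaging the line integrals of \<open>\<nabla>f\<close> over the rays from \<open>x\<close> bounds \<open>|f x|\<close> by the Riesz
  potential \<open>\<integral> |x - y|^(1-n) |\<nabla>f y| dy\<close>, where \<open>|.|\<close> is the supremum norm. The two-weight inequality
  for this potential follows from a Schur test whose test functions are powers of
  \<open>b = \<M>(g)\<close>: for a small \<open>\<epsilon>\<close>, the kernel is split by Hoelder with exponents \<open>p'\<close>, \<open>q\<close> and
  \<open>(1/p - 1/q)^(-1)\<close> into \<open>|x - y|^(\<beta>\<^sub>1 - n) b(y)^c\<^sub>1\<close>, a factor containing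
  \<open>|x - y|^(\<beta>\<^sub>2 - n)\<close>, and the integrand of the right-hand side. Writing \<open>\<Theta>\<close> for \<open>\<Theta>(1)\<close>, the exponents are
  \<open>\<beta>\<^sub>1 = p'\<Theta> - \<epsilon>\<close>, \<open>c\<^sub>1 = (p'\<Theta> + \<epsilon>)/n\<close> and \<open>\<beta>\<^sub>2 = q\<epsilon>/p'\<close>; the condition \<open>\<Theta> p' < n\<close> is
  what makes \<open>c\<^sub>1 < 1\<close> possible.

  Both kernel integrals are then controlled by averages over cubes \<open>Q\<close> of side comparable to \<open>r\<close> centred at \<open>x\<close>:
  by Kolmogorov's inequality, the average of \<open>b^c\<close> with \<open>c < 1\<close> is at most a constant times
  \<open>min (b x) (\<parallel>g\<parallel>\<^sub>1 / r^n)^c\<close>, and the reverse Hoelder inequality for \<open>A\<^sub>1\<close> weights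
  gives the same for \<open>b^c u\<close> with an extra factor \<open>u x\<close>, provided that \<open>c\<close> is small in terms of \<open>[u]\<close>.
\<close>

subsection \<open>Extended real powers and the Hoelder inequality\<close>

text \<open>The parameter \<open>e\<close> buys convergence. By the averages over cubes, the kernel
  \<open>infnorm (x - y) powr (beta - n)\<close> against \<open>b\<close> to the power
  \<open>c\<close> is integrable at the origin because \<open>beta > 0\<close> and at infinity
  because \<open>beta / n < c\<close>, and its integral is bounded by \<open>b\<close> to the power
  \<open>c - beta / n\<close> times \<open>L\<close> to the power \<open>beta / n\<close>, where
  \<open>L\<close> is the norm of \<open>g\<close>. With \<open>e = 0\<close> the first condition
  fails for the second kernel and the second condition for the first kernel. The exponents are then
  forced. The surplus \<open>2 * e / n\<close> of \<open>b\<close> left by the first kernel,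
  multiplied by \<open>q / p'\<close>, is the power \<open>c2\<close> that the dual integral has to
  carry. There the second kernel leaves \<open>u\<close> times \<open>b\<close> to the power
  \<open>c2 - beta2 / n\<close>, and the weight \<open>w\<close> hidden in the second Hoelder factor
  is the reciprocal of exactly this. Only \<open>c2\<close> meets the weight \<open>u\<close>, and
  it tends to 0 with \<open>e\<close>, so the small exponents allowed by the reverse Hoelder
  inequality suffice; \<open>c1\<close> is merely below 1 but is used without a weight.\<close>

lemma epowr_zero_exp [simp]: "epowr x 0 = 1"
  by (simp add: epowr_def)

lemma epowr_one_exp [simp]: "epowr x 1 = x"
  by (auto simp: epowr_def powr_one' enn2real_positive_iff top.not_eq_extremum zero_less_iff_neq_zero)

lemma epowr_zero_base: "a > 0 \<Longrightarrow> epowr 0 a = 0"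
  by (simp add: epowr_def)

lemma epowr_top_base: "a > 0 \<Longrightarrow> epowr top a = top"
  by (simp add: epowr_def)

lemma epowr_ennreal: "x > 0 \<Longrightarrow> epowr (ennreal x) a = ennreal (x powr a)"
  by (auto simp: epowr_def)

lemma epowr_ennreal_nonneg: "a > 0 \<Longrightarrow> x \<ge> 0 \<Longrightarrow> epowr (ennreal x) a = ennreal (x powr a)"
  by (cases "x = 0") (auto simp: epowr_def)

lemma ennreal_cases3:
  obtains "x = 0" | "x = top" | r where "r > 0" "x = ennreal r"
  by (metis ennreal_0 ennreal_cases infinity_ennreal_def less_eq_real_def)

lemma epowr_eq_0_iff: "a > 0 \<Longrightarrow> epowr x a = 0 \<longleftrightarrow> x = 0"
  by (cases x rule: ennreal_cases3) (auto simp: epowr_def)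

lemma epowr_mono:
  assumes "x \<le> y" "0 \<le> a"
  shows "epowr x a \<le> epowr y a"
proof (cases "a = 0")
  case False
  then have a: "a > 0" using assms by simp
  show ?thesis
  proof (cases x rule: ennreal_cases3)
    case 2
    then show ?thesis using assms by (simp add: top.extremum_unique)
  next
    case (3 r)
    show ?thesis
    proof (cases y rule: ennreal_cases3)
      case (3 s)
      then show ?thesis using \<open>x = ennreal r\<close> \<open>r > 0\<close> assms a
        by (simp add: epowr_ennreal powr_mono2 ennreal_leI)
    qed (use 3 assms a in \<open>auto simp: epowr_top_base\<close>)
  qed (use a in \<open>simp add: epowr_zero_base\<close>)
qed simp

text \<open>The values at \<open>0\<close> and \<open>top\<close> are swapped by a negative
  exponent, which matches the sign rule for products, so exponents of any sign may be
  composed.\<close>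

lemma epowr_epowr: "epowr (epowr x a) b = epowr x (a * b)"
proof (cases x rule: ennreal_cases3)
  case (3 r)
  then have "r powr a > 0" by simp
  then show ?thesis using 3 by (simp add: epowr_ennreal powr_powr)
qed (auto simp: epowr_def zero_less_mult_iff mult_less_0_iff)

text \<open>A negative exponent has to be excluded: for \<open>x = 0\<close> and
  \<open>y = top\<close> the product is \<open>0\<close>, whose negative power is
  \<open>top\<close>, whereas the product of the two powers is \<open>top * 0 = 0\<close>.\<close>

lemma epowr_mult:
  assumes "a \<ge> 0"
  shows "epowr (x * y) a = epowr x a * epowr y a"
proof (cases "a = 0")
  case False
  then have a: "a > 0" using assms by simp
  show ?thesis
  proof (cases x rule: ennreal_cases3)
    case 2
    show ?thesis
      by (cases "y = 0") (use 2 a in \<open>auto simp: epowr_zero_base epowr_top_base ennreal_top_mult epowr_eq_0_iff\<close>)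
  next
    case (3 r)
    show ?thesis
    proof (cases y rule: ennreal_cases3)
      case 2
      then show ?thesis using 3 a
        by (auto simp: epowr_top_base ennreal_mult_top epowr_ennreal)
    next
      case (3 s)
      then show ?thesis using \<open>x = ennreal r\<close> \<open>r > 0\<close> a
        by (simp add: epowr_ennreal powr_mult flip: ennreal_mult)
    qed (use 3 a in \<open>auto simp: epowr_zero_base\<close>)
  qed (use a in \<open>auto simp: epowr_zero_base\<close>)
qed simp

lemma epowr_add:
  assumes "a \<ge> 0" "b \<ge> 0"
  shows "epowr x (a + b) = epowr x a * epowr x b"
proof (cases "a = 0 \<or> b = 0")
  case False
  with assms have "a > 0" "b > 0" by auto
  then show ?thesis
    by (cases x rule: ennreal_cases3)
       (auto simp: epowr_zero_base epowr_top_base epowr_ennreal powr_add ennreal_mult)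
qed auto

lemma borel_measurable_epowr [measurable]:
  assumes [measurable]: "f \<in> borel_measurable M"
  shows "(\<lambda>x. epowr (f x) a) \<in> borel_measurable M"
  unfolding epowr_def by measurable

lemma Young_powr:
  fixes a b t :: real
  assumes "a \<ge> 0" "b \<ge> 0" "0 < t" "t < 1"
  shows "a powr t * b powr (1 - t) \<le> t * a + (1 - t) * b"
  using Youngs_inequality_0[of t "1 - t" a b] assms by (cases "a = 0 \<or> b = 0") auto

lemma Young_epowr:
  assumes "0 < t" "t < 1"
  shows "epowr x t * epowr y (1 - t) \<le> ennreal t * x + ennreal (1 - t) * y"
proof (cases x rule: ennreal_cases3)
  case 1 then show ?thesis using assms by (simp add: epowr_zero_base)
next
  case 2 then show ?thesis using assms by (simp add: ennreal_mult_top)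
next
  case (3 r)
  show ?thesis
  proof (cases y rule: ennreal_cases3)
    case 1 then show ?thesis using assms by (simp add: epowr_zero_base)
  next
    case 2 then show ?thesis using assms by (simp add: ennreal_mult_top)
  next
    case (3 s)
    have "r powr t * s powr (1 - t) \<le> t * r + (1 - t) * s"
      using Young_powr[of r s t] assms 3 \<open>r > 0\<close> by simp
    then have "ennreal (r powr t * s powr (1 - t)) \<le> ennreal (t * r + (1 - t) * s)"
      by (rule ennreal_leI)
    then show ?thesis using 3 \<open>r > 0\<close> \<open>x = ennreal r\<close> assms
      by (simp add: epowr_ennreal ennreal_mult)
  qed
qed

text \<open>Both integrals are normalised to 1 and Young's inequality is integrated. The endpoints
  of \<open>t\<close> are included because \<open>p = q\<close> leads to
  \<open>t = p / q = 1\<close>; there the claim rests on \<open>epowr x 0 = 1\<close> for every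
  \<open>x\<close>, including \<open>0\<close> and \<open>top\<close>.\<close>

lemma Holder_nn_integral:
  assumes [measurable]: "f \<in> borel_measurable M" "g \<in> borel_measurable M"
    and t: "0 \<le> t" "t \<le> 1"
  shows "(\<integral>\<^sup>+x. epowr (f x) t * epowr (g x) (1 - t) \<partial>M)
    \<le> epowr (\<integral>\<^sup>+x. f x \<partial>M) t * epowr (\<integral>\<^sup>+x. g x \<partial>M) (1 - t)"
proof (cases "t = 0 \<or> t = 1")
  case True
  then show ?thesis by auto
next
  case False
  with t have t': "0 < t" "t < 1" by auto
  let ?X = "\<integral>\<^sup>+x. f x \<partial>M" and ?Y = "\<integral>\<^sup>+x. g x \<partial>M"
  show ?thesis
  \<comment> \<open>Vanishing integrals come before infinite ones: once neither integral is
    \<open>0\<close>, an infinite one makes the right-hand side \<open>top\<close>, whereas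
    \<open>0 * top = 0\<close> would not bound anything.\<close>
  proof (cases "?X = 0 \<or> ?Y = 0")
    case True
    then have "AE x in M. f x = 0 \<or> g x = 0"
      by (auto simp: nn_integral_0_iff_AE)
    then have "AE x in M. epowr (f x) t * epowr (g x) (1 - t) = 0"
      by eventually_elim (use t' in \<open>auto simp: epowr_zero_base\<close>)
    then have "(\<integral>\<^sup>+x. epowr (f x) t * epowr (g x) (1 - t) \<partial>M) = 0"
      by (subst nn_integral_0_iff_AE) auto
    then show ?thesis by simp
  next
    case nz: False
    show ?thesis
    proof (cases "?X = top \<or> ?Y = top")
      case True
      then have "epowr ?X t * epowr ?Y (1 - t) = top"
        using nz t' by (auto simp: epowr_top_base epowr_eq_0_iff ennreal_top_mult ennreal_mult_top)
      then show ?thesis by simp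
    next
      case False
      obtain X where X: "X > 0" "?X = ennreal X"
        using nz False by (cases ?X rule: ennreal_cases3) auto
      obtain Y where Y: "Y > 0" "?Y = ennreal Y"
        using nz False by (cases ?Y rule: ennreal_cases3) auto
      have one: "ennreal X * ennreal (1/X) = 1" "ennreal Y * ennreal (1/Y) = 1"
        using X Y by (simp_all flip: ennreal_mult)
      have inv: "f x = ennreal X * (f x * ennreal (1/X))" "g x = ennreal Y * (g x * ennreal (1/Y))" for x
        using one by (simp_all add: mult.left_commute[of "ennreal _"])
      have "(\<integral>\<^sup>+x. epowr (f x) t * epowr (g x) (1 - t) \<partial>M) =
        (\<integral>\<^sup>+x. (epowr (ennreal X) t * epowr (ennreal Y) (1-t)) *
            (epowr (f x * ennreal (1/X)) t * epowr (g x * ennreal (1/Y)) (1 - t)) \<partial>M)"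
        using t' by (subst inv(1), subst inv(2)) (simp add: epowr_mult mult_ac)
      also have "\<dots> = epowr (ennreal X) t * epowr (ennreal Y) (1-t) *
           (\<integral>\<^sup>+x. epowr (f x * ennreal (1/X)) t * epowr (g x * ennreal (1/Y)) (1 - t) \<partial>M)"
        by (rule nn_integral_cmult) measurable
      also have "(\<integral>\<^sup>+x. epowr (f x * ennreal (1/X)) t * epowr (g x * ennreal (1/Y)) (1 - t) \<partial>M)
         \<le> (\<integral>\<^sup>+x. ennreal t * (f x * ennreal (1/X)) + ennreal (1-t) * (g x * ennreal (1/Y)) \<partial>M)"
        by (intro nn_integral_mono Young_epowr t')
      also have "\<dots> = ennreal t * (?X * ennreal (1/X)) + ennreal (1-t) * (?Y * ennreal (1/Y))"
        by (simp add: nn_integral_add nn_integral_cmult nn_integral_multc)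
      also have "\<dots> = 1"
        using X Y t' by (simp flip: ennreal_mult ennreal_plus)
      finally show ?thesis using X Y by (simp add: mult_left_mono)
    qed
  qed
qed

subsection \<open>Cubes and the maximal function\<close>

text \<open>Cubes are treated as closed balls of the supremum norm, with centre and half the side as
  parameters; inclusions between cubes then reduce to the triangle inequality for
  \<open>infnorm\<close>.\<close>

definition cube :: "real ^ 'n \<Rightarrow> real \<Rightarrow> (real ^ 'n) set" where
  "cube c r = {y. infnorm (y - c) \<le> r}"

lemma infnorm_le_iff: "infnorm (x :: real ^ 'n) \<le> r \<longleftrightarrow> (\<forall>i. \<bar>x $ i\<bar> \<le> r)"
proof
  show "\<forall>i. \<bar>x $ i\<bar> \<le> r" if "infnorm x \<le> r"
    using component_le_infnorm_cart[of x] that order_trans by blast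
  show "infnorm x \<le> r" if "\<forall>i. \<bar>x $ i\<bar> \<le> r"
    using that unfolding infnorm_Max by (subst Max_le_iff) (auto simp: Basis_vec_def inner_axis)
qed

lemma cube_eq_cbox: "cube c r = cbox (\<chi> i. c $ i - r) (\<chi> i. c $ i + r)"
  by (auto simp: cube_def infnorm_le_iff mem_box_cart abs_le_iff algebra_simps)

lemma cube_borel [measurable]: "cube c r \<in> sets borel"
  by (simp add: cube_eq_cbox)

lemma mem_cube: "y \<in> cube c r \<longleftrightarrow> infnorm (y - c) \<le> r"
  by (simp add: cube_def)

lemma center_in_cube: "r \<ge> 0 \<Longrightarrow> c \<in> cube c r"
  by (simp add: cube_def infnorm_0)

lemma infnorm_triangle_diff: "infnorm (x - z) \<le> infnorm (x - y) + infnorm (y - z)"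
  using infnorm_triangle[of "x - y" "y - z"] by simp

lemma cube_subset: "infnorm (c - c') + r \<le> r' \<Longrightarrow> cube c r \<subseteq> cube c' r'"
proof
  fix y assume "infnorm (c - c') + r \<le> r'" "y \<in> cube c r"
  then show "y \<in> cube c' r'"
    using infnorm_triangle_diff[of y c' c] by (simp add: cube_def)
qed

lemma cube_mono: "r \<le> r' \<Longrightarrow> cube c r \<subseteq> cube c r'"
  by (auto simp: cube_def)

lemma emeasure_cube:
  fixes c :: "real ^ 'n"
  assumes "r \<ge> 0"
  shows "emeasure lborel (cube c r) = ennreal ((2 * r) ^ CARD('n))"
proof -
  have "emeasure lborel (cube c r)
     = ennreal (\<Prod>b\<in>Basis. ((\<chi> i. c $ i + r) - (\<chi> i. c $ i - r) :: real ^ 'n) \<bullet> b)"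
    unfolding cube_eq_cbox using assms
    by (intro emeasure_lborel_cbox) (auto simp: Basis_vec_def inner_axis)
  also have "(\<Prod>b\<in>Basis. ((\<chi> i. c $ i + r) - (\<chi> i. c $ i - r) :: real ^ 'n) \<bullet> b)
     = (\<Prod>b\<in>(Basis :: (real ^ 'n) set). 2 * r)"
    by (intro prod.cong) (auto simp: Basis_vec_def inner_axis)
  finally show ?thesis by simp
qed

lemma cubes_eq: "cubes = {cube c r | c r. (r::real) > 0}"
proof safe
  fix Q :: "(real ^ 'n) set"
  assume "Q \<in> cubes"
  then obtain a l where l: "l > 0" "Q = cbox a (\<chi> i. a $ i + l)"
    by (auto simp: cubes_def)
  then have "Q = cube (\<chi> i. a $ i + l / 2) (l / 2)"
    by (simp add: cube_eq_cbox add.commute)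
  then show "\<exists>c r. Q = cube c r \<and> r > 0"
    using l by (intro exI[of _ "\<chi> i. a $ i + l / 2"] exI[of _ "l / 2"]) auto
next
  fix c :: "real ^ 'n" and r :: real
  assume r: "r > 0"
  show "cube c r \<in> cubes"
    unfolding cubes_def cube_eq_cbox
    by (rule CollectI, rule exI[of _ "\<chi> i. c $ i - r"], rule exI[of _ "2 * r"]) (use r in \<open>simp add: algebra_simps\<close>)
qed

lemma infnorm_le_norm_le:
  fixes x :: "real ^ 'n"
  shows "infnorm x \<le> norm x" "norm x \<le> real CARD('n) * infnorm x"
proof -
  have "sqrt (real CARD('n)) \<le> real CARD('n)"
    by (rule real_le_lsqrt) (auto simp: power2_eq_square)
  then have "sqrt (real CARD('n)) * infnorm x \<le> real CARD('n) * infnorm x"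
    by (rule mult_right_mono) (rule infnorm_pos_le)
  then show "norm x \<le> real CARD('n) * infnorm x"
    using norm_le_infnorm[of x] by simp
qed (rule infnorm_le_norm)

section \<open>Covering by dilated cubes\<close>

text \<open>The Vitali lemma for Euclidean balls is applied to the balls of radius
  \<open>n * r\<close> that contain the cubes of half-side \<open>r\<close>, \<open>n\<close> being
  the dimension. Disjoint balls contain disjoint cubes, and the five times larger ball lies in the
  cube of half-side \<open>5 * n * r\<close>. This is the origin of the factor
  \<open>5 * real CARD('n)\<close> in all later constants.\<close>

lemma Vitali_cubes:
  fixes K :: "((real ^ 'n) \<times> real) set"
  assumes K: "\<And>c r. (c, r) \<in> K \<Longrightarrow> 0 < r \<and> r \<le> B"
  obtains C where "countable C" "C \<subseteq> K" "disjoint_family_on (\<lambda>(c, r). cube c r) C"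
    "(\<Union>(c, r)\<in>K. cube c r) \<subseteq> (\<Union>(c, r)\<in>C. cube c (5 * real CARD('n) * r))"
proof -
  let ?n = "real CARD('n)"
  have n: "?n > 0" by simp
  have bnd: "0 < ?n * snd i \<and> ?n * snd i \<le> ?n * B" if "i \<in> K" for i
    using K[of "fst i" "snd i"] that by auto
  obtain C where C: "countable C" "C \<subseteq> K"
    "pairwise (\<lambda>i j. disjnt (cball (fst i) (?n * snd i)) (cball (fst j) (?n * snd j))) C"
    "\<And>i. i \<in> K \<Longrightarrow> \<exists>j. j \<in> C \<and> \<not> disjnt (cball (fst i) (?n * snd i)) (cball (fst j) (?n * snd j)) \<and>
                        cball (fst i) (?n * snd i) \<subseteq> ball (fst j) (5 * (?n * snd j))"
    using Vitali_covering_lemma_cballs_balls[of K "\<lambda>i. ?n * snd i" "?n * B" fst, OF bnd] by blast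
  have sub1: "cube c r \<subseteq> cball c (?n * r)" for c :: "real ^ 'n" and r
  proof
    fix y assume "y \<in> cube c r"
    then have "?n * infnorm (y - c) \<le> ?n * r"
      by (simp add: cube_def)
    with infnorm_le_norm_le(2)[of "y - c"] have "norm (y - c) \<le> ?n * r"
      by (rule order_trans)
    then show "y \<in> cball c (?n * r)"
      by (simp add: dist_norm norm_minus_commute)
  qed
  have sub2: "ball c R \<subseteq> cube c R" for c :: "real ^ 'n" and R
  proof
    fix y assume "y \<in> ball c R"
    then show "y \<in> cube c R"
      using infnorm_le_norm_le(1)[of "y - c"] by (simp add: cube_def dist_norm norm_minus_commute)
  qed
  show ?thesis
  proof (rule that[of C])
    show "disjoint_family_on (\<lambda>(c, r). cube c r) C"
      unfolding disjoint_family_on_def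
    proof (intro ballI impI)
      fix i j assume "i \<in> C" "j \<in> C" "i \<noteq> j"
      then have "disjnt (cball (fst i) (?n * snd i)) (cball (fst j) (?n * snd j))"
        using C(3) unfolding pairwise_def by blast
      then show "(case i of (c, r) \<Rightarrow> cube c r) \<inter> (case j of (c, r) \<Rightarrow> cube c r) = {}"
        using sub1[of "fst i" "snd i"] sub1[of "fst j" "snd j"] unfolding disjnt_def case_prod_beta by blast
    qed
    show "(\<Union>(c, r)\<in>K. cube c r) \<subseteq> (\<Union>(c, r)\<in>C. cube c (5 * ?n * r))"
    proof
      fix y assume "y \<in> (\<Union>(c, r)\<in>K. cube c r)"
      then obtain i where i: "i \<in> K" "y \<in> cube (fst i) (snd i)" by auto
      obtain j where j: "j \<in> C" "cball (fst i) (?n * snd i) \<subseteq> ball (fst j) (5 * (?n * snd j))"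
        using C(4)[OF i(1)] by blast
      have "y \<in> cube (fst j) (5 * (?n * snd j))"
        using i j sub1 sub2 by blast
      then show "y \<in> (\<Union>(c, r)\<in>C. cube c (5 * ?n * r))"
        using j(1) by (force simp: mult.assoc)
    qed
  qed (use C in auto)
qed

text \<open>Sums over a Vitali family are written as integrals over \<open>count_space C\<close>: no
  enumeration of \<open>C\<close> has to be chosen, and sums and integrals are interchanged as
  iterated integrals.\<close>

lemma nn_integral_UN_le_count:
  assumes "countable C" and [measurable]: "\<And>i. i \<in> C \<Longrightarrow> X i \<in> sets M" "h \<in> borel_measurable M"
    and E: "E \<subseteq> (\<Union>i\<in>C. X i)"
  shows "(\<integral>\<^sup>+x\<in>E. h x \<partial>M) \<le> (\<integral>\<^sup>+i. (\<integral>\<^sup>+x\<in>X i. h x \<partial>M) \<partial>count_space C)"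
proof -
  have "h x * indicator E x \<le> (\<integral>\<^sup>+i. h x * indicator (X i) x \<partial>count_space C)" for x
  proof (cases "x \<in> E")
    case True
    then obtain j where j: "j \<in> C" "x \<in> X j" using E by auto
    have "h x * indicator E x = (\<integral>\<^sup>+i. h x * indicator (X i) x * indicator {j} i \<partial>count_space C)"
      using j True by (subst nn_integral_indicator_singleton) auto
    also have "\<dots> \<le> (\<integral>\<^sup>+i. h x * indicator (X i) x \<partial>count_space C)"
      by (intro nn_integral_mono) (auto split: split_indicator)
    finally show ?thesis .
  qed simp
  then have "(\<integral>\<^sup>+x\<in>E. h x \<partial>M) \<le> (\<integral>\<^sup>+x. (\<integral>\<^sup>+i. h x * indicator (X i) x \<partial>count_space C) \<partial>M)"
    by (intro nn_integral_mono)
  also have "\<dots> = (\<integral>\<^sup>+i. (\<integral>\<^sup>+x\<in>X i. h x \<partial>M) \<partial>count_space C)"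
    by (rule nn_integral_count_space_nn_integral) (use assms in auto)
  finally show ?thesis .
qed

lemma nn_integral_disjoint_count_le:
  assumes "countable C" and [measurable]: "\<And>i. i \<in> C \<Longrightarrow> X i \<in> sets M" "h \<in> borel_measurable M"
    and disj: "disjoint_family_on X C" and T: "(\<Union>i\<in>C. X i) \<subseteq> T"
  shows "(\<integral>\<^sup>+i. (\<integral>\<^sup>+x\<in>X i. h x \<partial>M) \<partial>count_space C) \<le> (\<integral>\<^sup>+x\<in>T. h x \<partial>M)"
proof -
  have "(\<integral>\<^sup>+i. h x * indicator (X i) x \<partial>count_space C) \<le> h x * indicator T x" for x
  proof (cases "\<exists>j\<in>C. x \<in> X j")
    case True
    then obtain j where j: "j \<in> C" "x \<in> X j" by auto
    have "indicator (X i) x = (indicator {j} i :: ennreal)" if "i \<in> C" for i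
      using disj j that by (auto simp: disjoint_family_on_def split: split_indicator)
    then have "(\<integral>\<^sup>+i. h x * indicator (X i) x \<partial>count_space C) = (\<integral>\<^sup>+i. h x * indicator {j} i \<partial>count_space C)"
      by (intro nn_integral_cong) simp
    also have "\<dots> = h x"
      using j by (subst nn_integral_indicator_singleton) auto
    finally show ?thesis using j T by (auto simp: indicator_def)
  next
    case False
    then have "(\<integral>\<^sup>+i. h x * indicator (X i) x \<partial>count_space C) = (\<integral>\<^sup>+i. 0 \<partial>count_space C)"
      by (intro nn_integral_cong) (auto simp: indicator_def)
    then show ?thesis by simp
  qed
  then have "(\<integral>\<^sup>+x. (\<integral>\<^sup>+i. h x * indicator (X i) x \<partial>count_space C) \<partial>M) \<le> (\<integral>\<^sup>+x\<in>T. h x \<partial>M)"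
    by (intro nn_integral_mono)
  moreover have "(\<integral>\<^sup>+x. (\<integral>\<^sup>+i. h x * indicator (X i) x \<partial>count_space C) \<partial>M) = (\<integral>\<^sup>+i. (\<integral>\<^sup>+x\<in>X i. h x \<partial>M) \<partial>count_space C)"
    by (rule nn_integral_count_space_nn_integral) (use assms in auto)
  ultimately show ?thesis by simp
qed

section \<open>The noncentred maximal operator and its weak-type inequality\<close>

text \<open>This is the operator behind \<open>maximal_fun\<close>, moved to \<open>lborel\<close>
  and to \<open>ennreal\<close>-valued functions, with the volume of the cube in closed form. The
  cubes need only contain \<open>x\<close>, which is what makes the superlevel sets open.\<close>

definition cube_max :: "(real ^ 'n \<Rightarrow> ennreal) \<Rightarrow> real ^ 'n \<Rightarrow> ennreal" where
  "cube_max h x = (SUP (c, r) \<in> {(c, r). 0 < r \<and> x \<in> cube c r}.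
     (\<integral>\<^sup>+y\<in>cube c r. h y \<partial>lborel) / ennreal ((2 * r) ^ CARD('n)))"

lemma ennreal_less_divide_iff: "v > 0 \<Longrightarrow> t < s / ennreal v \<longleftrightarrow> t * ennreal v < s"
proof -
  assume v: "v > 0"
  have eq: "s = s / ennreal v * ennreal v"
    using v by (simp only: ennreal_divide_times) (simp add: divide_ennreal)
  show ?thesis
  proof
    assume "t < s / ennreal v"
    then have "t * ennreal v < s / ennreal v * ennreal v"
      using v by (intro ennreal_mult_strict_right_mono) auto
    then show "t * ennreal v < s" using eq by simp
  next
    assume "t * ennreal v < s"
    then have "\<not> s / ennreal v \<le> t"
      using eq mult_right_mono[of "s / ennreal v" t "ennreal v"] by auto
    then show "t < s / ennreal v" by simp
  qed
qed

lemma less_cube_max_iff: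
  fixes h :: "real ^ 'n \<Rightarrow> ennreal"
  shows "t < cube_max h x \<longleftrightarrow>
    (\<exists>c r. 0 < r \<and> x \<in> cube c r \<and> t * ennreal ((2 * r) ^ CARD('n)) < (\<integral>\<^sup>+y\<in>cube c r. h y \<partial>lborel))"
  unfolding cube_max_def less_SUP_iff
proof safe
  fix c r assume "0 < r" "x \<in> cube c r" "t < (\<integral>\<^sup>+y\<in>cube c r. h y \<partial>lborel) / ennreal ((2 * r) ^ CARD('n))"
  then show "\<exists>c r. 0 < r \<and> x \<in> cube c r \<and> t * ennreal ((2 * r) ^ CARD('n)) < (\<integral>\<^sup>+y\<in>cube c r. h y \<partial>lborel)"
    by (subst (asm) ennreal_less_divide_iff) auto
next
  fix c r assume "0 < r" "x \<in> cube c r" "t * ennreal ((2 * r) ^ CARD('n)) < (\<integral>\<^sup>+y\<in>cube c r. h y \<partial>lborel)"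
  then show "\<exists>i\<in>{(c, r). 0 < r \<and> x \<in> cube c r}. t < (case i of (c, r) \<Rightarrow> (\<integral>\<^sup>+y\<in>cube c r. h y \<partial>lborel) / ennreal ((2 * r) ^ CARD('n)))"
    by (intro bexI[of _ "(c, r)"]) (auto simp del: power_mult_distrib simp: ennreal_less_divide_iff)
qed

lemma cube_integral_le_max:
  fixes h :: "real ^ 'n \<Rightarrow> ennreal"
  assumes "0 < r" "x \<in> cube c r"
  shows "(\<integral>\<^sup>+y\<in>cube c r. h y \<partial>lborel) \<le> cube_max h x * ennreal ((2 * r) ^ CARD('n))"
  using less_cube_max_iff[of "cube_max h x" h x] assms by (meson less_irrefl linorder_not_le)

lemma cube_max_leI:
  fixes h :: "real ^ 'n \<Rightarrow> ennreal"
  assumes "\<And>c r. 0 < r \<Longrightarrow> x \<in> cube c r \<Longrightarrow>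
     (\<integral>\<^sup>+y\<in>cube c r. h y \<partial>lborel) \<le> t * ennreal ((2 * r) ^ CARD('n))"
  shows "cube_max h x \<le> t"
  using less_cube_max_iff[of t h x] assms by (meson linorder_not_le)

text \<open>The cubes are closed, so \<open>x\<close> may lie on the boundary of the cube that
  witnesses the strict inequality. Its half-side can be enlarged a little without losing that
  inequality, by continuity of the volume, and the larger cube is a neighbourhood of
  \<open>x\<close>. Openness of all superlevel sets gives Borel measurability.\<close>

lemma open_cube_max_superlevel:
  fixes h :: "real ^ 'n \<Rightarrow> ennreal"
  shows "open {x. t < cube_max h x}"
proof (rule openI)
  fix x assume "x \<in> {x. t < cube_max h x}"
  then obtain c r where r: "0 < r" "x \<in> cube c r"
    and lt: "t * ennreal ((2 * r) ^ CARD('n)) < (\<integral>\<^sup>+y\<in>cube c r. h y \<partial>lborel)"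
    by (auto simp: less_cube_max_iff)
  have "t \<noteq> top"
    using lt r by (auto simp: ennreal_top_mult)
  then obtain t' where t': "t = ennreal t'" "t' \<ge> 0"
    by (cases t) auto
  have "((\<lambda>s. ennreal (t' * (2 * s) ^ CARD('n))) \<longlongrightarrow> ennreal (t' * (2 * r) ^ CARD('n))) (at_right r)"
    by (intro tendsto_intros)
  moreover have "ennreal (t' * (2 * r) ^ CARD('n)) < (\<integral>\<^sup>+y\<in>cube c r. h y \<partial>lborel)"
    using lt t' r by (simp add: ennreal_mult)
  ultimately have "\<forall>\<^sub>F s in at_right r. ennreal (t' * (2 * s) ^ CARD('n)) < (\<integral>\<^sup>+y\<in>cube c r. h y \<partial>lborel)"
    by (rule order_tendstoD)
  then obtain b where b: "b > r" "\<And>s. r < s \<Longrightarrow> s < b \<Longrightarrow> ennreal (t' * (2 * s) ^ CARD('n)) < (\<integral>\<^sup>+y\<in>cube c r. h y \<partial>lborel)"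
    unfolding eventually_at_right_field by blast
  define s where "s = (r + b) / 2"
  have s: "r < s" "s < b" using b by (auto simp: s_def)
  have "ball x (s - r) \<subseteq> {x. t < cube_max h x}"
  proof
    fix y assume "y \<in> ball x (s - r)"
    then have "infnorm (y - x) < s - r"
      using infnorm_le_norm[of "y - x"] by (simp add: dist_norm norm_minus_commute)
    then have "y \<in> cube c s"
      using r infnorm_triangle_diff[of y c x] by (simp add: cube_def)
    moreover have "t * ennreal ((2 * s) ^ CARD('n)) < (\<integral>\<^sup>+y\<in>cube c s. h y \<partial>lborel)"
    proof -
      have "t * ennreal ((2 * s) ^ CARD('n)) < (\<integral>\<^sup>+y\<in>cube c r. h y \<partial>lborel)"
        using b(2)[OF s] t' s r by (simp add: ennreal_mult)
      also have "\<dots> \<le> (\<integral>\<^sup>+y\<in>cube c s. h y \<partial>lborel)"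
        using cube_mono[of r s c] s by (intro nn_set_integral_set_mono) auto
      finally show ?thesis .
    qed
    ultimately show "y \<in> {x. t < cube_max h x}"
      using s r by (auto simp: less_cube_max_iff intro!: exI[of _ c] exI[of _ s])
  qed
  then show "\<exists>e>0. ball x e \<subseteq> {x. t < cube_max h x}"
    using s by (intro exI[of _ "s - r"]) auto
qed

lemma borel_measurable_cube_max [measurable]: "cube_max h \<in> borel_measurable borel"
  by (rule borel_measurableI_greater) (simp add: open_cube_max_superlevel)

text \<open>Every point of the superlevel set lies in a cube whose average exceeds \<open>t\<close>.
  Dilating a disjoint subfamily costs the factor \<open>5 * n\<close> to the power \<open>n\<close>,
  and the volumes of the disjoint cubes add up to at most the integral of \<open>h\<close> divided
  by \<open>t\<close>. An infinite integral is set aside because the Vitali lemma requires bounded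
  radii.\<close>

lemma cube_max_weak_type:
  fixes h :: "real ^ 'n \<Rightarrow> ennreal"
  assumes [measurable]: "h \<in> borel_measurable borel" and t: "t > 0"
  shows "emeasure lborel {x. ennreal t < cube_max h x}
    \<le> ennreal ((5 * real CARD('n)) ^ CARD('n) / t) * (\<integral>\<^sup>+x. h x \<partial>lborel)"
proof (cases "(\<integral>\<^sup>+x. h x \<partial>lborel) = top")
  case True
  then show ?thesis using t by (simp add: ennreal_mult_top)
next
  case False
  then obtain I where I: "(\<integral>\<^sup>+x. h x \<partial>lborel) = ennreal I" "I \<ge> 0"
    by (cases "\<integral>\<^sup>+x. h x \<partial>lborel") auto
  let ?n = "real CARD('n)"
  define K where "K = {(c, r). 0 < r \<and> ennreal t * ennreal ((2 * r) ^ CARD('n)) < (\<integral>\<^sup>+y\<in>cube c r. h y \<partial>lborel)}"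
  have bnd: "0 < r \<and> r \<le> 1 + I / t" if "(c, r) \<in> K" for c r
  proof
    show r: "0 < r" using that by (simp add: K_def)
    have "ennreal (t * (2 * r) ^ CARD('n)) < (\<integral>\<^sup>+y\<in>cube c r. h y \<partial>lborel)"
      using that t r by (simp add: K_def ennreal_mult)
    also have "\<dots> \<le> ennreal I"
      unfolding I(1)[symmetric] by (intro nn_integral_mono) (auto split: split_indicator)
    finally have "t * (2 * r) ^ CARD('n) < I"
      using t r by (subst (asm) ennreal_less_iff) auto
    then have "(2 * r) ^ CARD('n) \<le> I / t"
      using t by (simp add: field_simps)
    \<comment> \<open>The bound on the volume becomes a bound on the radius without taking roots;
      the summand \<open>1\<close> in \<open>1 + I / t\<close> covers the cubes with
      \<open>2 * r < 1\<close>.\<close>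
    moreover have "2 * r \<le> (2 * r) ^ CARD('n)" if "2 * r \<ge> 1"
      using that self_le_power[of "2 * r" "CARD('n)"] by simp
    ultimately show "r \<le> 1 + I / t"
      using I t r by (cases "2 * r \<ge> 1") (auto simp: add_increasing2)
  qed
  obtain C where C: "countable C" "C \<subseteq> K" "disjoint_family_on (\<lambda>(c, r). cube c r) C"
    "(\<Union>(c, r)\<in>K. cube c r) \<subseteq> (\<Union>(c, r)\<in>C. cube c (5 * ?n * r))"
    by (rule Vitali_cubes[OF bnd])
  have "{x. ennreal t < cube_max h x} \<subseteq> (\<Union>(c, r)\<in>C. cube c (5 * ?n * r))"
    using C(4) by (auto simp: less_cube_max_iff K_def)
  then have "emeasure lborel {x. ennreal t < cube_max h x}
      \<le> (\<integral>\<^sup>+i. (\<integral>\<^sup>+x\<in>(case i of (c, r) \<Rightarrow> cube c (5 * ?n * r)). 1 \<partial>lborel) \<partial>count_space C)"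
    using nn_integral_UN_le_count[OF C(1), of "\<lambda>(c, r). cube c (5 * ?n * r)" lborel "\<lambda>_. 1" "{x. ennreal t < cube_max h x}"]
    by (auto simp: case_prod_beta)
  also have "\<dots> \<le> (\<integral>\<^sup>+i. ennreal ((5 * ?n) ^ CARD('n) / t) *
       (\<integral>\<^sup>+x\<in>(case i of (c, r) \<Rightarrow> cube c r). h x \<partial>lborel) \<partial>count_space C)"
  proof (rule nn_integral_mono)
    fix i assume i: "i \<in> space (count_space C)"
    obtain c r where icr: "i = (c, r)" by (cases i)
    then have cr: "(c, r) \<in> K" using C i by auto
    then have r: "r > 0" by (simp add: K_def)
    have "emeasure lborel (cube c (5 * ?n * r)) = ennreal ((5 * ?n) ^ CARD('n) / t * (t * (2 * r) ^ CARD('n)))"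
    proof -
      have "2 * (5 * ?n * r) = (5 * ?n) * (2 * r)" by simp
      then have "(2 * (5 * ?n * r)) ^ CARD('n) = (5 * ?n) ^ CARD('n) * (2 * r) ^ CARD('n)"
        by (simp only: power_mult_distrib)
      then show ?thesis
        using r t by (subst emeasure_cube) auto
    qed
    also have "\<dots> = ennreal ((5 * ?n) ^ CARD('n) / t) * (ennreal t * ennreal ((2 * r) ^ CARD('n)))"
      using r t by (simp flip: ennreal_mult)
    also have "\<dots> \<le> ennreal ((5 * ?n) ^ CARD('n) / t) * (\<integral>\<^sup>+x\<in>cube c r. h x \<partial>lborel)"
      using cr by (intro mult_left_mono) (auto simp: K_def less_imp_le)
    finally show "(\<integral>\<^sup>+x\<in>(case i of (c, r) \<Rightarrow> cube c (5 * ?n * r)). 1 \<partial>lborel) \<le> ennreal ((5 * ?n) ^ CARD('n) / t) *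
       (\<integral>\<^sup>+x\<in>(case i of (c, r) \<Rightarrow> cube c r). h x \<partial>lborel)"
      by (simp only: icr prod.case) simp
  qed
  also have "\<dots> = ennreal ((5 * ?n) ^ CARD('n) / t) *
       (\<integral>\<^sup>+i. (\<integral>\<^sup>+x\<in>(case i of (c, r) \<Rightarrow> cube c r). h x \<partial>lborel) \<partial>count_space C)"
    by (rule nn_integral_cmult) simp
  also have "\<dots> \<le> ennreal ((5 * ?n) ^ CARD('n) / t) * (\<integral>\<^sup>+x\<in>UNIV. h x \<partial>lborel)"
    by (intro mult_left_mono nn_integral_disjoint_count_le C) (auto simp: case_prod_beta)
  finally show ?thesis by simp
qed

subsection \<open>Kolmogorov's inequality\<close>

lemma nn_integral_powr_from_0:
  fixes a r :: real
  assumes "a > -1" "r \<ge> 0"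
  shows "(\<integral>\<^sup>+t\<in>{0..r}. ennreal (t powr a) \<partial>lborel) = ennreal (r powr (a + 1) / (a + 1))"
  using nn_integral_has_integral_lebesgue'[OF _ has_integral_powr_from_0[OF assms]] by simp

lemma nn_integral_powr_to_inf:
  fixes e r :: real
  assumes "e < -1" "r > 0"
  shows "(\<integral>\<^sup>+t\<in>{r..}. ennreal (t powr e) \<partial>lborel) = ennreal (- (r powr (e + 1)) / (e + 1))"
  using nn_integral_has_integral_lebesgue'[OF _ has_integral_powr_to_inf[OF assms]] by simp

text \<open>This writes a negative power of \<open>r\<close> as a superposition of indicators of
  half-lines, hence a Riesz kernel as a superposition of indicators of cubes. Only an inequality
  holds at \<open>r = 0\<close>: the integral diverges there, whereas
  \<open>0 powr (- s) = 0\<close>.\<close>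

lemma nn_integral_powr_to_inf':
  fixes s r :: real
  assumes "s > 0" "r \<ge> 0"
  shows "(\<integral>\<^sup>+t\<in>{r..}. ennreal (s * t powr (- s - 1)) \<partial>lborel) \<ge> ennreal (r powr (- s))"
proof (cases "r = 0")
  case False
  then have "(\<integral>\<^sup>+t\<in>{r..}. ennreal (s * t powr (- s - 1)) \<partial>lborel)
    = ennreal s * (\<integral>\<^sup>+t\<in>{r..}. ennreal (t powr (- s - 1)) \<partial>lborel)"
    using assms by (simp add: ennreal_mult mult.assoc nn_integral_cmult)
  also have "\<dots> = ennreal (r powr (- s))"
    using False assms by (subst nn_integral_powr_to_inf) (auto simp: field_simps simp flip: ennreal_mult)
  finally show ?thesis by simp
qed simp

text \<open>The value \<open>v = top\<close> has to be covered because a maximal function may be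
  infinite at some points.\<close>

lemma epowr_layer_cake:
  assumes c: "c > 0"
  shows "epowr v c = (\<integral>\<^sup>+t\<in>{0<..}. ennreal (c * t powr (c - 1)) * indicator {t. ennreal t < v} t \<partial>lborel)"
proof -
  have fin: "(\<integral>\<^sup>+t\<in>{0<..}. ennreal (c * t powr (c - 1)) * indicator {t. ennreal t < ennreal r} t \<partial>lborel) = ennreal (r powr c)"
    if "r \<ge> 0" for r
  proof -
    have "(\<integral>\<^sup>+t\<in>{0<..}. ennreal (c * t powr (c - 1)) * indicator {t. ennreal t < ennreal r} t \<partial>lborel)
       = (\<integral>\<^sup>+t. ennreal c * (ennreal (t powr (c - 1)) * indicator {0..r} t) \<partial>lborel)"
    proof (rule nn_integral_cong_AE)
      have "AE t in lborel. t \<noteq> r \<and> t \<noteq> 0"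
        using AE_lborel_singleton[of r] AE_lborel_singleton[of "0::real"] by eventually_elim simp
      then show "AE t in lborel. ennreal (c * t powr (c - 1)) * indicator {t. ennreal t < ennreal r} t * indicator {0<..} t
         = ennreal c * (ennreal (t powr (c - 1)) * indicator {0..r} t)"
        by eventually_elim (use c that in \<open>auto simp: ennreal_mult ennreal_less_iff split: split_indicator\<close>)
    qed
    also have "\<dots> = ennreal c * ennreal (r powr c / c)"
      using c that nn_integral_powr_from_0[of "c - 1" r] by (subst nn_integral_cmult) auto
    also have "\<dots> = ennreal (r powr c)"
      using c by (simp flip: ennreal_mult)
    finally show ?thesis .
  qed
  show ?thesis
  proof (cases "v = top")
    case False
    then obtain r where "r \<ge> 0" "v = ennreal r" by (cases v) auto
    then show ?thesis using fin[of r] c by (simp add: epowr_ennreal_nonneg)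
  next
    case True
    let ?I = "\<integral>\<^sup>+t\<in>{0<..}. ennreal (c * t powr (c - 1)) * indicator {t. ennreal t < v} t \<partial>lborel"
    \<comment> \<open>The level \<open>y powr (1 / c)\<close> is chosen so that the finite case
      evaluates to \<open>y\<close>; thus \<open>?I\<close> exceeds every real number.\<close>
    have ge: "ennreal y \<le> ?I" if "y \<ge> 0" for y
    proof -
      have "ennreal y = ennreal ((y powr (1 / c)) powr c)"
        using c that by (simp add: powr_powr)
      also have "\<dots> \<le> ?I"
        unfolding fin[of "y powr (1 / c)", OF powr_ge_zero, symmetric]
        by (intro nn_integral_mono) (auto simp: True split: split_indicator)
      finally show ?thesis .
    qed
    have "?I = top"
    proof (rule ccontr)
      assume "?I \<noteq> top"
      then obtain z where "z \<ge> 0" "?I = ennreal z" by (cases ?I) auto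
      then show False using ge[of "z + 1"] by simp
    qed
    then show ?thesis using True c by (simp add: epowr_top_base)
  qed
qed

lemma nn_integral_epowr_layer_cake:
  fixes f :: "'a::euclidean_space \<Rightarrow> ennreal"
  assumes c: "c > 0" and [measurable]: "f \<in> borel_measurable borel" "h \<in> borel_measurable borel"
  shows "(\<integral>\<^sup>+x. epowr (f x) c * h x \<partial>lborel) =
    (\<integral>\<^sup>+t\<in>{0<..}. ennreal (c * t powr (c - 1)) * (\<integral>\<^sup>+x\<in>{x. ennreal t < f x}. h x \<partial>lborel) \<partial>lborel)"
proof -
  have "(\<integral>\<^sup>+x. epowr (f x) c * h x \<partial>lborel) =
    (\<integral>\<^sup>+x. (\<integral>\<^sup>+t. ennreal (c * t powr (c - 1)) * indicator {0<..} t * (h x * indicator {x. ennreal t < f x} x) \<partial>lborel) \<partial>lborel)"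
  proof (rule nn_integral_cong)
    fix x
    have "epowr (f x) c * h x = (\<integral>\<^sup>+t. ennreal (c * t powr (c - 1)) * indicator {t. ennreal t < f x} t * indicator {0<..} t * h x \<partial>lborel)"
      by (subst epowr_layer_cake[OF c], subst nn_integral_multc) auto
    also have "\<dots> = (\<integral>\<^sup>+t. ennreal (c * t powr (c - 1)) * indicator {0<..} t * (h x * indicator {x. ennreal t < f x} x) \<partial>lborel)"
      by (intro nn_integral_cong) (auto split: split_indicator)
    finally show "epowr (f x) c * h x = \<dots>" .
  qed
  also have "\<dots> = (\<integral>\<^sup>+t. (\<integral>\<^sup>+x. ennreal (c * t powr (c - 1)) * indicator {0<..} t * (h x * indicator {x. ennreal t < f x} x) \<partial>lborel) \<partial>lborel)"
    by (rule lborel_pair.Fubini') measurable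
  also have "\<dots> = (\<integral>\<^sup>+t\<in>{0<..}. ennreal (c * t powr (c - 1)) * (\<integral>\<^sup>+x\<in>{x. ennreal t < f x}. h x \<partial>lborel) \<partial>lborel)"
    by (intro nn_integral_cong) (subst nn_integral_cmult, auto simp: mult_ac)
  finally show ?thesis .
qed

text \<open>In the application \<open>X\<close> is the volume of a cube and \<open>Y / t\<close> the
  weak-type bound. Convergence at the origin uses \<open>c > 0\<close> and at infinity
  \<open>c < 1\<close>; the two parts contribute the same product of powers with the coefficients
  \<open>1\<close> and \<open>c / (1 - c)\<close>, which add up to
  \<open>1 / (1 - c)\<close>.\<close>

lemma nn_integral_min_powr:
  fixes X Y c :: real
  assumes X: "X > 0" and Y: "Y > 0" and c: "0 < c" "c < 1"
  shows "(\<integral>\<^sup>+t\<in>{0<..}. ennreal (c * t powr (c - 1)) * min (ennreal X) (ennreal (Y / t)) \<partial>lborel)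
    \<le> ennreal (X powr (1 - c) * Y powr c / (1 - c))"
proof -
  \<comment> \<open>The level at which the two terms of the minimum coincide.\<close>
  define R where "R = Y / X"
  have R: "R > 0" using X Y by (simp add: R_def)
  have "(\<integral>\<^sup>+t\<in>{0<..}. ennreal (c * t powr (c - 1)) * min (ennreal X) (ennreal (Y / t)) \<partial>lborel)
    \<le> (\<integral>\<^sup>+t. ennreal (c * X) * (ennreal (t powr (c - 1)) * indicator {0..R} t)
            + ennreal (c * Y) * (ennreal (t powr (c - 2)) * indicator {R..} t) \<partial>lborel)"
  proof (rule nn_integral_mono)
    fix t :: real
    show "ennreal (c * t powr (c - 1)) * min (ennreal X) (ennreal (Y / t)) * indicator {0<..} t \<le>
       ennreal (c * X) * (ennreal (t powr (c - 1)) * indicator {0..R} t)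
            + ennreal (c * Y) * (ennreal (t powr (c - 2)) * indicator {R..} t)"
    proof (cases "t > 0")
      case t: True
      show ?thesis
      proof (cases "t \<le> R")
        case True
        have "ennreal (c * t powr (c - 1)) * min (ennreal X) (ennreal (Y / t)) \<le> ennreal (c * t powr (c - 1)) * ennreal X"
          by (intro mult_left_mono) auto
        also have "\<dots> = ennreal (c * X) * ennreal (t powr (c - 1))"
          using c X by (simp add: mult_ac flip: ennreal_mult)
        finally show ?thesis using True t by (simp add: add_increasing2)
      next
        case False
        have "ennreal (c * t powr (c - 1)) * min (ennreal X) (ennreal (Y / t)) \<le> ennreal (c * t powr (c - 1)) * ennreal (Y / t)"
          by (intro mult_left_mono) auto
        also have "\<dots> = ennreal (c * Y * t powr (c - 2))"
        proof -
          have "t powr (c - 1) = t powr (c - 2) * t"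
            using t powr_add[of t "c - 2" 1] by simp
          then show ?thesis
            using c Y t by (simp add: mult_ac flip: ennreal_mult)
        qed
        finally show ?thesis using False t c Y by (simp add: ennreal_mult)
      qed
    qed simp
  qed
  also have "\<dots> = ennreal (c * X) * ennreal (R powr c / c) + ennreal (c * Y) * ennreal (- (R powr (c - 1)) / (c - 1))"
    using c R nn_integral_powr_from_0[of "c - 1" R] nn_integral_powr_to_inf[of "c - 2" R]
    by (subst nn_integral_add) (auto simp: nn_integral_cmult)
  also have "\<dots> = ennreal (X * R powr c + c * Y * (R powr (c - 1) / (1 - c)))"
  proof -
    have "- (R powr (c - 1)) / (c - 1) = R powr (c - 1) / (1 - c)"
      using c by (simp add: field_simps)
    then show ?thesis
      using c X Y by (simp flip: ennreal_mult ennreal_plus)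
  qed
  also have "X * R powr c + c * Y * (R powr (c - 1) / (1 - c)) = X powr (1 - c) * Y powr c / (1 - c)"
  proof -
    have 1: "X * R powr c = X powr (1 - c) * Y powr c"
      using X Y by (simp add: R_def powr_divide powr_diff)
    have 2: "Y * R powr (c - 1) = X powr (1 - c) * Y powr c"
      using X Y by (simp add: R_def powr_divide powr_diff)
    have "c * Y * (R powr (c - 1) / (1 - c)) = c * (Y * R powr (c - 1)) / (1 - c)" by simp
    then have "c * Y * (R powr (c - 1) / (1 - c)) = c * (X powr (1 - c) * Y powr c) / (1 - c)"
      unfolding 2 .
    then show ?thesis unfolding 1 using c by (simp add: field_simps)
  qed
  finally show ?thesis .
qed

text \<open>The distribution function of \<open>cube_max h\<close> on a cube is at most the volume
  of the cube and also obeys the weak-type bound; the layer cake formula integrates the smaller of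
  the two.\<close>

lemma cube_max_Kolmogorov_local:
  fixes h :: "real ^ 'n \<Rightarrow> ennreal"
  assumes [measurable]: "h \<in> borel_measurable borel" and c: "0 < c" "c < 1" and r: "r > 0"
  shows "(\<integral>\<^sup>+y\<in>cube x r. epowr (cube_max h y) c \<partial>lborel)
    \<le> ennreal (((2 * r) ^ CARD('n)) powr (1 - c) * ((5 * real CARD('n)) ^ CARD('n)) powr c / (1 - c))
       * epowr (\<integral>\<^sup>+y. h y \<partial>lborel) c"
proof -
  let ?V = "(2 * r) ^ CARD('n)" and ?K = "(5 * real CARD('n)) ^ CARD('n)"
  have V: "?V > 0" and K: "?K > 0" using r by auto
  let ?I = "\<integral>\<^sup>+y. h y \<partial>lborel"
  have weak: "emeasure lborel {y \<in> cube x r. ennreal t < cube_max h y} \<le> min (ennreal ?V) (ennreal (?K / t) * ?I)"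
    if "t > 0" for t
  proof (rule min.boundedI)
    have "emeasure lborel {y \<in> cube x r. ennreal t < cube_max h y} \<le> emeasure lborel (cube x r)"
      by (intro emeasure_mono) auto
    then show "emeasure lborel {y \<in> cube x r. ennreal t < cube_max h y} \<le> ennreal ?V"
      using r by (simp only: emeasure_cube less_imp_le)
    have "emeasure lborel {y \<in> cube x r. ennreal t < cube_max h y} \<le> emeasure lborel {y. ennreal t < cube_max h y}"
      by (intro emeasure_mono) auto
    also have "\<dots> \<le> ennreal (?K / t) * ?I"
      by (rule cube_max_weak_type) (use that in auto)
    finally show "emeasure lborel {y \<in> cube x r. ennreal t < cube_max h y} \<le> ennreal (?K / t) * ?I" .
  qed
  have "(\<integral>\<^sup>+y\<in>cube x r. epowr (cube_max h y) c \<partial>lborel) =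
    (\<integral>\<^sup>+t\<in>{0<..}. ennreal (c * t powr (c - 1)) * emeasure lborel {y \<in> cube x r. ennreal t < cube_max h y} \<partial>lborel)"
    by (subst nn_integral_epowr_layer_cake[OF c(1)])
       (auto simp flip: nn_integral_indicator intro!: nn_integral_cong arg_cong2[where f = times] split: split_indicator)
  also have "\<dots> \<le> (\<integral>\<^sup>+t\<in>{0<..}. ennreal (c * t powr (c - 1)) * min (ennreal ?V) (ennreal (?K / t) * ?I) \<partial>lborel)"
    using weak by (intro nn_integral_mono) (auto intro!: mult_left_mono split: split_indicator)
  also have "\<dots> \<le> ennreal (?V powr (1 - c) * ?K powr c / (1 - c)) * epowr ?I c"
  proof (cases ?I rule: ennreal_cases3)
    case 1
    then show ?thesis by simp
  next
    case 2
    have "?V powr (1 - c) > 0" "?K powr c > 0"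
      using V K by (metis powr_gt_zero less_irrefl)+
    then have "?V powr (1 - c) * ?K powr c / (1 - c) > 0"
      using c by (intro divide_pos_pos mult_pos_pos) auto
    moreover have "ennreal z * epowr ?I c = top" if "z > 0" for z
      using that 2 c by (simp add: epowr_top_base ennreal_mult_top)
    ultimately have "ennreal (?V powr (1 - c) * ?K powr c / (1 - c)) * epowr ?I c = top" by blast
    then show ?thesis by (simp only: top_greatest)
  next
    case (3 I)
    have "(\<integral>\<^sup>+t\<in>{0<..}. ennreal (c * t powr (c - 1)) * min (ennreal ?V) (ennreal (?K / t) * ?I) \<partial>lborel)
       = (\<integral>\<^sup>+t\<in>{0<..}. ennreal (c * t powr (c - 1)) * min (ennreal ?V) (ennreal (?K * I / t)) \<partial>lborel)"
      using 3 K by (intro nn_integral_cong) (auto split: split_indicator simp flip: ennreal_mult)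
    also have "\<dots> \<le> ennreal (?V powr (1 - c) * (?K * I) powr c / (1 - c))"
      by (rule nn_integral_min_powr) (use V K 3 c in auto)
    also have "\<dots> = ennreal (?V powr (1 - c) * ?K powr c / (1 - c)) * epowr ?I c"
    proof -
      have "(?K * I) powr c = ?K powr c * I powr c"
        by (rule powr_mult)
      then show ?thesis
        using 3 c V K by (simp only: epowr_ennreal) (subst ennreal_mult[symmetric], auto)
    qed
    finally show ?thesis .
  qed
  finally show ?thesis .
qed

text \<open>A cube of half-side \<open>s \<le> r\<close> through \<open>y\<close> stays in
  \<open>cube x (3 * r)\<close> and sees only the restriction of \<open>h\<close>. One with
  \<open>s > r\<close> lies in \<open>cube x (3 * s)\<close>, so its average is at most
  \<open>3 ^ n\<close> times the maximal function at \<open>x\<close>; it is also at most the total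
  integral over \<open>r ^ n\<close>. The large cubes therefore contribute a bound that is the same
  for all \<open>y\<close> in \<open>cube x r\<close>.\<close>

lemma cube_max_le_local:
  fixes h :: "real ^ 'n \<Rightarrow> ennreal"
  assumes [measurable]: "h \<in> borel_measurable borel" and r: "r > 0" and y: "y \<in> cube x r"
  shows "cube_max h y \<le> max (cube_max (\<lambda>z. h z * indicator (cube x (3 * r)) z) y)
     (ennreal (3 ^ CARD('n)) * min (cube_max h x) ((\<integral>\<^sup>+z. h z \<partial>lborel) / ennreal (r ^ CARD('n))))"
    (is "_ \<le> max ?f (_ * min ?M (?I / _))")
proof (rule cube_max_leI)
  fix c s assume s: "0 < s" "y \<in> cube c s"
  let ?V = "ennreal ((2 * s) ^ CARD('n))"
  show "(\<integral>\<^sup>+z\<in>cube c s. h z \<partial>lborel) \<le>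
    max ?f (ennreal (3 ^ CARD('n)) * min ?M (?I / ennreal (r ^ CARD('n)))) * ?V"
  proof (cases "s \<le> r")
    case True
    have "infnorm (c - x) \<le> s + r"
      using s(2) y infnorm_triangle_diff[of c x y] by (simp add: mem_cube infnorm_sub[of c y])
    then have "cube c s \<subseteq> cube x (3 * r)"
      using True r by (intro cube_subset) simp
    then have "(\<integral>\<^sup>+z\<in>cube c s. h z \<partial>lborel) = (\<integral>\<^sup>+z\<in>cube c s. h z * indicator (cube x (3 * r)) z \<partial>lborel)"
      by (intro nn_integral_cong) (auto split: split_indicator)
    also have "\<dots> \<le> ?f * ?V"
      by (rule cube_integral_le_max) (use s in auto)
    finally show ?thesis by (rule order_trans) (intro mult_right_mono, auto)
  next
    case False
    then have rs: "r < s" by simp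
    have "infnorm (c - x) \<le> s + r"
      using s(2) y infnorm_triangle_diff[of c x y] by (simp add: mem_cube infnorm_sub[of c y])
    then have sub: "cube c s \<subseteq> cube x (3 * s)"
      using rs r by (intro cube_subset) simp
    have "(\<integral>\<^sup>+z\<in>cube c s. h z \<partial>lborel) \<le> (\<integral>\<^sup>+z\<in>cube x (3 * s). h z \<partial>lborel)"
      using sub by (intro nn_set_integral_set_mono) auto
    also have "\<dots> \<le> ?M * ennreal ((2 * (3 * s)) ^ CARD('n))"
      by (rule cube_integral_le_max) (use s in \<open>auto intro!: center_in_cube\<close>)
    also have "\<dots> = ennreal (3 ^ CARD('n)) * ?M * ?V"
    proof -
      have "2 * (3 * s) = 3 * (2 * s)" by simp
      then have "(2 * (3 * s)) ^ CARD('n) = 3 ^ CARD('n) * (2 * s) ^ CARD('n)"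
        by (simp only: power_mult_distrib)
      then show ?thesis using s by (simp only:) (subst ennreal_mult, auto simp: mult_ac)
    qed
    finally have A: "(\<integral>\<^sup>+z\<in>cube c s. h z \<partial>lborel) \<le> ennreal (3 ^ CARD('n)) * ?M * ?V" .
    have "(\<integral>\<^sup>+z\<in>cube c s. h z \<partial>lborel) \<le> ?I"
      by (intro nn_integral_mono) (auto split: split_indicator)
    also have "\<dots> = ?I / ennreal (r ^ CARD('n)) * ennreal (r ^ CARD('n))"
      using r by (simp only: ennreal_divide_times) (simp add: divide_ennreal)
    also have "\<dots> \<le> ?I / ennreal (r ^ CARD('n)) * ?V"
      using rs r by (intro mult_left_mono ennreal_leI power_mono) auto
    also have "\<dots> \<le> ennreal (3 ^ CARD('n)) * (?I / ennreal (r ^ CARD('n))) * ?V"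
    proof (intro mult_right_mono)
      have "1 \<le> ennreal (3 ^ CARD('n))" by (simp flip: ennreal_1)
      then show "?I / ennreal (r ^ CARD('n)) \<le> ennreal (3 ^ CARD('n)) * (?I / ennreal (r ^ CARD('n)))"
        using mult_right_mono[of 1 "ennreal (3 ^ CARD('n))" "?I / ennreal (r ^ CARD('n))"] by simp
    qed auto
    finally have B: "(\<integral>\<^sup>+z\<in>cube c s. h z \<partial>lborel) \<le> ennreal (3 ^ CARD('n)) * (?I / ennreal (r ^ CARD('n))) * ?V" .
    have "(\<integral>\<^sup>+z\<in>cube c s. h z \<partial>lborel) \<le> ennreal (3 ^ CARD('n)) * min ?M (?I / ennreal (r ^ CARD('n))) * ?V"
      using A B by (cases "?M \<le> ?I / ennreal (r ^ CARD('n))") (auto simp only: min_def if_True if_False)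
    also have "\<dots> \<le> max ?f (ennreal (3 ^ CARD('n)) * min ?M (?I / ennreal (r ^ CARD('n)))) * ?V"
      by (intro mult_right_mono) auto
    finally show ?thesis .
  qed
qed

text \<open>The local part falls under the preceding Kolmogorov estimate and the remaining part is
  constant on the cube. Both scale alike, because the integral of the restricted function is at most
  \<open>(6 * r) ^ n\<close> times the same minimum \<open>m\<close>.\<close>

lemma cube_max_Kolmogorov:
  fixes c :: real
  assumes c: "0 < c" "c < 1"
  obtains D where "D > 0"
    "\<And>(h :: real ^ 'n \<Rightarrow> ennreal) x r. h \<in> borel_measurable borel \<Longrightarrow> r > 0 \<Longrightarrow>
       (\<integral>\<^sup>+y\<in>cube x r. epowr (cube_max h y) c \<partial>lborel) \<le> ennreal (D * r ^ CARD('n)) *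
          epowr (min (cube_max h x) ((\<integral>\<^sup>+z. h z \<partial>lborel) / ennreal (r ^ CARD('n)))) c"
proof -
  let ?N = "CARD('n)"
  let ?K = "(5 * real ?N) ^ ?N"
  \<comment> \<open>\<open>D1\<close> belongs to the local part, its last factor coming from the
    side \<open>6 * r\<close> of \<open>cube x (3 * r)\<close>; \<open>D2\<close> is the volume
    factor times the power of the bound \<open>3 ^ n\<close> for large cubes.\<close>
  define D1 where "D1 = (2 ^ ?N) powr (1 - c) * ?K powr c / (1 - c) * (6 ^ ?N) powr c"
  define D2 where "D2 = 2 ^ ?N * (3 ^ ?N) powr c"
  have D: "D1 > 0" "D2 > 0" using c by (auto simp: D1_def D2_def)
  show ?thesis
  proof (rule that[of "D1 + D2"])
    show "D1 + D2 > 0" using D by simp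
    fix h :: "real ^ 'n \<Rightarrow> ennreal" and x :: "real ^ 'n" and r :: real
    assume [measurable]: "h \<in> borel_measurable borel" and r: "r > 0"
    let ?I = "\<integral>\<^sup>+z. h z \<partial>lborel"
    define m where "m = min (cube_max h x) (?I / ennreal (r ^ ?N))"
    define h' where "h' = (\<lambda>z. h z * indicator (cube x (3 * r)) z)"
    have [measurable]: "h' \<in> borel_measurable borel" by (simp add: h'_def)
    have h': "(\<integral>\<^sup>+z. h' z \<partial>lborel) \<le> ennreal (6 ^ ?N * r ^ ?N) * m"
    proof -
      have "(\<integral>\<^sup>+z. h' z \<partial>lborel) \<le> cube_max h x * ennreal ((2 * (3 * r)) ^ ?N)"
        unfolding h'_def by (rule cube_integral_le_max) (use r in \<open>auto intro!: center_in_cube\<close>)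
      also have "\<dots> = ennreal (6 ^ ?N * r ^ ?N) * cube_max h x"
      proof -
        have "2 * (3 * r) = 6 * r" by simp
        then show ?thesis by (simp only: power_mult_distrib mult.commute)
      qed
      finally have 1: "(\<integral>\<^sup>+z. h' z \<partial>lborel) \<le> ennreal (6 ^ ?N * r ^ ?N) * cube_max h x" .
      have "(\<integral>\<^sup>+z. h' z \<partial>lborel) \<le> ?I"
        unfolding h'_def by (intro nn_integral_mono) (auto split: split_indicator)
      also have "\<dots> = ennreal (r ^ ?N) * (?I / ennreal (r ^ ?N))"
        using r by (subst mult.commute) (simp only: ennreal_divide_times, simp add: divide_ennreal)
      also have "\<dots> \<le> ennreal (6 ^ ?N * r ^ ?N) * (?I / ennreal (r ^ ?N))"
        using r by (intro mult_right_mono ennreal_leI) auto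
      finally have 2: "(\<integral>\<^sup>+z. h' z \<partial>lborel) \<le> ennreal (6 ^ ?N * r ^ ?N) * (?I / ennreal (r ^ ?N))" .
      show ?thesis using 1 2 unfolding m_def min_def by (simp only: split: if_split) simp
    qed
    have "(\<integral>\<^sup>+y\<in>cube x r. epowr (cube_max h y) c \<partial>lborel)
      \<le> (\<integral>\<^sup>+y\<in>cube x r. (epowr (cube_max h' y) c + epowr (ennreal (3 ^ ?N) * m) c) \<partial>lborel)"
    proof (intro nn_integral_mono)
      fix y
      show "epowr (cube_max h y) c * indicator (cube x r) y
        \<le> (epowr (cube_max h' y) c + epowr (ennreal (3 ^ ?N) * m) c) * indicator (cube x r) y"
      proof (cases "y \<in> cube x r")
        case True
        have "cube_max h y \<le> max (cube_max h' y) (ennreal (3 ^ ?N) * m)"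
          unfolding h'_def m_def by (rule cube_max_le_local[OF _ r True]) measurable
        then have "epowr (cube_max h y) c \<le> epowr (max (cube_max h' y) (ennreal (3 ^ ?N) * m)) c"
          using c by (intro epowr_mono) auto
        also have "\<dots> \<le> epowr (cube_max h' y) c + epowr (ennreal (3 ^ ?N) * m) c"
          by (auto simp: max_def)
        finally show ?thesis using True by simp
      qed simp
    qed
    also have "\<dots> = (\<integral>\<^sup>+y\<in>cube x r. epowr (cube_max h' y) c \<partial>lborel) + epowr (ennreal (3 ^ ?N) * m) c * emeasure lborel (cube x r)"
      by (simp add: distrib_right nn_integral_add nn_integral_cmult)
    also have "\<dots> \<le> ennreal (D1 * r ^ ?N) * epowr m c + ennreal (D2 * r ^ ?N) * epowr m c"
    proof (rule add_mono)
      have "(\<integral>\<^sup>+y\<in>cube x r. epowr (cube_max h' y) c \<partial>lborel)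
        \<le> ennreal (((2 * r) ^ ?N) powr (1 - c) * ?K powr c / (1 - c)) * epowr (\<integral>\<^sup>+y. h' y \<partial>lborel) c"
        by (rule cube_max_Kolmogorov_local) (use c r in auto)
      also have "\<dots> \<le> ennreal (((2 * r) ^ ?N) powr (1 - c) * ?K powr c / (1 - c)) * epowr (ennreal (6 ^ ?N * r ^ ?N) * m) c"
        using c h' by (intro mult_left_mono epowr_mono) auto
      also have "\<dots> = ennreal (((2 * r) ^ ?N) powr (1 - c) * ?K powr c / (1 - c)) * (ennreal ((6 ^ ?N * r ^ ?N) powr c) * epowr m c)"
        using c r by (subst epowr_mult) (auto simp: epowr_ennreal)
      also have "\<dots> = ennreal (((2 * r) ^ ?N) powr (1 - c) * ?K powr c / (1 - c) * (6 ^ ?N * r ^ ?N) powr c) * epowr m c"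
        using c r by (subst ennreal_mult) (auto simp: mult.assoc)
      also have "((2 * r) ^ ?N) powr (1 - c) * ?K powr c / (1 - c) * (6 ^ ?N * r ^ ?N) powr c = D1 * r ^ ?N"
      proof -
        have a: "((2 * r) ^ ?N) powr (1 - c) = (2 ^ ?N) powr (1 - c) * (r ^ ?N) powr (1 - c)"
          by (simp only: power_mult_distrib powr_mult)
        have b: "(6 ^ ?N * r ^ ?N) powr c = (6 ^ ?N) powr c * (r ^ ?N) powr c"
          by (simp only: powr_mult)
        have "(r ^ ?N) powr (1 - c) * (r ^ ?N) powr c = r ^ ?N"
          using r by (simp flip: powr_add)
        then show ?thesis unfolding a b D1_def by (simp add: field_simps)
      qed
      finally show "(\<integral>\<^sup>+y\<in>cube x r. epowr (cube_max h' y) c \<partial>lborel) \<le> ennreal (D1 * r ^ ?N) * epowr m c" .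
      have "epowr (ennreal (3 ^ ?N) * m) c * emeasure lborel (cube x r) = ennreal ((3 ^ ?N) powr c) * epowr m c * ennreal (2 ^ ?N * r ^ ?N)"
        using c r by (subst epowr_mult) (auto simp: epowr_ennreal emeasure_cube power_mult_distrib)
      also have "\<dots> = ennreal (D2 * r ^ ?N) * epowr m c"
      proof -
        have "ennreal ((3 ^ ?N) powr c) * epowr m c * ennreal (2 ^ ?N * r ^ ?N)
          = (ennreal ((3 ^ ?N) powr c) * ennreal (2 ^ ?N * r ^ ?N)) * epowr m c" by (simp only: mult_ac)
        also have "ennreal ((3 ^ ?N) powr c) * ennreal (2 ^ ?N * r ^ ?N) = ennreal (D2 * r ^ ?N)"
          unfolding D2_def using r by (subst ennreal_mult[symmetric]) (auto simp: mult_ac)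
        finally show ?thesis .
      qed
      finally show "epowr (ennreal (3 ^ ?N) * m) c * emeasure lborel (cube x r) \<le> ennreal (D2 * r ^ ?N) * epowr m c" by simp
    qed
    also have "\<dots> = ennreal ((D1 + D2) * r ^ ?N) * epowr m c"
      using D r by (simp only: distrib_right) (subst ennreal_plus, auto simp: distrib_right)
    finally show "(\<integral>\<^sup>+y\<in>cube x r. epowr (cube_max h y) c \<partial>lborel) \<le> ennreal ((D1 + D2) * r ^ ?N) *
          epowr (min (cube_max h x) (?I / ennreal (r ^ ?N))) c"
      unfolding m_def .
  qed
qed

section \<open>Finiteness and positivity of the maximal function\<close>

lemma cube_max_finite_AE:
  fixes h :: "real ^ 'n \<Rightarrow> ennreal"
  assumes [measurable]: "h \<in> borel_measurable borel" and fin: "(\<integral>\<^sup>+x. h x \<partial>lborel) < top"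
  shows "AE x in lborel. cube_max h x < top"
proof -
  let ?K = "(5 * real CARD('n)) ^ CARD('n)"
  obtain I where I: "I \<ge> 0" "(\<integral>\<^sup>+x. h x \<partial>lborel) = ennreal I"
    using fin by (cases "\<integral>\<^sup>+x. h x \<partial>lborel") auto
  let ?E = "{x. cube_max h x = top}"
  have le: "emeasure lborel ?E \<le> ennreal (?K * I / t)" if "t > 0" for t
  proof -
    have "emeasure lborel ?E \<le> emeasure lborel {x. ennreal t < cube_max h x}"
      by (intro emeasure_mono) auto
    also have "\<dots> \<le> ennreal (?K / t) * ennreal I"
      using cube_max_weak_type[of h t] that I by simp
    finally show ?thesis using I that by (simp flip: ennreal_mult)
  qed
  have "emeasure lborel ?E = 0"
  proof (rule ccontr)
    assume nz: "emeasure lborel ?E \<noteq> 0"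
    have "emeasure lborel ?E \<noteq> top" using le[of 1] by (auto simp: top_unique)
    then obtain e where e: "e > 0" "emeasure lborel ?E = ennreal e"
      using nz by (cases "emeasure lborel ?E" rule: ennreal_cases3) auto
    \<comment> \<open>With this level the weak-type bound is \<open>e * (I / (2 * (I + 1)))\<close>,
      which is less than \<open>e\<close>; the summand \<open>1\<close> keeps the level positive
      when \<open>I = 0\<close>.\<close>
    let ?t = "2 * ?K * (I + 1) / e"
    have t: "?t > 0" using e I by simp
    have "ennreal e \<le> ennreal (?K * I / ?t)" using le[OF t] e by simp
    moreover have "?K * I / ?t \<ge> 0" using t I by (intro divide_nonneg_pos mult_nonneg_nonneg) auto
    ultimately have "e \<le> ?K * I / ?t" by simp
    moreover have "?K * I / ?t = e * (I / (2 * (I + 1)))" 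
    proof -
      have "k * I / (2 * k * (I + 1) / e) = e * (I / (2 * (I + 1)))" if "k > 0" for k :: real
        using that e by simp
      then show ?thesis by simp
    qed
    moreover have "I / (2 * (I + 1)) < 1" using I by (simp add: field_simps)
    ultimately show False using e mult_strict_left_mono[of "I / (2 * (I + 1))" 1 e] by linarith
  qed
  then have "AE x in lborel. x \<notin> ?E"
    by (intro AE_not_in) (auto simp: null_sets_def)
  then show ?thesis by eventually_elim (auto simp: top.not_eq_extremum)
qed

lemma AE_zero_if_cube_integrals_zero:
  fixes h :: "real ^ 'n \<Rightarrow> ennreal"
  assumes [measurable]: "h \<in> borel_measurable borel"
    and z: "\<And>r. r > 0 \<Longrightarrow> (\<integral>\<^sup>+y\<in>cube x r. h y \<partial>lborel) = 0"
  shows "AE y in lborel. h y = 0"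
proof -
  have "AE y in lborel. y \<in> cube x (real (Suc k)) \<longrightarrow> h y = 0" for k
  proof -
    have "(\<integral>\<^sup>+y\<in>cube x (real (Suc k)). h y \<partial>lborel) = 0" by (rule z) simp
    then have "AE y in lborel. h y * indicator (cube x (real (Suc k))) y = 0"
      by (subst (asm) nn_integral_0_iff_AE) auto
    then show ?thesis by eventually_elim (auto simp: indicator_def)
  qed
  then have "AE y in lborel. \<forall>k. y \<in> cube x (real (Suc k)) \<longrightarrow> h y = 0"
    by (subst AE_all_countable) auto
  then show ?thesis
  proof eventually_elim
    case (elim y)
    obtain k where "infnorm (y - x) \<le> real k" using real_arch_simple by blast
    then show ?case using elim[rule_format, of k] by (auto simp: cube_def)
  qed
qed

text \<open>The cubes centred at a single point exhaust the space, so one zero of the maximal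
  function already forces \<open>h\<close> to vanish almost everywhere. Positivity is needed at
  every point because negative powers of the maximal function occur.\<close>

lemma cube_max_pos:
  fixes h :: "real ^ 'n \<Rightarrow> ennreal"
  assumes [measurable]: "h \<in> borel_measurable borel" and nz: "\<not> (AE y in lborel. h y = 0)"
  shows "cube_max h x > 0"
proof (rule ccontr)
  assume "\<not> cube_max h x > 0"
  then have "cube_max h x = 0" by simp
  then have "(\<integral>\<^sup>+y\<in>cube x r. h y \<partial>lborel) = 0" if "r > 0" for r
    using cube_integral_le_max[OF that center_in_cube[of r x], of h] that by simp
  then show False using AE_zero_if_cube_integrals_zero[of h x] nz by auto
qed

subsection \<open>Muckenhoupt weights of class A1\<close>

lemma infnorm_less_iff: "infnorm (x :: real ^ 'n) < r \<longleftrightarrow> (\<forall>i. \<bar>x $ i\<bar> < r)"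
proof
  show "\<forall>i. \<bar>x $ i\<bar> < r" if "infnorm x < r"
    using component_le_infnorm_cart[of x] that le_less_trans by blast
  show "infnorm x < r" if "\<forall>i. \<bar>x $ i\<bar> < r"
    using that unfolding infnorm_Max by (subst Max_less_iff) (auto simp: Basis_vec_def inner_axis)
qed

lemma cube_eq_corner_cbox:
  fixes x :: "real ^ 'n"
  assumes "h \<ge> 0"
  shows "cbox x (x + h *\<^sub>R One) = cube (x + (h / 2) *\<^sub>R One) (h / 2)"
proof -
  have "(One :: real ^ 'n) $ i = 1" for i
    using inner_axis[of "One :: real ^ 'n" i 1] by (simp add: axis_in_Basis_iff)
  then show ?thesis
    by (simp add: cube_eq_cbox mem_box_cart set_eq_iff add.commute)
qed

lemma infnorm_One: "infnorm (One :: real ^ 'n) = 1"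
proof -
  have "(One :: real ^ 'n) $ i = 1" for i
    using inner_axis[of "One :: real ^ 'n" i 1] by (simp add: axis_in_Basis_iff)
  then have "infnorm (One :: real ^ 'n) \<le> 1" "infnorm (One :: real ^ 'n) \<ge> 1"
    using component_le_infnorm_cart[of "One :: real ^ 'n" undefined] by (auto simp: infnorm_le_iff)
  then show ?thesis by simp
qed

text \<open>The small cubes have \<open>x\<close> as a corner, the shape used in the underlying
  differentiation theorem. Both inequalities serve: the upper one shows that an essential lower
  bound on a cube is a lower bound at \<open>x\<close>, and the lower one starts the stopping
  argument where \<open>u\<close> exceeds a level.\<close>

lemma Lebesgue_differentiation_cubes:
  fixes u :: "real ^ 'n \<Rightarrow> real"
  assumes [measurable]: "u \<in> borel_measurable borel" and nonneg: "\<And>x. 0 \<le> u x"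
    and fin: "\<And>c r. 0 < r \<Longrightarrow> (\<integral>\<^sup>+x\<in>cube c r. ennreal (u x) \<partial>lborel) < top"
  shows "AE x in lborel. \<forall>e>0. \<forall>d>0. \<exists>h. 0 < h \<and> h < d \<and>
     ennreal ((u x - e) * h ^ CARD('n)) \<le> (\<integral>\<^sup>+y\<in>cube (x + (h / 2) *\<^sub>R One) (h / 2). ennreal (u y) \<partial>lborel) \<and>
     (\<integral>\<^sup>+y\<in>cube (x + (h / 2) *\<^sub>R One) (h / 2). ennreal (u y) \<partial>lborel) \<le> ennreal ((u x + e) * h ^ CARD('n))"
proof -
  have int: "set_integrable lborel Q u" if "Q \<in> sets borel" "Q \<subseteq> cube c r" "0 < r" for Q c r
    unfolding set_integrable_def
  proof (rule integrableI_bounded)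
    show "(\<lambda>x. indicat_real Q x *\<^sub>R u x) \<in> borel_measurable lborel" using that by simp
    have "(\<integral>\<^sup>+x. ennreal (norm (indicat_real Q x *\<^sub>R u x)) \<partial>lborel) \<le> (\<integral>\<^sup>+x\<in>cube c r. ennreal (u x) \<partial>lborel)"
      using that nonneg by (intro nn_integral_mono) (auto split: split_indicator)
    then show "(\<integral>\<^sup>+x. ennreal (norm (indicat_real Q x *\<^sub>R u x)) \<partial>lborel) < \<infinity>"
      using fin[OF that(3), of c] by (simp add: order_le_less_trans)
  qed
  have intc: "set_integrable lborel (cbox a b) u" for a b
  proof -
    obtain R where R: "\<And>x. x \<in> cbox a b \<Longrightarrow> norm x \<le> R"
      using bounded_cbox[of a b] unfolding bounded_iff by blast
    have "cbox a b \<subseteq> cube 0 (max R 1)"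
    proof
      fix x assume "x \<in> cbox a b"
      then show "x \<in> cube 0 (max R 1)"
        using R[of x] infnorm_le_norm[of x] by (simp add: cube_def)
    qed
    then show ?thesis by (intro int[of _ 0 "max R 1"]) auto
  qed
  have eq: "(\<integral>\<^sup>+y\<in>cbox a b. ennreal (u y) \<partial>lborel) = ennreal (integral (cbox a b) u)" for a b
  proof -
    have "(\<integral>\<^sup>+y\<in>cbox a b. ennreal (u y) \<partial>lborel) = (\<integral>\<^sup>+y. ennreal (indicator (cbox a b) y *\<^sub>R u y) \<partial>lborel)"
      by (intro nn_integral_cong) (auto split: split_indicator)
    also have "\<dots> = ennreal (LINT y : cbox a b | lborel. u y)"
      unfolding set_lebesgue_integral_def
      by (rule nn_integral_eq_integral) (use intc[of a b] nonneg in \<open>auto simp: set_integrable_def\<close>)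
    finally show ?thesis
      by (simp add: set_borel_integral_eq_integral(2)[OF intc])
  qed
  obtain N where N: "negligible N" "\<And>x e. \<lbrakk>x \<notin> N; 0 < e\<rbrakk> \<Longrightarrow>
               \<exists>d>0. \<forall>h. 0 < h \<and> h < d \<longrightarrow>
                         norm(integral (cbox x (x + h *\<^sub>R One)) u /\<^sub>R h ^ DIM(real ^ 'n) - u x) < e"
    using integrable_ccontinuous_explicit[of u] set_borel_integral_eq_integral(1)[OF intc] by blast
  have "AE x in lebesgue. x \<notin> N"
    using N(1) by (intro AE_not_in) (simp add: negligible_iff_null_sets)
  then have "AE x in lborel. x \<notin> N" by (simp add: AE_completion_iff)
  then show ?thesis
  proof eventually_elim
    case (elim x)
    show ?case
    proof (intro allI impI)
      fix e d :: real assume e: "e > 0" and d: "d > 0"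
      obtain d' where d': "d' > 0" "\<And>h. 0 < h \<Longrightarrow> h < d' \<Longrightarrow>
          \<bar>integral (cbox x (x + h *\<^sub>R One)) u / h ^ CARD('n) - u x\<bar> < e"
        using N(2)[OF elim e] by (auto simp: divide_inverse mult.commute)
      define h where "h = min d d' / 2"
      have h: "0 < h" "h < d" "h < d'" using d d' by (auto simp: h_def)
      have "\<bar>integral (cbox x (x + h *\<^sub>R One)) u / h ^ CARD('n) - u x\<bar> < e"
        using d' h by blast
      then have "(u x - e) * h ^ CARD('n) \<le> integral (cbox x (x + h *\<^sub>R One)) u"
        "integral (cbox x (x + h *\<^sub>R One)) u \<le> (u x + e) * h ^ CARD('n)"
        using h by (auto simp: field_simps abs_if split: if_splits)
      then show "\<exists>h>0. h < d \<and>
             ennreal ((u x - e) * h ^ CARD('n)) \<le> (\<integral>\<^sup>+y\<in>cube (x + (h / 2) *\<^sub>R One) (h / 2). ennreal (u y) \<partial>lborel) \<and>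
             (\<integral>\<^sup>+y\<in>cube (x + (h / 2) *\<^sub>R One) (h / 2). ennreal (u y) \<partial>lborel) \<le> ennreal ((u x + e) * h ^ CARD('n))"
        using h by (intro exI[of _ h]) (auto simp: eq cube_eq_corner_cbox[symmetric] intro!: ennreal_leI)
    qed
  qed
qed

text \<open>The witness \<open>m\<close> stands for the essential infimum. Multiplying it out avoids
  the inverse: \<open>m = 0\<close> simply forces the integral over the cube to vanish. Borel
  measurability and nonnegativity at every point are demanded so that the later integrals can be
  taken over \<open>lborel\<close>.\<close>

definition A1_bound :: "real \<Rightarrow> (real ^ 'n \<Rightarrow> real) \<Rightarrow> bool" where
  "A1_bound A u \<longleftrightarrow> 1 \<le> A \<and> u \<in> borel_measurable borel \<and> (\<forall>x. 0 \<le> u x) \<and>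
    (\<forall>c r. 0 < r \<longrightarrow> (\<exists>m\<ge>0. (AE x in lborel. x \<in> cube c r \<longrightarrow> m \<le> u x) \<and>
       (\<integral>\<^sup>+x\<in>cube c r. ennreal (u x) \<partial>lborel) \<le> ennreal (A * m * (2 * r) ^ CARD('n))))"

lemma A1_boundD:
  fixes u :: "real ^ 'n \<Rightarrow> real"
  assumes "A1_bound A u"
  shows "1 \<le> A" "u \<in> borel_measurable borel" "0 \<le> u x"
    "0 < r \<Longrightarrow> (\<integral>\<^sup>+x\<in>cube c r. ennreal (u x) \<partial>lborel) < top"
proof -
  show "1 \<le> A" "u \<in> borel_measurable borel" "0 \<le> u x" using assms by (auto simp: A1_bound_def)
  assume "0 < r"
  then obtain m where "(\<integral>\<^sup>+x\<in>cube c r. ennreal (u x) \<partial>lborel) \<le> ennreal (A * m * (2 * r) ^ CARD('n))"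
    using assms unfolding A1_bound_def by blast
  also have "\<dots> < top" by simp
  finally show "(\<integral>\<^sup>+x\<in>cube c r. ennreal (u x) \<partial>lborel) < top" .
qed

lemma A1_bound_Lebesgue:
  fixes u :: "real ^ 'n \<Rightarrow> real"
  assumes "A1_bound A u"
  shows "AE x in lborel. \<forall>e>0. \<forall>d>0. \<exists>h. 0 < h \<and> h < d \<and>
     ennreal ((u x - e) * h ^ CARD('n)) \<le> (\<integral>\<^sup>+y\<in>cube (x + (h / 2) *\<^sub>R One) (h / 2). ennreal (u y) \<partial>lborel) \<and>
     (\<integral>\<^sup>+y\<in>cube (x + (h / 2) *\<^sub>R One) (h / 2). ennreal (u y) \<partial>lborel) \<le> ennreal ((u x + e) * h ^ CARD('n))"
  by (rule Lebesgue_differentiation_cubes) (use A1_boundD[OF assms] in auto)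

lemma A1_bound_ess_inf:
  fixes u :: "real ^ 'n \<Rightarrow> real"
  assumes "A1_bound A u" "0 < r"
  obtains m where "m \<ge> 0" "AE x in lborel. x \<in> cube c r \<longrightarrow> m \<le> u x"
    "(\<integral>\<^sup>+x\<in>cube c r. ennreal (u x) \<partial>lborel) \<le> ennreal (A * m * (2 * r) ^ CARD('n))"
  using assms unfolding A1_bound_def by blast

lemma ennreal_const_cube_le:
  fixes u :: "real ^ 'n \<Rightarrow> real"
  assumes "m \<ge> 0" "r \<ge> 0" "AE x in lborel. x \<in> cube c r \<longrightarrow> m \<le> u x"
  shows "ennreal (m * (2 * r) ^ CARD('n)) \<le> (\<integral>\<^sup>+x\<in>cube c r. ennreal (u x) \<partial>lborel)"
proof -
  have "ennreal (m * (2 * r) ^ CARD('n)) = (\<integral>\<^sup>+x\<in>cube c r. ennreal m \<partial>lborel)"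
    using assms by (simp only: emeasure_cube nn_integral_cmult_indicator cube_borel sets_lborel) (simp add: ennreal_mult)
  also have "\<dots> \<le> (\<integral>\<^sup>+x\<in>cube c r. ennreal (u x) \<partial>lborel)"
    by (rule nn_integral_mono_AE) (use assms(3) in \<open>eventually_elim, auto split: split_indicator intro!: ennreal_leI\<close>)
  finally show ?thesis .
qed

text \<open>This is the pointwise form of the A1 condition, restricted to cubes centred at
  \<open>x\<close>. At a Lebesgue point an essential lower bound of \<open>u\<close> on a
  neighbourhood is a lower bound for \<open>u x\<close>; the exceptional null set does not depend on
  \<open>r\<close>.\<close>

lemma A1_bound_pointwise:
  fixes u :: "real ^ 'n \<Rightarrow> real"
  assumes A1: "A1_bound A u"
  shows "AE x in lborel. \<forall>r>0. (\<integral>\<^sup>+y\<in>cube x r. ennreal (u y) \<partial>lborel) \<le> ennreal (A * u x * (2 * r) ^ CARD('n))"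
  using A1_bound_Lebesgue[OF A1]
proof eventually_elim
  case (elim x)
  show ?case
  proof (intro allI impI)
    fix r :: real assume r: "r > 0"
    obtain m where m: "m \<ge> 0" "AE y in lborel. y \<in> cube x r \<longrightarrow> m \<le> u y"
      "(\<integral>\<^sup>+y\<in>cube x r. ennreal (u y) \<partial>lborel) \<le> ennreal (A * m * (2 * r) ^ CARD('n))"
      using A1_bound_ess_inf[OF A1 r] .
    \<comment> \<open>A small cube with corner \<open>x\<close> lies in \<open>cube x r\<close>, so
      its average is at least \<open>m\<close>, while differentiation bounds that average by
      \<open>u x + e\<close>.\<close>
    have "m \<le> u x"
    proof (rule field_le_epsilon)
      fix e :: real assume "e > 0"
      then obtain h where h: "0 < h" "h < r"
        "(\<integral>\<^sup>+y\<in>cube (x + (h / 2) *\<^sub>R One) (h / 2). ennreal (u y) \<partial>lborel) \<le> ennreal ((u x + e) * h ^ CARD('n))"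
        using elim r by blast
      have "cube (x + (h / 2) *\<^sub>R One) (h / 2) \<subseteq> cube x r"
        using h by (intro cube_subset) (simp add: infnorm_mul infnorm_One)
      then have "AE y in lborel. y \<in> cube (x + (h / 2) *\<^sub>R One) (h / 2) \<longrightarrow> m \<le> u y"
        by (intro eventually_mono[OF m(2)]) auto
      from ennreal_const_cube_le[OF m(1) _ this] h
      have "ennreal (m * h ^ CARD('n)) \<le> ennreal ((u x + e) * h ^ CARD('n))" by (simp add: order_trans)
      then have "m * h ^ CARD('n) \<le> (u x + e) * h ^ CARD('n)"
        using h \<open>e > 0\<close> A1_boundD(3)[OF A1, of x] by (subst (asm) ennreal_le_iff) auto
      then show "m \<le> u x + e" using h by simp
    qed
    then have "A * m * (2 * r) ^ CARD('n) \<le> A * u x * (2 * r) ^ CARD('n)"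
      using A1_boundD(1)[OF A1] r by (intro mult_right_mono mult_left_mono) auto
    then show "(\<integral>\<^sup>+y\<in>cube x r. ennreal (u y) \<partial>lborel) \<le> ennreal (A * u x * (2 * r) ^ CARD('n))"
      using m(3) ennreal_leI order_trans by blast
  qed
qed

text \<open>The lower bound \<open>m\<close> found on the large cube also holds on the small one, so
  \<open>m\<close> times the small volume is at most the integral of \<open>u\<close> there, and the
  A1 condition on the large cube is stated in terms of the same \<open>m\<close>.\<close>

lemma A1_bound_doubling:
  fixes u :: "real ^ 'n \<Rightarrow> real"
  assumes A1: "A1_bound A u" and r: "0 < r" and k: "1 \<le> k"
  shows "(\<integral>\<^sup>+x\<in>cube c (k * r). ennreal (u x) \<partial>lborel) \<le> ennreal (A * k ^ CARD('n)) * (\<integral>\<^sup>+x\<in>cube c r. ennreal (u x) \<partial>lborel)"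
proof -
  have kr: "k * r > 0" using r k by simp
  obtain m where m: "m \<ge> 0" "AE y in lborel. y \<in> cube c (k * r) \<longrightarrow> m \<le> u y"
      "(\<integral>\<^sup>+y\<in>cube c (k * r). ennreal (u y) \<partial>lborel) \<le> ennreal (A * m * (2 * (k * r)) ^ CARD('n))"
    using A1_bound_ess_inf[OF A1 kr] .
  have "cube c r \<subseteq> cube c (k * r)" using r k by (intro cube_mono) (simp add: mult_le_cancel_right1)
  then have AE: "AE y in lborel. y \<in> cube c r \<longrightarrow> m \<le> u y"
    by (intro eventually_mono[OF m(2)]) auto
  have "2 * (k * r) = k * (2 * r)" by simp
  then have "A * m * (2 * (k * r)) ^ CARD('n) = (A * k ^ CARD('n)) * (m * (2 * r) ^ CARD('n))"
    by (simp only: power_mult_distrib mult_ac)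
  then have "ennreal (A * m * (2 * (k * r)) ^ CARD('n)) = ennreal (A * k ^ CARD('n)) * ennreal (m * (2 * r) ^ CARD('n))"
    using A1_boundD(1)[OF A1] k r m(1) by (simp only:) (subst ennreal_mult, auto)
  also have "\<dots> \<le> ennreal (A * k ^ CARD('n)) * (\<integral>\<^sup>+x\<in>cube c r. ennreal (u x) \<partial>lborel)"
    by (intro mult_left_mono ennreal_const_cube_le AE m) (use r in auto)
  finally show ?thesis using m(3) by (rule order_trans[rotated])
qed

text \<open>The stopping cube is found on a nested one-parameter family of cubes that joins a small
  cube with corner \<open>x\<close> to the ambient cube and is parametrised by the radius.\<close>

lemma stopping_cube:
  fixes v :: "real ^ 'n \<Rightarrow> ennreal"
  assumes r0: "0 < r0" and inside: "infnorm (c0 - a) \<le> R - r0" and lam: "0 \<le> lam"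
    and small: "ennreal (lam * (2 * r0) ^ CARD('n)) < (\<integral>\<^sup>+y\<in>cube c0 r0. v y \<partial>lborel)"
    and large: "(\<integral>\<^sup>+y\<in>cube a R. v y \<partial>lborel) \<le> ennreal (lam * (2 * R) ^ CARD('n))"
    and [measurable]: "v \<in> borel_measurable borel"
  obtains c r where "0 < r" "r \<le> R" "cube c0 r0 \<subseteq> cube c r" "cube c r \<subseteq> cube a R"
    "ennreal (lam * (2 * r) ^ CARD('n)) < (\<integral>\<^sup>+y\<in>cube c r. v y \<partial>lborel)"
    "(\<integral>\<^sup>+y\<in>cube c r. v y \<partial>lborel) \<le> ennreal (lam * (2 * (2 * r)) ^ CARD('n))"
proof -
  have "r0 \<noteq> R"
  proof
    assume "r0 = R"
    then have "infnorm (c0 - a) \<le> 0" using inside by simp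
    then have "infnorm (c0 - a) = 0" using infnorm_pos_le[of "c0 - a"] by simp
    then have "c0 = a" by (simp add: infnorm_eq_0)
    then show False using small large \<open>r0 = R\<close> by simp
  qed
  moreover have "r0 \<le> R" using inside infnorm_pos_le[of "c0 - a"] by linarith
  ultimately have r0R: "r0 < R" by simp
  \<comment> \<open>The centre moves linearly from \<open>c0\<close> to \<open>a\<close> while the
    half-side grows from \<open>r0\<close> to \<open>R\<close>. By \<open>inside\<close> it moves no
    faster than the half-side grows, which makes the cubes nested.\<close>
  define c where "c = (\<lambda>s. c0 + ((s - r0) / (R - r0)) *\<^sub>R (a - c0))"
  have nested: "cube (c s) s \<subseteq> cube (c t) t" if "s \<le> t" for s t
  proof (rule cube_subset)
    have "c s - c t = ((s - t) / (R - r0)) *\<^sub>R (a - c0)"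
      by (simp add: c_def scaleR_diff_left[symmetric] diff_divide_distrib[symmetric])
    then have "infnorm (c s - c t) = (t - s) / (R - r0) * infnorm (c0 - a)"
      using that r0R by (simp add: infnorm_mul infnorm_sub[of a c0])
    also have "\<dots> \<le> (t - s) / (R - r0) * (R - r0)"
      using that r0R inside by (intro mult_left_mono) auto
    finally show "infnorm (c s - c t) + s \<le> t" using r0R by simp
  qed
  have cR: "c R = a" "c r0 = c0" using r0R by (auto simp: c_def)
  define T where "T = {s. r0 \<le> s \<and> s \<le> R \<and> ennreal (lam * (2 * s) ^ CARD('n)) < (\<integral>\<^sup>+y\<in>cube (c s) s. v y \<partial>lborel)}"
  have T: "r0 \<in> T" "R \<notin> T" "bdd_above T"
    using small large cR r0R by (auto simp: T_def bdd_above_def)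
  have "Sup T \<ge> r0" using T by (intro cSup_upper)
  then have "Sup T / 2 < Sup T" using r0 by simp
  then obtain s where s: "s \<in> T" "Sup T / 2 < s"
    using T(1) by (metis less_cSup_iff empty_iff T(3))
  \<comment> \<open>As \<open>s\<close> exceeds half the supremum of \<open>T\<close>, doubling it
    leaves \<open>T\<close>. This replaces an exact stopping radius, and with it the continuity of
    the integral in the radius, at the cost of a factor 2 in the side.\<close>
  define t where "t = min (2 * s) R"
  have "t \<notin> T"
  proof (cases "2 * s \<le> R")
    case True
    then have "Sup T < t" using s(2) by (simp add: t_def)
    then show ?thesis using cSup_upper[OF _ T(3), of t] by auto
  next
    case False
    then show ?thesis using T(2) by (simp add: t_def)
  qed
  moreover have st: "s \<le> t" "r0 \<le> t" "t \<le> R" "0 < s" "t \<le> 2 * s"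
    using s r0 by (auto simp: t_def T_def)
  ultimately have tT: "(\<integral>\<^sup>+y\<in>cube (c t) t. v y \<partial>lborel) \<le> ennreal (lam * (2 * t) ^ CARD('n))"
    by (auto simp: T_def)
  show ?thesis
  proof (rule that[of s "c s"])
    show "0 < s" "s \<le> R" using st by auto
    show "cube c0 r0 \<subseteq> cube (c s) s" using nested[of r0 s] s cR by (auto simp: T_def)
    show "cube (c s) s \<subseteq> cube a R" using nested[of s R] s cR by (auto simp: T_def)
    show "ennreal (lam * (2 * s) ^ CARD('n)) < (\<integral>\<^sup>+y\<in>cube (c s) s. v y \<partial>lborel)"
      using s by (simp add: T_def)
    have "(\<integral>\<^sup>+y\<in>cube (c s) s. v y \<partial>lborel) \<le> (\<integral>\<^sup>+y\<in>cube (c t) t. v y \<partial>lborel)"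
      using nested[OF st(1)] by (intro nn_set_integral_set_mono) auto
    also note tT
    also have "ennreal (lam * (2 * t) ^ CARD('n)) \<le> ennreal (lam * (2 * (2 * s)) ^ CARD('n))"
      using st lam by (intro ennreal_leI mult_left_mono power_mono) auto
    finally show "(\<integral>\<^sup>+y\<in>cube (c s) s. v y \<partial>lborel) \<le> ennreal (lam * (2 * (2 * s)) ^ CARD('n))" .
  qed
qed

text \<open>Almost every point of the cube with \<open>u x > lam\<close> lies in a stopping cube
  inside \<open>cube a R\<close> with average comparable to \<open>lam\<close>. On such a cube the
  A1 condition forces \<open>lam \<le> A * u\<close> almost everywhere, so the volumes of a disjoint
  subfamily are counted by the set on the right. In the constant, \<open>A * (5 * n) ^ n\<close>
  comes from doubling and \<open>2 ^ n\<close> from the stopping rule. The dilated cubes may leave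
  \<open>cube a R\<close>, which does no harm since doubling holds globally.\<close>

lemma A1_level_set:
  fixes u :: "real ^ 'n \<Rightarrow> real"
  assumes A1: "A1_bound A u" and lam: "0 < lam"
    and large: "(\<integral>\<^sup>+y\<in>cube a R. ennreal (u y) \<partial>lborel) \<le> ennreal (lam * (2 * R) ^ CARD('n))"
  shows "(\<integral>\<^sup>+x\<in>cube a R \<inter> {x. lam < u x}. ennreal (u x) \<partial>lborel)
    \<le> ennreal (A * (5 * real CARD('n)) ^ CARD('n) * 2 ^ CARD('n) * lam) * emeasure lborel {x \<in> cube a R. lam \<le> A * u x}"
proof -
  note [measurable] = A1_boundD(2)[OF A1]
  let ?N = "CARD('n)"
  define K where "K = {(c, r). 0 < r \<and> r \<le> R \<and> cube c r \<subseteq> cube a R \<and>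
    ennreal (lam * (2 * r) ^ ?N) < (\<integral>\<^sup>+y\<in>cube c r. ennreal (u y) \<partial>lborel) \<and>
    (\<integral>\<^sup>+y\<in>cube c r. ennreal (u y) \<partial>lborel) \<le> ennreal (lam * (2 * (2 * r)) ^ ?N)}"
  have bnd: "0 < r \<and> r \<le> R" if "(c, r) \<in> K" for c r using that by (simp add: K_def)
  obtain C where C: "countable C" "C \<subseteq> K" "disjoint_family_on (\<lambda>(c, r). cube c r) C"
    "(\<Union>(c, r)\<in>K. cube c r) \<subseteq> (\<Union>(c, r)\<in>C. cube c (5 * real ?N * r))"
    by (rule Vitali_cubes[OF bnd])
  let ?E = "cube a R \<inter> {x. lam < u x}"
  \<comment> \<open>The boundary is discarded so that small cubes with corner \<open>x\<close> fit
    into \<open>cube a R\<close>.\<close>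
  have "AE x in lborel. x \<in> cube a R \<longrightarrow> infnorm (x - a) < R"
  proof -
    have "AE x in lborel. x \<notin> cube a R - box (\<chi> i. a $ i - R) (\<chi> i. a $ i + R)"
      unfolding cube_eq_cbox by (rule AE_not_in) (rule null_sets_cbox_Diff_box)
    then show ?thesis
    proof eventually_elim
      case (elim x)
      show ?case
      proof
        assume "x \<in> cube a R"
        then have "x \<in> box (\<chi> i. a $ i - R) (\<chi> i. a $ i + R)"
          using elim by blast
        then have "a $ i - R < x $ i \<and> x $ i < a $ i + R" for i
          by (simp add: mem_box_cart)
        then have "\<bar>(x - a) $ i\<bar> < R" for i
          by (simp add: abs_less_iff algebra_simps)
        then show "infnorm (x - a) < R"
          by (simp add: infnorm_less_iff)
      qed
    qed
  qed
  then have cover: "AE x in lborel. x \<in> ?E \<longrightarrow> x \<in> (\<Union>(c, r)\<in>K. cube c r)"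
    using A1_bound_Lebesgue[OF A1]
  proof eventually_elim
    case (elim x)
    show ?case
    proof
      assume x: "x \<in> ?E"
      \<comment> \<open>Then \<open>u x - e\<close> is the midpoint of \<open>lam\<close> and
        \<open>u x\<close>, so the average over the small cube still exceeds
        \<open>lam\<close>.\<close>
      define e where "e = (u x - lam) / 2"
      define d where "d = R - infnorm (x - a)"
      have "e > 0" "d > 0" using x elim(1) by (auto simp: e_def d_def)
      then obtain h where h: "0 < h" "h < d" "ennreal ((u x - e) * h ^ ?N) \<le> (\<integral>\<^sup>+y\<in>cube (x + (h / 2) *\<^sub>R One) (h / 2). ennreal (u y) \<partial>lborel)"
        using elim(2) by blast
      let ?c = "x + (h / 2) *\<^sub>R One" and ?r = "h / 2"
      have "lam * h ^ ?N < (u x - e) * h ^ ?N"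
        using h(1) x by (intro mult_strict_right_mono) (auto simp: e_def field_simps)
      then have "ennreal (lam * h ^ ?N) < ennreal ((u x - e) * h ^ ?N)"
        using lam h by (subst ennreal_less_iff) auto
      then have small: "ennreal (lam * (2 * ?r) ^ ?N) < (\<integral>\<^sup>+y\<in>cube ?c ?r. ennreal (u y) \<partial>lborel)"
        using h(3) by simp
      have inside: "infnorm (?c - a) \<le> R - ?r"
        using infnorm_triangle_diff[of ?c a x] h by (simp add: infnorm_mul infnorm_One d_def)
      obtain c r where cr: "0 < r" "r \<le> R" "cube ?c ?r \<subseteq> cube c r" "cube c r \<subseteq> cube a R"
        "ennreal (lam * (2 * r) ^ CARD('n)) < (\<integral>\<^sup>+y\<in>cube c r. ennreal (u y) \<partial>lborel)"
        "(\<integral>\<^sup>+y\<in>cube c r. ennreal (u y) \<partial>lborel) \<le> ennreal (lam * (2 * (2 * r)) ^ CARD('n))"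
        by (rule stopping_cube[OF _ inside _ small large]) (use h lam in auto)
      have "x \<in> cube ?c ?r"
        using h by (simp add: cube_def infnorm_mul infnorm_One infnorm_neg)
      then show "x \<in> (\<Union>(c, r)\<in>K. cube c r)"
        using cr by (auto simp: K_def intro!: bexI[of _ "(c, r)"])
    qed
  qed
  have "(\<integral>\<^sup>+x\<in>?E. ennreal (u x) \<partial>lborel) \<le> (\<integral>\<^sup>+x\<in>(\<Union>(c, r)\<in>C. cube c (5 * real ?N * r)). ennreal (u x) \<partial>lborel)"
  proof (rule nn_integral_mono_AE)
    show "AE x in lborel. ennreal (u x) * indicator ?E x \<le> ennreal (u x) * indicator (\<Union>(c, r)\<in>C. cube c (5 * real ?N * r)) x"
      using cover by eventually_elim (use C(4) in \<open>auto split: split_indicator\<close>)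
  qed
  also have "\<dots> \<le> (\<integral>\<^sup>+i. (\<integral>\<^sup>+x\<in>(case i of (c, r) \<Rightarrow> cube c (5 * real ?N * r)). ennreal (u x) \<partial>lborel) \<partial>count_space C)"
    by (rule nn_integral_UN_le_count[OF C(1)]) (auto simp: case_prod_beta)
  also have "\<dots> \<le> (\<integral>\<^sup>+i. ennreal (A * (5 * real ?N) ^ ?N * 2 ^ ?N * lam) *
      (\<integral>\<^sup>+x\<in>(case i of (c, r) \<Rightarrow> cube c r). indicator {x. lam \<le> A * u x} x \<partial>lborel) \<partial>count_space C)"
  proof (rule nn_integral_mono)
    fix i assume "i \<in> space (count_space C)"
    then obtain c r where i: "i = (c, r)" and "(c, r) \<in> K" using C(2) by (cases i) auto
    then have cr: "0 < r" "ennreal (lam * (2 * r) ^ ?N) < (\<integral>\<^sup>+y\<in>cube c r. ennreal (u y) \<partial>lborel)"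
      "(\<integral>\<^sup>+y\<in>cube c r. ennreal (u y) \<partial>lborel) \<le> ennreal (lam * (2 * (2 * r)) ^ ?N)"
      by (auto simp: K_def)
    have A: "A \<ge> 1" using A1_boundD(1)[OF A1] .
    obtain m where m: "m \<ge> 0" "AE y in lborel. y \<in> cube c r \<longrightarrow> m \<le> u y"
      "(\<integral>\<^sup>+y\<in>cube c r. ennreal (u y) \<partial>lborel) \<le> ennreal (A * m * (2 * r) ^ ?N)"
      using A1_bound_ess_inf[OF A1 cr(1)] .
    have "ennreal (lam * (2 * r) ^ ?N) < ennreal (A * m * (2 * r) ^ ?N)"
      using cr(2) m(3) by simp
    then have "lam * (2 * r) ^ ?N < A * m * (2 * r) ^ ?N"
      using lam cr(1) by (subst (asm) ennreal_less_iff) auto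
    \<comment> \<open>Since \<open>m\<close> bounds \<open>u\<close> from below almost everywhere on
      the stopping cube, almost the whole cube lies in the set
      \<open>lam \<le> A * u\<close>.\<close>
    then have lm: "lam < A * m" using cr(1) by simp
    have "(\<integral>\<^sup>+x\<in>cube c (5 * real ?N * r). ennreal (u x) \<partial>lborel)
      \<le> ennreal (A * (5 * real ?N) ^ ?N) * (\<integral>\<^sup>+y\<in>cube c r. ennreal (u y) \<partial>lborel)"
    proof (rule A1_bound_doubling[OF A1 cr(1)])
      have "1 \<le> real ?N" by (simp add: Suc_leI)
      then show "1 \<le> 5 * real ?N" by linarith
    qed
    also have "\<dots> \<le> ennreal (A * (5 * real ?N) ^ ?N) * ennreal (lam * (2 * (2 * r)) ^ ?N)"
      using cr(3) by (rule mult_left_mono) simp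
    also have "\<dots> = ennreal (A * (5 * real ?N) ^ ?N * 2 ^ ?N * lam) * ennreal ((2 * r) ^ ?N)"
    proof -
      have "A * (5 * real ?N) ^ ?N * (lam * (2 * (2 * r)) ^ ?N) = A * (5 * real ?N) ^ ?N * 2 ^ ?N * lam * (2 * r) ^ ?N"
        unfolding power_mult_distrib[of 2 "2 * r"] by (simp only: mult_ac)
      then show ?thesis using A lam cr(1) by (subst (1 2) ennreal_mult[symmetric]) auto
    qed
    also have "ennreal ((2 * r) ^ ?N) = (\<integral>\<^sup>+x\<in>cube c r. 1 \<partial>lborel)"
      using cr(1) emeasure_cube[of r c] by simp
    also have "\<dots> \<le> (\<integral>\<^sup>+x\<in>cube c r. indicator {x. lam \<le> A * u x} x \<partial>lborel)"
    proof (rule nn_integral_mono_AE)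
      show "AE x in lborel. 1 * indicator (cube c r) x \<le> (indicator {x. lam \<le> A * u x} x * indicator (cube c r) x :: ennreal)"
        using m(2)
      proof eventually_elim
        case (elim x)
        have "lam \<le> A * u x" if "x \<in> cube c r"
        proof -
          have "A * m \<le> A * u x" using elim that A by (intro mult_left_mono) auto
          then show ?thesis using lm by simp
        qed
        then show ?case by (auto split: split_indicator)
      qed
    qed
    finally show "(\<integral>\<^sup>+x\<in>(case i of (c, r) \<Rightarrow> cube c (5 * real ?N * r)). ennreal (u x) \<partial>lborel)
       \<le> ennreal (A * (5 * real ?N) ^ ?N * 2 ^ ?N * lam) *
      (\<integral>\<^sup>+x\<in>(case i of (c, r) \<Rightarrow> cube c r). indicator {x. lam \<le> A * u x} x \<partial>lborel)"
      unfolding i prod.case by (simp add: mult_left_mono)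
  qed
  also have "\<dots> = ennreal (A * (5 * real ?N) ^ ?N * 2 ^ ?N * lam) *
      (\<integral>\<^sup>+i. (\<integral>\<^sup>+x\<in>(case i of (c, r) \<Rightarrow> cube c r). indicator {x. lam \<le> A * u x} x \<partial>lborel) \<partial>count_space C)"
    by (rule nn_integral_cmult) simp
  also have "(\<integral>\<^sup>+i. (\<integral>\<^sup>+x\<in>(case i of (c, r) \<Rightarrow> cube c r). indicator {x. lam \<le> A * u x} x \<partial>lborel) \<partial>count_space C)
     \<le> (\<integral>\<^sup>+x\<in>cube a R. indicator {x. lam \<le> A * u x} x \<partial>lborel)"
  proof (rule nn_integral_disjoint_count_le[OF C(1)])
    show "(\<Union>i\<in>C. case i of (c, r) \<Rightarrow> cube c r) \<subseteq> cube a R"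
      using C(2) by (fastforce simp: K_def)
    show "disjoint_family_on (\<lambda>(c, r). cube c r) C" by (rule C(3))
  qed (auto simp: case_prod_beta)
  also have "(\<integral>\<^sup>+x\<in>cube a R. indicator {x. lam \<le> A * u x} x \<partial>lborel) = emeasure lborel {x \<in> cube a R. lam \<le> A * u x}"
  proof -
    have "(\<integral>\<^sup>+x\<in>cube a R. indicator {x. lam \<le> A * u x} x \<partial>lborel) = (\<integral>\<^sup>+x. indicator {x \<in> cube a R. lam \<le> A * u x} x \<partial>lborel)"
      by (intro nn_integral_cong) (auto split: split_indicator)
    then show ?thesis by simp
  qed
  finally show ?thesis by (simp add: mult_left_mono)
qed

subsection \<open>The reverse Hoelder inequality\<close>

text \<open>A self-improvement by absorption. Levels below the average \<open>l0\<close> give the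
  main term; above it the level set estimate trades the integral of \<open>u\<close> over
  \<open>{u > t}\<close> for \<open>t\<close> times a measure, and integration in \<open>t\<close>
  returns at most half of the left-hand side. Truncation at \<open>M\<close> makes the left-hand
  side finite, so that this half can be subtracted.\<close>

lemma A1_reverse_Holder_truncated:
  fixes u :: "real ^ 'n \<Rightarrow> real"
  assumes A1: "A1_bound A u" and R: "0 < R" and M: "0 < M"
    and B: "B = A * (5 * real CARD('n)) ^ CARD('n) * 2 ^ CARD('n)"
    and d: "0 < d" "d \<le> 1" "d * (8 * B * A\<^sup>2) \<le> 1"
    and U: "0 < U" "(\<integral>\<^sup>+x\<in>cube a R. ennreal (u x) \<partial>lborel) = ennreal U"
  shows "(\<integral>\<^sup>+x\<in>cube a R. ennreal (min (u x) M powr d * u x) \<partial>lborel)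
     \<le> ennreal (2 * (U / (2 * R) ^ CARD('n)) powr d * U)"
proof -
  note [measurable] = A1_boundD(2)[OF A1]
  have u0: "0 \<le> u x" for x using A1_boundD(3)[OF A1] .
  have A: "1 \<le> A" using A1_boundD(1)[OF A1] .
  let ?N = "CARD('n)"
  let ?Q = "cube a R"
  define l0 where "l0 = U / (2 * R) ^ ?N"
  have l0: "l0 > 0" using U R by (simp add: l0_def)
  have l0U: "l0 * (2 * R) ^ ?N = U" using R by (simp add: l0_def)
  have B0: "B > 0" using A by (simp add: B)
  define X where "X = (\<integral>\<^sup>+x\<in>?Q. ennreal (min (u x) M powr d * u x) \<partial>lborel)"
  have "X \<le> (\<integral>\<^sup>+x. ennreal (M powr d) * (ennreal (u x) * indicator ?Q x) \<partial>lborel)"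
    unfolding X_def using u0 M d
    by (intro nn_integral_mono)
       (auto split: split_indicator simp flip: ennreal_mult intro!: ennreal_leI mult_right_mono powr_mono2)
  also have "\<dots> = ennreal (M powr d) * ennreal U"
    by (subst nn_integral_cmult) (auto simp: U)
  also have "\<dots> < top" by (simp add: ennreal_mult_less_top)
  finally have Xfin: "X < top" .
  have "X = (\<integral>\<^sup>+x. epowr (ennreal (min (u x) M)) d * (ennreal (u x) * indicator ?Q x) \<partial>lborel)"
    unfolding X_def using u0 M d
    by (intro nn_integral_cong) (auto split: split_indicator simp: epowr_ennreal_nonneg ennreal_mult)
  also have "\<dots> = (\<integral>\<^sup>+t\<in>{0<..}. ennreal (d * t powr (d - 1)) *
      (\<integral>\<^sup>+x\<in>{x. ennreal t < ennreal (min (u x) M)}. ennreal (u x) * indicator ?Q x \<partial>lborel) \<partial>lborel)"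
    by (rule nn_integral_epowr_layer_cake) (use d in auto)
  also have "\<dots> \<le> (\<integral>\<^sup>+t. ennreal (d * U) * (ennreal (t powr (d - 1)) * indicator {0..l0} t) +
       ennreal B * (ennreal ((1 + d) * t powr (1 + d - 1)) *
          (\<integral>\<^sup>+x\<in>{x. ennreal t < ennreal (min (2 * A * u x) M)}. indicator ?Q x \<partial>lborel) * indicator {0<..} t) * ennreal d \<partial>lborel)"
    (is "_ \<le> (\<integral>\<^sup>+t. ?F t + ?G t \<partial>lborel)")
  proof (rule nn_integral_mono)
    fix t :: real
    let ?I = "\<integral>\<^sup>+x\<in>{x. ennreal t < ennreal (min (u x) M)}. ennreal (u x) * indicator ?Q x \<partial>lborel"
    let ?J = "\<integral>\<^sup>+x\<in>{x. ennreal t < ennreal (min (2 * A * u x) M)}. indicator ?Q x \<partial>lborel"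
    show "ennreal (d * t powr (d - 1)) * ?I * indicator {0<..} t \<le> ?F t + ?G t"
    proof (cases "t > 0")
      case t: True
      show ?thesis
      proof (cases "t \<le> l0")
        case True
        have "?I \<le> ennreal U" unfolding U(2)[symmetric]
          by (intro nn_integral_mono) (auto split: split_indicator)
        then have "ennreal (d * t powr (d - 1)) * ?I \<le> ennreal (d * t powr (d - 1)) * ennreal U"
          by (rule mult_left_mono) simp
        also have "\<dots> = ennreal (d * U) * ennreal (t powr (d - 1))"
          using d U by (simp add: mult_ac flip: ennreal_mult)
        finally show ?thesis using True t by (simp add: add_increasing2)
      next
        case False
        have "?I \<le> ennreal (B * t) * ?J"
        proof (cases "t < M")
          case True
          have "?I = (\<integral>\<^sup>+x\<in>?Q \<inter> {x. t < u x}. ennreal (u x) \<partial>lborel)"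
            using t True by (intro nn_integral_cong) (auto split: split_indicator simp: ennreal_less_iff)
          also have "\<dots> \<le> ennreal (B * t) * emeasure lborel {x \<in> ?Q. t \<le> A * u x}"
            unfolding B
          proof (rule A1_level_set[OF A1 t])
            have "U \<le> t * (2 * R) ^ ?N"
              unfolding l0U[symmetric] using False R by (intro mult_right_mono) auto
            then show "(\<integral>\<^sup>+x\<in>?Q. ennreal (u x) \<partial>lborel) \<le> ennreal (t * (2 * R) ^ ?N)"
              unfolding U(2) by (rule ennreal_leI)
          qed
          also have "emeasure lborel {x \<in> ?Q. t \<le> A * u x} = (\<integral>\<^sup>+x. indicator {x \<in> ?Q. t \<le> A * u x} x \<partial>lborel)"
            by simp
          also have "\<dots> \<le> ?J"
          proof (rule nn_integral_mono)
            fix x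
            \<comment> \<open>The extra factor 2 turns the weak inequality of the level set estimate
              into the strict one of the layer cake formula.\<close>
            have "t < 2 * A * u x" if "t \<le> A * u x" using that t by linarith
            then show "indicator {x \<in> ?Q. t \<le> A * u x} x \<le>
              (indicator ?Q x * indicator {x. ennreal t < ennreal (min (2 * A * u x) M)} x :: ennreal)"
              using t True by (auto split: split_indicator simp: ennreal_less_iff)
          qed
          finally show ?thesis by (simp add: mult_left_mono)
        next
          case False
          have "?I = (\<integral>\<^sup>+(x :: real ^ 'n). 0 \<partial>lborel)"
            using t False M by (intro nn_integral_cong) (auto split: split_indicator simp: ennreal_less_iff)
          then show ?thesis by simp
        qed
        then have "ennreal (d * t powr (d - 1)) * ?I \<le> ennreal (d * t powr (d - 1)) * (ennreal (B * t) * ?J)"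
          by (rule mult_left_mono) simp
        also have "\<dots> = ennreal (d * t powr (d - 1) * (B * t)) * ?J"
        proof -
          have "0 \<le> d * t powr (d - 1)" using d by simp
          then have eq: "ennreal (d * t powr (d - 1) * (B * t)) = ennreal (d * t powr (d - 1)) * ennreal (B * t)"
            by (rule ennreal_mult')
          show ?thesis unfolding eq by (rule mult.assoc[symmetric])
        qed
        \<comment> \<open>The factor \<open>1 + d \<ge> 1\<close> is inserted to match the layer
          cake formula with exponent \<open>1 + d\<close>.\<close>
        also have "\<dots> \<le> ennreal (B * ((1 + d) * t powr (1 + d - 1)) * d) * ?J"
        proof (intro mult_right_mono ennreal_leI)
          have "t powr (d - 1) * t = t powr d"
            using t powr_add[of t "d - 1" 1] by simp
          then have "d * t powr (d - 1) * (B * t) = B * t powr d * d" by (simp add: mult_ac)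
          also have "\<dots> \<le> B * ((1 + d) * t powr (1 + d - 1)) * d"
            using B0 d by (intro mult_right_mono mult_left_mono) (auto simp: mult_le_cancel_right1)
          finally show "d * t powr (d - 1) * (B * t) \<le> B * ((1 + d) * t powr (1 + d - 1)) * d" .
        qed simp
        also have "\<dots> = ?G t"
          using t B0 d by (simp add: ennreal_mult mult_ac)
        finally show ?thesis using t by (simp add: add_increasing)
      qed
    qed simp
  qed
  also have "\<dots> = ennreal (d * U) * ennreal (l0 powr d / d) + ennreal B *
      (\<integral>\<^sup>+x. epowr (ennreal (min (2 * A * u x) M)) (1 + d) * indicator ?Q x \<partial>lborel) * ennreal d"
  proof -
    have "(\<integral>\<^sup>+t. ?F t \<partial>lborel) = ennreal (d * U) * ennreal (l0 powr d / d)"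
      using nn_integral_powr_from_0[of "d - 1" l0] d l0 by (subst nn_integral_cmult) auto
    moreover have "(\<integral>\<^sup>+t. ?G t \<partial>lborel) = ennreal B *
      (\<integral>\<^sup>+x. epowr (ennreal (min (2 * A * u x) M)) (1 + d) * indicator ?Q x \<partial>lborel) * ennreal d"
      using d by (subst nn_integral_epowr_layer_cake) (auto simp: nn_integral_cmult nn_integral_multc)
    ultimately show ?thesis by (subst nn_integral_add) auto
  qed
  also have "\<dots> \<le> ennreal (l0 powr d * U) + ennreal (1 / 2) * X"
  proof (rule add_mono)
    show "ennreal (d * U) * ennreal (l0 powr d / d) \<le> ennreal (l0 powr d * U)"
      using d U by (simp add: mult.commute flip: ennreal_mult)
    have "(\<integral>\<^sup>+x. epowr (ennreal (min (2 * A * u x) M)) (1 + d) * indicator ?Q x \<partial>lborel)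
       \<le> (\<integral>\<^sup>+x. ennreal (4 * A\<^sup>2) * (ennreal (min (u x) M powr d * u x) * indicator ?Q x) \<partial>lborel)"
    proof (rule nn_integral_mono)
      fix x
      have "min (2 * A * u x) M powr (1 + d) \<le> 4 * A\<^sup>2 * (min (u x) M powr d * u x)"
      proof -
        let ?m = "min (u x) M"
        have m0: "?m \<ge> 0" "?m \<le> u x" using u0 M by (auto simp: less_imp_le)
        have "min (2 * A * u x) M \<le> 2 * A * ?m"
        proof -
          have "M \<le> 2 * A * M" using A M by simp
          then show ?thesis
            by (cases "u x \<le> M") (auto intro: min.coboundedI1 min.coboundedI2)
        qed
        moreover have "0 \<le> min (2 * A * u x) M" using u0[of x] M A by simp
        ultimately have "min (2 * A * u x) M powr (1 + d) \<le> (2 * A * ?m) powr (1 + d)"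
          using d by (intro powr_mono2) auto
        also have "\<dots> = (2 * A) powr (1 + d) * ?m powr (1 + d)"
          by (rule powr_mult)
        also have "\<dots> \<le> (2 * A) powr 2 * (?m powr d * u x)"
        proof (rule mult_mono)
          show "(2 * A) powr (1 + d) \<le> (2 * A) powr 2" using A d by (intro powr_mono) auto
          show "?m powr (1 + d) \<le> ?m powr d * u x"
            using m0 by (cases "?m = 0") (auto simp: powr_add mult.commute intro!: mult_left_mono)
        qed auto
        also have "(2 * A) powr 2 = 4 * A\<^sup>2"
          using A by (simp add: powr_numeral power_mult_distrib)
        finally show ?thesis .
      qed
      then show "epowr (ennreal (min (2 * A * u x) M)) (1 + d) * indicator ?Q x
         \<le> ennreal (4 * A\<^sup>2) * (ennreal (min (u x) M powr d * u x) * indicator ?Q x)"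
        using u0[of x] A M d
        by (auto split: split_indicator simp: epowr_ennreal_nonneg simp flip: ennreal_mult intro!: ennreal_leI)
    qed
    also have "\<dots> = ennreal (4 * A\<^sup>2) * X"
      unfolding X_def by (rule nn_integral_cmult) measurable
    finally have "ennreal B * (\<integral>\<^sup>+x. epowr (ennreal (min (2 * A * u x) M)) (1 + d) * indicator ?Q x \<partial>lborel) * ennreal d
      \<le> ennreal B * (ennreal (4 * A\<^sup>2) * X) * ennreal d"
      by (intro mult_right_mono mult_left_mono) auto
    also have "\<dots> = ennreal (B * (4 * A\<^sup>2) * d) * X"
      using B0 d by (simp add: ennreal_mult mult_ac)
    also have "\<dots> \<le> ennreal (1 / 2) * X"
      using d(3) by (intro mult_right_mono ennreal_leI) (auto simp: mult_ac)
    finally show "ennreal B * (\<integral>\<^sup>+x. epowr (ennreal (min (2 * A * u x) M)) (1 + d) * indicator ?Q x \<partial>lborel) * ennreal d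
      \<le> ennreal (1 / 2) * X" .
  qed
  finally have le: "X \<le> ennreal (l0 powr d * U) + ennreal (1 / 2) * X" .
  \<comment> \<open>Finiteness of \<open>X\<close> turns the inequality into one between reals,
    where the term with \<open>1 / 2\<close> is absorbed.\<close>
  obtain y where y: "y \<ge> 0" "X = ennreal y" using Xfin by (cases X) auto
  have "ennreal (l0 powr d * U) + ennreal (1 / 2) * ennreal y = ennreal (l0 powr d * U + 1 / 2 * y)"
    using y U by (subst ennreal_mult'[symmetric], simp, subst ennreal_plus[symmetric]) auto
  then have "ennreal y \<le> ennreal (l0 powr d * U + 1 / 2 * y)"
    using le y by simp
  then have "y \<le> l0 powr d * U + 1 / 2 * y"
    using y U by (subst (asm) ennreal_le_iff) auto
  then have "y \<le> 2 * l0 powr d * U" by simp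
  then show ?thesis using y unfolding X_def l0_def by (simp add: ennreal_leI)
qed

text \<open>The truncation level tends to infinity by monotone convergence. The exponent
  \<open>d\<close> is chosen before the weight and the cube, from \<open>A\<close> and the dimension
  alone; this keeps the final constant uniform.\<close>

lemma A1_reverse_Holder:
  assumes "1 \<le> A"
  obtains d where "0 < d" "d \<le> 1"
    "\<And>(u :: real ^ 'n \<Rightarrow> real) a R U. A1_bound A u \<Longrightarrow> 0 < R \<Longrightarrow> 0 \<le> U \<Longrightarrow>
       (\<integral>\<^sup>+x\<in>cube a R. ennreal (u x) \<partial>lborel) = ennreal U \<Longrightarrow>
       (\<integral>\<^sup>+x\<in>cube a R. ennreal (u x powr (1 + d)) \<partial>lborel) \<le> ennreal (2 * (U / (2 * R) ^ CARD('n)) powr d * U)"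
proof -
  define B where "B = A * (5 * real CARD('n)) ^ CARD('n) * 2 ^ CARD('n)"
  have B: "B > 0" using assms by (simp add: B_def)
  \<comment> \<open>The term to be absorbed has the coefficient
    \<open>B * (4 * A\<^sup>2) * d\<close>, which this choice makes at most
    \<open>1 / 2\<close>.\<close>
  define d where "d = min 1 (1 / (8 * B * A\<^sup>2))"
  have d: "0 < d" "d \<le> 1" using B assms by (auto simp: d_def)
  have "d * (8 * B * A\<^sup>2) \<le> 1 / (8 * B * A\<^sup>2) * (8 * B * A\<^sup>2)"
    using B by (intro mult_right_mono) (auto simp: d_def)
  then have d3: "d * (8 * B * A\<^sup>2) \<le> 1" using B assms by simp
  show ?thesis
  proof (rule that[OF d])
    fix u :: "real ^ 'n \<Rightarrow> real" and a R U
    assume A1: "A1_bound A u" and R: "0 < R" and U: "0 \<le> U" "(\<integral>\<^sup>+x\<in>cube a R. ennreal (u x) \<partial>lborel) = ennreal U"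
    note [measurable] = A1_boundD(2)[OF A1]
    have u0: "0 \<le> u x" for x using A1_boundD(3)[OF A1] .
    show "(\<integral>\<^sup>+x\<in>cube a R. ennreal (u x powr (1 + d)) \<partial>lborel) \<le> ennreal (2 * (U / (2 * R) ^ CARD('n)) powr d * U)"
    proof (cases "U = 0")
      case True
      then have "(\<integral>\<^sup>+x\<in>cube a R. ennreal (u x) \<partial>lborel) = 0" using U(2) by simp
      then have "AE x in lborel. ennreal (u x) * indicator (cube a R) x = 0"
        by (subst (asm) nn_integral_0_iff_AE) auto
      then have "AE x in lborel. ennreal (u x powr (1 + d)) * indicator (cube a R) x = 0"
        by eventually_elim (use u0 in \<open>auto split: split_indicator simp: ennreal_eq_0_iff order_antisym\<close>)
      then have "(\<integral>\<^sup>+x\<in>cube a R. ennreal (u x powr (1 + d)) \<partial>lborel) = 0"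
        by (subst nn_integral_0_iff_AE) auto
      then show ?thesis by simp
    next
      case False
      let ?f = "\<lambda>k x. ennreal (min (u x) (real (Suc k)) powr d * u x) * indicator (cube a R) x"
      have "(\<lambda>k. \<integral>\<^sup>+x. ?f k x \<partial>lborel) \<longlonglongrightarrow> (\<integral>\<^sup>+x\<in>cube a R. ennreal (u x powr (1 + d)) \<partial>lborel)"
      proof (rule nn_integral_LIMSEQ)
        show "incseq ?f"
          using u0 d by (intro incseq_SucI le_funI mult_right_mono ennreal_leI powr_mono2) auto
        show "?f k \<in> borel_measurable lborel" for k by measurable
        fix x
        obtain k0 where k0: "u x \<le> real k0" using real_arch_simple by blast
        have "?f k x = ennreal (u x powr (1 + d)) * indicator (cube a R) x" if "k \<ge> k0" for k
        proof -
          have "min (u x) (real (Suc k)) = u x" using k0 that by (simp add: min_def)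
          then show ?thesis using u0[of x] by (cases "u x = 0") (auto simp: powr_add mult.commute)
        qed
        then show "(\<lambda>k. ?f k x) \<longlonglongrightarrow> ennreal (u x powr (1 + d)) * indicator (cube a R) x"
          by (intro tendsto_eventually) (auto simp: eventually_sequentially)
      qed
      then show ?thesis
      proof (rule LIMSEQ_le_const2)
        show "\<exists>N. \<forall>k\<ge>N. (\<integral>\<^sup>+x. ?f k x \<partial>lborel) \<le> ennreal (2 * (U / (2 * R) ^ CARD('n)) powr d * U)"
          using A1_reverse_Holder_truncated[OF A1 R _ B_def d d3, of "real (Suc _)" U a] U False by auto
      qed
    qed
  qed
qed

text \<open>Hoelder with exponents \<open>1 + d\<close> and its conjugate separates \<open>u\<close>
  from the power of the maximal function: the reverse Hoelder inequality handles the first factor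
  and Kolmogorov's inequality the second. The latter requires \<open>c / (1 - t) < 1\<close>, hence
  \<open>c0 = 1 - t = d / (1 + d)\<close>. The pointwise A1 condition finally replaces the average
  of \<open>u\<close> by \<open>u x\<close>.\<close>

lemma A1_cube_max_average:
  assumes A: "1 \<le> A"
  obtains c0 where "0 < c0" "c0 < 1"
    "\<And>c. 0 < c \<Longrightarrow> c < c0 \<Longrightarrow> \<exists>D>0. \<forall>(u :: real ^ 'n \<Rightarrow> real) h. A1_bound A u \<longrightarrow> h \<in> borel_measurable borel \<longrightarrow>
       (AE x in lborel. \<forall>r>0. (\<integral>\<^sup>+y\<in>cube x r. epowr (cube_max h y) c * ennreal (u y) \<partial>lborel) \<le>
          ennreal (D * u x * r ^ CARD('n)) * epowr (min (cube_max h x) ((\<integral>\<^sup>+z. h z \<partial>lborel) / ennreal (r ^ CARD('n)))) c)"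
proof -
  obtain d where d: "0 < d" "d \<le> 1"
    and RH: "\<And>(u :: real ^ 'n \<Rightarrow> real) a R U. A1_bound A u \<Longrightarrow> 0 < R \<Longrightarrow> 0 \<le> U \<Longrightarrow>
       (\<integral>\<^sup>+x\<in>cube a R. ennreal (u x) \<partial>lborel) = ennreal U \<Longrightarrow>
       (\<integral>\<^sup>+x\<in>cube a R. ennreal (u x powr (1 + d)) \<partial>lborel) \<le> ennreal (2 * (U / (2 * R) ^ CARD('n)) powr d * U)"
    using A1_reverse_Holder[OF A, where 'n = 'n] by blast
  define t where "t = 1 / (1 + d)"
  have t: "0 < t" "t < 1" using d by (auto simp: t_def)
  have t1: "1 - t = d * t" "(1 + d) * t = 1" using d by (auto simp: t_def field_simps)
  let ?N = "CARD('n)"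
  show ?thesis
  proof (rule that[of "1 - t"])
    show "0 < 1 - t" "1 - t < 1" using t by auto
    fix c assume c: "0 < c" "c < 1 - t"
    then have c': "0 < c / (1 - t)" "c / (1 - t) < 1" using t by (auto simp: field_simps)
    obtain D where D: "D > 0"
    "\<And>(h :: real ^ 'n \<Rightarrow> ennreal) x r. h \<in> borel_measurable borel \<Longrightarrow> r > 0 \<Longrightarrow>
       (\<integral>\<^sup>+y\<in>cube x r. epowr (cube_max h y) (c / (1 - t)) \<partial>lborel) \<le> ennreal (D * r ^ ?N) *
          epowr (min (cube_max h x) ((\<integral>\<^sup>+z. h z \<partial>lborel) / ennreal (r ^ ?N))) (c / (1 - t))"
      using cube_max_Kolmogorov[OF c', where 'n = 'n] by blast
    \<comment> \<open>The factors come from the constant 2 of the reverse Hoelder inequality, from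
      Kolmogorov's constant per unit of volume, and from the pointwise A1 bound on a cube of side
      \<open>2 * r\<close>.\<close>
    define E where "E = 2 powr t * (D / 2 ^ ?N) powr (1 - t) * A * 2 ^ ?N"
    have E: "E > 0" using D A by (simp add: E_def)
    show "\<exists>D>0. \<forall>(u :: real ^ 'n \<Rightarrow> real) h. A1_bound A u \<longrightarrow> h \<in> borel_measurable borel \<longrightarrow>
       (AE x in lborel. \<forall>r>0. (\<integral>\<^sup>+y\<in>cube x r. epowr (cube_max h y) c * ennreal (u y) \<partial>lborel) \<le>
          ennreal (D * u x * r ^ ?N) * epowr (min (cube_max h x) ((\<integral>\<^sup>+z. h z \<partial>lborel) / ennreal (r ^ ?N))) c)"
    proof (intro exI[of _ E] conjI E allI impI)
      fix u :: "real ^ 'n \<Rightarrow> real" and h :: "real ^ 'n \<Rightarrow> ennreal"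
      assume A1: "A1_bound A u" and [measurable]: "h \<in> borel_measurable borel"
      note [measurable] = A1_boundD(2)[OF A1]
      have u0: "0 \<le> u x" for x using A1_boundD(3)[OF A1] .
      show "AE x in lborel. \<forall>r>0. (\<integral>\<^sup>+y\<in>cube x r. epowr (cube_max h y) c * ennreal (u y) \<partial>lborel) \<le>
          ennreal (E * u x * r ^ ?N) * epowr (min (cube_max h x) ((\<integral>\<^sup>+z. h z \<partial>lborel) / ennreal (r ^ ?N))) c"
        using A1_bound_pointwise[OF A1]
      proof eventually_elim
        case (elim x)
        show ?case
        proof (intro allI impI)
          fix r :: real assume r: "r > 0"
          define m where "m = min (cube_max h x) ((\<integral>\<^sup>+z. h z \<partial>lborel) / ennreal (r ^ ?N))"
          obtain U where U: "U \<ge> 0" "(\<integral>\<^sup>+y\<in>cube x r. ennreal (u y) \<partial>lborel) = ennreal U"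
            using A1_boundD(4)[OF A1 r, of x] by (cases "\<integral>\<^sup>+y\<in>cube x r. ennreal (u y) \<partial>lborel") auto
          have "ennreal U \<le> ennreal (A * u x * (2 * r) ^ ?N)" using elim r U by metis
          then have UA: "U \<le> A * u x * (2 * r) ^ ?N"
            using A u0[of x] r by (subst (asm) ennreal_le_iff) auto
          have "(\<integral>\<^sup>+y\<in>cube x r. epowr (cube_max h y) c * ennreal (u y) \<partial>lborel) =
            (\<integral>\<^sup>+y. epowr (ennreal (u y powr (1 + d)) * indicator (cube x r) y) t *
                epowr (epowr (cube_max h y) (c / (1 - t)) * indicator (cube x r) y) (1 - t) \<partial>lborel)"
          proof (rule nn_integral_cong)
            fix y
            have "epowr (ennreal (u y powr (1 + d))) t = ennreal (u y)"
              using t u0[of y] t1(2) by (cases "u y = 0") (auto simp: epowr_ennreal epowr_zero_base powr_powr)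
            moreover have "epowr (epowr (cube_max h y) (c / (1 - t))) (1 - t) = epowr (cube_max h y) c"
              using t by (simp add: epowr_epowr)
            ultimately show "epowr (cube_max h y) c * ennreal (u y) * indicator (cube x r) y =
               epowr (ennreal (u y powr (1 + d)) * indicator (cube x r) y) t *
                epowr (epowr (cube_max h y) (c / (1 - t)) * indicator (cube x r) y) (1 - t)"
              using t by (auto split: split_indicator simp: epowr_zero_base mult.commute)
          qed
          also have "\<dots> \<le> epowr (\<integral>\<^sup>+y\<in>cube x r. ennreal (u y powr (1 + d)) \<partial>lborel) t *
               epowr (\<integral>\<^sup>+y\<in>cube x r. epowr (cube_max h y) (c / (1 - t)) \<partial>lborel) (1 - t)"
            by (rule Holder_nn_integral) (use t in auto)
          also have "\<dots> \<le> epowr (ennreal (2 * (U / (2 * r) ^ ?N) powr d * U)) t *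
               epowr (ennreal (D * r ^ ?N) * epowr m (c / (1 - t))) (1 - t)"
            unfolding m_def using t
            by (intro mult_mono epowr_mono RH[OF A1 r U] D(2) r) auto
          also have "epowr (ennreal (D * r ^ ?N) * epowr m (c / (1 - t))) (1 - t) =
              ennreal ((D * r ^ ?N) powr (1 - t)) * epowr m c"
            using t D r by (simp add: epowr_mult epowr_epowr epowr_ennreal)
          also have "epowr (ennreal (2 * (U / (2 * r) ^ ?N) powr d * U)) t =
              ennreal ((2 * (U / (2 * r) ^ ?N) powr d * U) powr t)"
            using t U r by (intro epowr_ennreal_nonneg) auto
          also have "\<dots> * (ennreal ((D * r ^ ?N) powr (1 - t)) * epowr m c)
            = ennreal ((2 * (U / (2 * r) ^ ?N) powr d * U) powr t * (D * r ^ ?N) powr (1 - t)) * epowr m c"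
            by (simp add: ennreal_mult mult.assoc)
          also have "(2 * (U / (2 * r) ^ ?N) powr d * U) powr t * (D * r ^ ?N) powr (1 - t)
             = 2 powr t * (D / 2 ^ ?N) powr (1 - t) * U"
          proof (cases "U = 0")
            case False
            then have U0: "U > 0" using U by simp
            define V where "V = (2 * r) ^ ?N"
            have V: "V > 0" using r by (simp add: V_def)
            have Vr: "D * r ^ ?N = D / 2 ^ ?N * V" by (simp add: V_def power_mult_distrib)
            have "(2 * (U / V) powr d * U) powr t = 2 powr t * ((U / V) powr (1 - t) * U powr t)"
              by (simp add: powr_mult powr_powr t1(1))
            also have "\<dots> = 2 powr t * (U / V powr (1 - t))"
              using U0 V by (simp add: powr_divide powr_diff)
            finally show ?thesis
              unfolding Vr V_def[symmetric] powr_mult[of "D / 2 ^ ?N" V] using V by (simp add: mult_ac)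
          qed simp
          also have "ennreal (2 powr t * (D / 2 ^ ?N) powr (1 - t) * U) * epowr m c \<le> ennreal (E * u x * r ^ ?N) * epowr m c"
          proof (intro mult_right_mono ennreal_leI)
            have "2 powr t * (D / 2 ^ ?N) powr (1 - t) * U \<le> 2 powr t * (D / 2 ^ ?N) powr (1 - t) * (A * u x * (2 * r) ^ ?N)"
              using UA by (intro mult_left_mono) auto
            also have "\<dots> = E * u x * r ^ ?N" unfolding E_def by (simp add: power_mult_distrib mult_ac)
            finally show "2 powr t * (D / 2 ^ ?N) powr (1 - t) * U \<le> E * u x * r ^ ?N" .
          qed simp
          finally show "(\<integral>\<^sup>+y\<in>cube x r. epowr (cube_max h y) c * ennreal (u y) \<partial>lborel) \<le>
            ennreal (E * u x * r ^ ?N) * epowr (min (cube_max h x) ((\<integral>\<^sup>+z. h z \<partial>lborel) / ennreal (r ^ ?N))) c"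
            unfolding m_def .
        qed
      qed
    qed
  qed
qed

subsection \<open>Riesz potentials\<close>

lemma borel_measurable_infnorm [measurable]:
  "f \<in> borel_measurable M \<Longrightarrow> (\<lambda>x. infnorm (f x :: real ^ 'n)) \<in> borel_measurable M"
  by (rule borel_measurable_continuous_on[of infnorm]) (auto intro: continuous_intros)

lemma nn_integral_powr_split:
  fixes R X Y s t :: real
  assumes "R > 0" "X \<ge> 0" "Y \<ge> 0" "0 < s" "0 < t"
  shows "(\<integral>\<^sup>+x. ennreal X * (ennreal (x powr (s - 1)) * indicator {0..R} x) + ennreal Y * (ennreal (x powr (- t - 1)) * indicator {R..} x) \<partial>lborel)
    = ennreal (X * (R powr s / s) + Y * (R powr (- t) / t))"
proof -
  have "- (R powr (- t)) / (- t) = R powr (- t) / t" by simp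
  then show ?thesis
    using assms nn_integral_powr_from_0[of "s - 1" R] nn_integral_powr_to_inf[of "- t - 1" R]
    by (subst nn_integral_add) (auto simp: nn_integral_cmult simp flip: ennreal_mult)
qed

text \<open>The kernel is a superposition of indicators of the cubes \<open>cube x t\<close>, so the
  hypothesis on cube integrals can be inserted for each \<open>t\<close>. What remains is an
  integral in \<open>t\<close>, which converges at the origin by \<open>beta > 0\<close> and at
  infinity by \<open>beta / n < c\<close>.\<close>

lemma Riesz_kernel_bound:
  fixes v :: "real ^ 'n \<Rightarrow> ennreal" and x :: "real ^ 'n"
  assumes [measurable]: "v \<in> borel_measurable borel"
    and pos: "0 < b" "0 < L" "0 \<le> D" "0 < beta" "beta < real CARD('n)" "beta / real CARD('n) < c"
    and bound: "\<And>r. 0 < r \<Longrightarrow> (\<integral>\<^sup>+y\<in>cube x r. v y \<partial>lborel) \<le>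
        ennreal (D * r ^ CARD('n)) * epowr (min (ennreal b) (ennreal L / ennreal (r ^ CARD('n)))) c"
  shows "(\<integral>\<^sup>+y. ennreal (infnorm (x - y) powr (beta - real CARD('n))) * v y \<partial>lborel) \<le>
     ennreal ((real CARD('n) - beta) * (1 / beta + 1 / (real CARD('n) * c - beta)) * D *
        (b powr (c - beta / real CARD('n)) * L powr (beta / real CARD('n))))"
proof -
  let ?N = "CARD('n)" and ?n = "real CARD('n)"
  have n: "?n > 0" by simp
  define s where "s = ?n - beta"
  have s: "s > 0" "beta - ?n = - s" using pos by (auto simp: s_def)
  have c: "c > 0" using pos n by (smt (verit) divide_pos_pos)
  have nc: "?n * c - beta > 0" using pos n by (simp add: field_simps)
  \<comment> \<open>The radius at which \<open>b\<close> and \<open>L / t ^ n\<close> coincide; both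
    parts of the integral then give the same product of powers of \<open>b\<close> and
    \<open>L\<close>.\<close>
  define R where "R = (L / b) powr (1 / ?n)"
  have R: "R > 0" using pos by (simp add: R_def)
  have Rn: "R powr ?n = L / b" using pos n by (simp add: R_def powr_powr)
  have "(\<integral>\<^sup>+y. ennreal (infnorm (x - y) powr (beta - ?n)) * v y \<partial>lborel)
    \<le> (\<integral>\<^sup>+y. (\<integral>\<^sup>+t. ennreal (s * t powr (- s - 1)) * indicator {infnorm (x - y)..} t * v y \<partial>lborel) \<partial>lborel)"
  proof (rule nn_integral_mono)
    fix y
    have "ennreal (infnorm (x - y) powr (beta - ?n)) \<le> (\<integral>\<^sup>+t\<in>{infnorm (x - y)..}. ennreal (s * t powr (- s - 1)) \<partial>lborel)"
      unfolding s(2) by (rule nn_integral_powr_to_inf'[OF s(1) infnorm_pos_le])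
    then have "ennreal (infnorm (x - y) powr (beta - ?n)) * v y \<le> (\<integral>\<^sup>+t\<in>{infnorm (x - y)..}. ennreal (s * t powr (- s - 1)) \<partial>lborel) * v y"
      by (rule mult_right_mono) simp
    also have "\<dots> = (\<integral>\<^sup>+t. ennreal (s * t powr (- s - 1)) * indicator {infnorm (x - y)..} t * v y \<partial>lborel)"
      by (rule nn_integral_multc[symmetric]) simp
    finally show "ennreal (infnorm (x - y) powr (beta - ?n)) * v y
       \<le> (\<integral>\<^sup>+t. ennreal (s * t powr (- s - 1)) * indicator {infnorm (x - y)..} t * v y \<partial>lborel)" .
  qed
  also have "\<dots> = (\<integral>\<^sup>+y. (\<integral>\<^sup>+t. ennreal (s * t powr (- s - 1)) * (if infnorm (x - y) \<le> t then v y else 0) \<partial>lborel) \<partial>lborel)"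
    by (intro nn_integral_cong) auto
  also have "\<dots> = (\<integral>\<^sup>+t. (\<integral>\<^sup>+y. ennreal (s * t powr (- s - 1)) * (if infnorm (x - y) \<le> t then v y else 0) \<partial>lborel) \<partial>lborel)"
    by (rule lborel_pair.Fubini') measurable
  also have "\<dots> = (\<integral>\<^sup>+t. ennreal (s * t powr (- s - 1)) * (\<integral>\<^sup>+y\<in>cube x t. v y \<partial>lborel) \<partial>lborel)"
  proof (rule nn_integral_cong)
    fix t
    have "(\<integral>\<^sup>+y. ennreal (s * t powr (- s - 1)) * (if infnorm (x - y) \<le> t then v y else 0) \<partial>lborel)
      = (\<integral>\<^sup>+y. ennreal (s * t powr (- s - 1)) * (v y * indicator (cube x t) y) \<partial>lborel)"
      by (intro nn_integral_cong) (auto simp: cube_def infnorm_sub[of x] split: split_indicator)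
    then show "(\<integral>\<^sup>+y. ennreal (s * t powr (- s - 1)) * (if infnorm (x - y) \<le> t then v y else 0) \<partial>lborel)
      = ennreal (s * t powr (- s - 1)) * (\<integral>\<^sup>+y\<in>cube x t. v y \<partial>lborel)"
      by (simp add: nn_integral_cmult)
  qed
  also have "\<dots> \<le> (\<integral>\<^sup>+t. ennreal (s * D * b powr c) * (ennreal (t powr (beta - 1)) * indicator {0..R} t)
      + ennreal (s * D * L powr c) * (ennreal (t powr (- (?n * c - beta) - 1)) * indicator {R..} t) \<partial>lborel)"
  proof (rule nn_integral_mono)
    fix t :: real
    consider "t < 0" | "t = 0" | "t > 0" by linarith
    then show "ennreal (s * t powr (- s - 1)) * (\<integral>\<^sup>+y\<in>cube x t. v y \<partial>lborel)
       \<le> ennreal (s * D * b powr c) * (ennreal (t powr (beta - 1)) * indicator {0..R} t)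
      + ennreal (s * D * L powr c) * (ennreal (t powr (- (?n * c - beta) - 1)) * indicator {R..} t)"
    proof cases
      case 1
      then have "cube x t = {}" by (auto simp: cube_def not_le intro: less_le_trans[OF _ infnorm_pos_le])
      then show ?thesis by simp
    next
      case 2
      then show ?thesis by simp
    next
      case 3
      have tn: "t powr (- s - 1) * t ^ ?N = t powr (beta - 1)"
        using 3 by (simp add: s_def flip: powr_realpow powr_add)
      have *: "ennreal (s * t powr (- s - 1)) * (\<integral>\<^sup>+y\<in>cube x t. v y \<partial>lborel) \<le> ennreal (s * D * m * t powr (beta - 1))"
        if m: "epowr (min (ennreal b) (ennreal L / ennreal (t ^ ?N))) c \<le> ennreal m" "m \<ge> 0" for m
      proof -
        have "ennreal (s * t powr (- s - 1)) * (\<integral>\<^sup>+y\<in>cube x t. v y \<partial>lborel)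
          \<le> ennreal (s * t powr (- s - 1)) * (ennreal (D * t ^ ?N) * ennreal m)"
          using bound[OF 3] m by (meson mult_left_mono order_trans zero_le)
        also have "\<dots> = ennreal (s * t powr (- s - 1) * (D * t ^ ?N * m))"
          using s 3 pos m by (simp add: ennreal_mult)
        also have "s * t powr (- s - 1) * (D * t ^ ?N * m) = s * D * m * (t powr (- s - 1) * t ^ ?N)"
          by (simp add: mult_ac)
        finally show ?thesis unfolding tn .
      qed
      show ?thesis
      proof (cases "t \<le> R")
        case True
        have "ennreal (s * t powr (- s - 1)) * (\<integral>\<^sup>+y\<in>cube x t. v y \<partial>lborel) \<le> ennreal (s * D * b powr c * t powr (beta - 1))"
        proof (rule *)
          have "epowr (min (ennreal b) (ennreal L / ennreal (t ^ ?N))) c \<le> epowr (ennreal b) c"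
            using c by (intro epowr_mono) auto
          then show "epowr (min (ennreal b) (ennreal L / ennreal (t ^ ?N))) c \<le> ennreal (b powr c)"
            using pos by (simp add: epowr_ennreal)
        qed simp
        also have "\<dots> = ennreal (s * D * b powr c) * (ennreal (t powr (beta - 1)) * indicator {0..R} t)"
          using True 3 s pos by (simp add: ennreal_mult)
        finally show ?thesis by (simp add: add_increasing2)
      next
        case False
        have "ennreal (s * t powr (- s - 1)) * (\<integral>\<^sup>+y\<in>cube x t. v y \<partial>lborel)
           \<le> ennreal (s * D * (L powr c * t powr (- (?n * c))) * t powr (beta - 1))"
        proof (rule *)
          have "epowr (min (ennreal b) (ennreal L / ennreal (t ^ ?N))) c \<le> epowr (ennreal L / ennreal (t ^ ?N)) c"
            using c by (intro epowr_mono) auto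
          also have "\<dots> = ennreal ((L / t ^ ?N) powr c)"
            using pos 3 by (simp add: divide_ennreal epowr_ennreal)
          also have "(L / t ^ ?N) powr c = L powr c * t powr (- (?n * c))"
            using pos 3 by (simp add: powr_divide powr_realpow[symmetric] powr_powr powr_minus_divide)
          finally show "epowr (min (ennreal b) (ennreal L / ennreal (t ^ ?N))) c \<le> ennreal (L powr c * t powr (- (?n * c)))" .
        qed simp
        also have "s * D * (L powr c * t powr (- (?n * c))) * t powr (beta - 1) = s * D * L powr c * t powr (- (?n * c - beta) - 1)"
          using 3 by (simp add: mult.assoc flip: powr_add) (simp add: algebra_simps)
        also have "ennreal (s * D * L powr c * t powr (- (?n * c - beta) - 1)) = ennreal (s * D * L powr c) * (ennreal (t powr (- (?n * c - beta) - 1)) * indicator {R..} t)"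
          using False 3 s pos by (simp add: ennreal_mult)
        finally show ?thesis by (simp add: add_increasing)
      qed
    qed
  qed
  also have "\<dots> = ennreal (s * D * b powr c * (R powr beta / beta) + s * D * L powr c * (R powr (- (?n * c - beta)) / (?n * c - beta)))"
    by (rule nn_integral_powr_split) (use R s pos nc in auto)
  also have "s * D * b powr c * (R powr beta / beta) + s * D * L powr c * (R powr (- (?n * c - beta)) / (?n * c - beta))
    = (?n - beta) * (1 / beta + 1 / (?n * c - beta)) * D * (b powr (c - beta / ?n) * L powr (beta / ?n))"
  proof -
    have 1: "b powr c * R powr beta = b powr (c - beta / ?n) * L powr (beta / ?n)"
      using pos by (simp add: R_def powr_powr powr_divide powr_diff)
    have e: "- (?n * c - beta) / ?n = beta / ?n - c" using n by (simp add: field_simps)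
    have 2: "L powr c * R powr (- (?n * c - beta)) = b powr (c - beta / ?n) * L powr (beta / ?n)"
    proof -
      have "R powr (- (?n * c - beta)) = (L / b) powr (beta / ?n - c)"
        unfolding R_def powr_powr e[symmetric] by simp
      then show ?thesis using pos by (simp add: powr_divide powr_diff)
    qed
    have "s * D * b powr c * (R powr beta / beta) + s * D * L powr c * (R powr (- (?n * c - beta)) / (?n * c - beta))
      = s * D * ((b powr c * R powr beta) / beta) + s * D * ((L powr c * R powr (- (?n * c - beta))) / (?n * c - beta))"
      by simp
    also have "\<dots> = s * (1 / beta + 1 / (?n * c - beta)) * D * (b powr (c - beta / ?n) * L powr (beta / ?n))"
      unfolding 1 2 by (simp add: algebra_simps)
    finally show ?thesis by (simp add: s_def)
  qed
  finally show ?thesis .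
qed

section \<open>Domination of functions by a Riesz potential of the gradient\<close>

text \<open>The fundamental theorem of calculus on \<open>{0..T}\<close> leaves the value of
  \<open>f\<close> at the far end \<open>x + T *\<^sub>R z\<close>, which tends to 0 as
  \<open>T\<close> grows since \<open>f\<close> vanishes at infinity and \<open>z\<close> is
  nonzero.\<close>

lemma C01_line_integral_bound:
  fixes f :: "real ^ 'n \<Rightarrow> real"
  assumes f: "f \<in> C01" and z: "z \<noteq> 0"
  shows "ennreal \<bar>f x\<bar> \<le> (\<integral>\<^sup>+t\<in>{0..}. ennreal (norm (gradient f (x + t *\<^sub>R z)) * norm z) \<partial>lborel)"
    (is "_ \<le> ?J")
proof -
  have cg: "continuous_on UNIV (gradient f)" and lim: "(f \<longlongrightarrow> 0) at_infinity"
    using f by (auto simp: C01_def)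
  have cont: "continuous_on S (\<lambda>t. gradient f (x + t *\<^sub>R z))" for S :: "real set"
    by (rule continuous_on_compose2[OF cg]) (auto intro!: continuous_intros)
  have step: "ennreal \<bar>f x\<bar> \<le> ?J + ennreal \<bar>f (x + T *\<^sub>R z)\<bar>" if T: "T \<ge> 0" for T
  proof -
    let ?h = "\<lambda>t. z \<bullet> gradient f (x + t *\<^sub>R z)"
    let ?k = "\<lambda>t. norm (gradient f (x + t *\<^sub>R z)) * norm z"
    have "(?h has_integral f (x + T *\<^sub>R z) - f (x + 0 *\<^sub>R z)) {0..T}"
    proof (rule fundamental_theorem_of_calculus[OF T])
      fix t assume "t \<in> {0..T}"
      have "(f has_derivative (\<lambda>h. h \<bullet> gradient f (x + t *\<^sub>R z))) (at (x + t *\<^sub>R z))"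
        using C01_GDERIV[OF f] by (simp add: gderiv_def)
      moreover have "((\<lambda>t. x + t *\<^sub>R z) has_derivative (\<lambda>s. s *\<^sub>R z)) (at t within {0..T})"
        by (auto intro!: derivative_eq_intros)
      ultimately have "((\<lambda>t. f (x + t *\<^sub>R z)) has_derivative (\<lambda>s. (s *\<^sub>R z) \<bullet> gradient f (x + t *\<^sub>R z))) (at t within {0..T})"
        by (rule has_derivative_compose[rotated])
      then show "((\<lambda>t. f (x + t *\<^sub>R z)) has_vector_derivative ?h t) (at t within {0..T})"
        by (simp add: has_vector_derivative_def)
    qed
    then have I: "f (x + T *\<^sub>R z) - f x = integral {0..T} ?h" and int: "?h integrable_on {0..T}"
      by (auto simp: integral_unique has_integral_integrable)
    have intk: "?k integrable_on {0..T}"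
      by (intro integrable_continuous_interval continuous_intros cont)
    have "norm (integral {0..T} ?h) \<le> integral {0..T} ?k"
      by (rule integral_norm_bound_integral[OF int intk])
         (metis Cauchy_Schwarz_ineq2 mult.commute real_norm_def)
    then have "ennreal \<bar>f x - f (x + T *\<^sub>R z)\<bar> \<le> ennreal (integral {0..T} ?k)"
      using I by (intro ennreal_leI) simp
    also have "\<dots> = (\<integral>\<^sup>+t\<in>{0..T}. ennreal (?k t) \<partial>lborel)"
      by (rule nn_integral_has_integral_lebesgue'[symmetric]) (simp, rule integrable_integral[OF intk])
    also have "\<dots> \<le> ?J"
      by (intro nn_integral_mono) (auto split: split_indicator)
    finally have le: "ennreal \<bar>f x - f (x + T *\<^sub>R z)\<bar> \<le> ?J" .
    have "ennreal \<bar>f x\<bar> \<le> ennreal (\<bar>f x - f (x + T *\<^sub>R z)\<bar> + \<bar>f (x + T *\<^sub>R z)\<bar>)"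
      by (intro ennreal_leI) simp
    also have "\<dots> = ennreal \<bar>f x - f (x + T *\<^sub>R z)\<bar> + ennreal \<bar>f (x + T *\<^sub>R z)\<bar>"
      by (simp add: ennreal_plus)
    also have "\<dots> \<le> ?J + ennreal \<bar>f (x + T *\<^sub>R z)\<bar>"
      using le by (rule add_right_mono)
    finally show ?thesis .
  qed
  have "filterlim (\<lambda>T. norm (T *\<^sub>R z)) at_top at_top"
    using z by (simp add: filterlim_at_top_mult_tendsto_pos) (intro filterlim_at_top_mult_tendsto_pos[OF tendsto_const _ filterlim_abs_real], simp)
  then have "filterlim (\<lambda>T. x + T *\<^sub>R z) at_infinity at_top"
    by (intro tendsto_add_filterlim_at_infinity[OF tendsto_const]) (simp add: filterlim_norm_at_top_imp_at_infinity)
  then have "((\<lambda>T. f (x + T *\<^sub>R z)) \<longlongrightarrow> 0) at_top"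
    by (rule filterlim_compose[OF lim])
  then have "((\<lambda>T. ennreal \<bar>f (x + T *\<^sub>R z)\<bar>) \<longlongrightarrow> ennreal \<bar>0\<bar>) at_top"
    by (intro tendsto_intros)
  then have "((\<lambda>T. ?J + ennreal \<bar>f (x + T *\<^sub>R z)\<bar>) \<longlongrightarrow> ?J + ennreal \<bar>0\<bar>) at_top"
    by (intro tendsto_add tendsto_const)
  then have "ennreal \<bar>f x\<bar> \<le> ?J + ennreal \<bar>0\<bar>"
    by (rule tendsto_lowerbound) (rule eventually_mono[OF eventually_ge_at_top[of 0] step], auto)
  then show ?thesis by simp
qed

text \<open>The direction \<open>z\<close> is averaged over the solid unit cube instead of a sphere,
  so Lebesgue measure and an affine change of variables suffice. The volume \<open>2 ^ n\<close> of
  that cube is simply dropped.\<close>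

lemma C01_le_Riesz_potential:
  fixes f :: "real ^ 'n \<Rightarrow> real"
  assumes f: "f \<in> C01"
  shows "ennreal \<bar>f x\<bar> \<le> (\<integral>\<^sup>+y. ennreal (infnorm (x - y) powr (1 - real CARD('n))) * ennreal (norm (gradient f y)) \<partial>lborel)"
proof -
  let ?N = "CARD('n)" and ?n = "real CARD('n)"
  have n: "?n > 0" "?n \<ge> 1" by (auto simp: Suc_leI)
  have [measurable]: "gradient f \<in> borel_measurable borel"
    using f by (auto simp: C01_def intro: borel_measurable_continuous_onI)
  let ?H = "\<lambda>y. norm (gradient f y)"
  have "1 \<le> ennreal (2 ^ ?N)" by (simp flip: ennreal_1)
  then have "ennreal \<bar>f x\<bar> \<le> ennreal (2 ^ ?N) * ennreal \<bar>f x\<bar>"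
    using mult_right_mono[of 1 "ennreal (2 ^ ?N)" "ennreal \<bar>f x\<bar>"] by simp
  also have "\<dots> = (\<integral>\<^sup>+z\<in>cube (0 :: real ^ 'n) 1. ennreal \<bar>f x\<bar> \<partial>lborel)"
    using emeasure_cube[of 1 "0 :: real ^ 'n"] by (simp add: nn_integral_cmult_indicator mult.commute)
  also have "\<dots> \<le> (\<integral>\<^sup>+z\<in>cube (0 :: real ^ 'n) 1. (\<integral>\<^sup>+t\<in>{0..}. ennreal (?H (x + t *\<^sub>R z) * norm z) \<partial>lborel) \<partial>lborel)"
  proof (rule nn_integral_mono_AE)
    show "AE z in lborel. ennreal \<bar>f x\<bar> * indicator (cube (0 :: real ^ 'n) 1) z
       \<le> (\<integral>\<^sup>+t\<in>{0..}. ennreal (?H (x + t *\<^sub>R z) * norm z) \<partial>lborel) * indicator (cube (0 :: real ^ 'n) 1) z"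
      using AE_lborel_singleton[of "0 :: real ^ 'n"]
      by eventually_elim (use C01_line_integral_bound[OF f] in \<open>auto split: split_indicator\<close>)
  qed
  also have "\<dots> = (\<integral>\<^sup>+z. (\<integral>\<^sup>+t. ennreal (?H (x + t *\<^sub>R z) * norm z) * indicator {0..} t * indicator (cube (0 :: real ^ 'n) 1) z \<partial>lborel) \<partial>lborel)"
    by (intro nn_integral_cong nn_integral_multc[symmetric]) measurable
  also have "\<dots> = (\<integral>\<^sup>+t. (\<integral>\<^sup>+z. ennreal (?H (x + t *\<^sub>R z) * norm z) * indicator {0..} t * indicator (cube (0 :: real ^ 'n) 1) z \<partial>lborel) \<partial>lborel)"
    by (rule lborel_pair.Fubini') measurable
  \<comment> \<open>The substitution \<open>y = x + t *\<^sub>R z\<close> contributes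
    \<open>t\<close> to the power \<open>- n\<close>, and
    \<open>norm z \<le> n * infnorm (x - y) / t\<close> one more power; the condition on
    \<open>z\<close> becomes \<open>infnorm (x - y) \<le> t\<close>.\<close>
  also have "\<dots> \<le> (\<integral>\<^sup>+t. (\<integral>\<^sup>+y. ennreal (?H y) * ennreal (?n * infnorm (x - y)) * (ennreal (t powr (- ?n - 1)) * (if infnorm (x - y) \<le> t then 1 else 0)) \<partial>lborel) \<partial>lborel)"
  proof (rule nn_integral_mono_AE)
    show "AE t in lborel. (\<integral>\<^sup>+z. ennreal (?H (x + t *\<^sub>R z) * norm z) * indicator {0..} t * indicator (cube (0 :: real ^ 'n) 1) z \<partial>lborel)
       \<le> (\<integral>\<^sup>+y. ennreal (?H y) * ennreal (?n * infnorm (x - y)) * (ennreal (t powr (- ?n - 1)) * (if infnorm (x - y) \<le> t then 1 else 0)) \<partial>lborel)"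
      using AE_lborel_singleton[of "0 :: real"]
    proof eventually_elim
      case (elim t)
      show ?case
      proof (cases "t > 0")
        case t: True
        have "(\<integral>\<^sup>+y. ennreal (?H y) * ennreal (?n * infnorm (x - y)) * (ennreal (t powr (- ?n - 1)) * (if infnorm (x - y) \<le> t then 1 else 0)) \<partial>lborel)
          = (\<integral>\<^sup>+z. ennreal (t ^ ?N) * (ennreal (?H (x + t *\<^sub>R z)) * ennreal (?n * infnorm (x - (x + t *\<^sub>R z))) *
              (ennreal (t powr (- ?n - 1)) * (if infnorm (x - (x + t *\<^sub>R z)) \<le> t then 1 else 0))) \<partial>lborel)"
          using t by (subst lborel_affine[of t x]) (auto simp: nn_integral_density nn_integral_distr)
        also have "\<dots> \<ge> (\<integral>\<^sup>+z. ennreal (?H (x + t *\<^sub>R z) * norm z) * indicator {0..} t * indicator (cube (0 :: real ^ 'n) 1) z \<partial>lborel)"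
        proof (rule nn_integral_mono)
          fix z :: "real ^ 'n"
          have N: "infnorm (x - (x + t *\<^sub>R z)) = t * infnorm z"
            using t by (simp add: infnorm_neg infnorm_mul)
          show "ennreal (?H (x + t *\<^sub>R z) * norm z) * indicator {0..} t * indicator (cube (0 :: real ^ 'n) 1) z
            \<le> ennreal (t ^ ?N) * (ennreal (?H (x + t *\<^sub>R z)) * ennreal (?n * infnorm (x - (x + t *\<^sub>R z))) *
              (ennreal (t powr (- ?n - 1)) * (if infnorm (x - (x + t *\<^sub>R z)) \<le> t then 1 else 0)))"
          proof (cases "infnorm z \<le> 1")
            case True
            have "t ^ ?N * t * t powr (- ?n - 1) = 1"
              using t by (simp add: powr_diff powr_minus powr_realpow field_simps)
            moreover have "t ^ ?N * (?H (x + t *\<^sub>R z) * (?n * (t * infnorm z)) * t powr (- ?n - 1))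
                = ?H (x + t *\<^sub>R z) * (?n * infnorm z) * (t ^ ?N * t * t powr (- ?n - 1))"
              by (simp only: mult_ac)
            ultimately have "?H (x + t *\<^sub>R z) * (?n * infnorm z) = t ^ ?N * (?H (x + t *\<^sub>R z) * (?n * (t * infnorm z)) * t powr (- ?n - 1))"
              by (simp only: mult_1_right)
            moreover have "?H (x + t *\<^sub>R z) * norm z \<le> ?H (x + t *\<^sub>R z) * (?n * infnorm z)"
              by (intro mult_left_mono infnorm_le_norm_le) auto
            ultimately have "?H (x + t *\<^sub>R z) * norm z \<le> t ^ ?N * (?H (x + t *\<^sub>R z) * (?n * (t * infnorm z)) * t powr (- ?n - 1))"
              by (rule ord_le_eq_trans[rotated])
            then have "ennreal (?H (x + t *\<^sub>R z) * norm z) \<le> ennreal (t ^ ?N * (?H (x + t *\<^sub>R z) * (?n * (t * infnorm z)) * t powr (- ?n - 1)))"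
              by (rule ennreal_leI)
            also have "\<dots> = ennreal (t ^ ?N) * (ennreal (?H (x + t *\<^sub>R z)) * ennreal (?n * (t * infnorm z)) * ennreal (t powr (- ?n - 1)))"
              using t infnorm_pos_le[of z] by (simp add: ennreal_mult)
            finally show ?thesis unfolding N using True t by (auto simp: cube_def)
          qed (simp add: cube_def)
        qed
        finally show ?thesis .
      qed (use elim in simp)
    qed
  qed
  also have "\<dots> = (\<integral>\<^sup>+y. (\<integral>\<^sup>+t. ennreal (?H y) * ennreal (?n * infnorm (x - y)) * (ennreal (t powr (- ?n - 1)) * (if infnorm (x - y) \<le> t then 1 else 0)) \<partial>lborel) \<partial>lborel)"
    by (rule lborel_pair.Fubini') measurable
  also have "\<dots> = (\<integral>\<^sup>+y. ennreal (infnorm (x - y) powr (1 - ?n)) * ennreal (?H y) \<partial>lborel)"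
  proof (rule nn_integral_cong)
    fix y
    show "(\<integral>\<^sup>+t. ennreal (?H y) * ennreal (?n * infnorm (x - y)) * (ennreal (t powr (- ?n - 1)) * (if infnorm (x - y) \<le> t then 1 else 0)) \<partial>lborel)
      = ennreal (infnorm (x - y) powr (1 - ?n)) * ennreal (?H y)"
    \<comment> \<open>On the diagonal both sides are 0: the left one through its factor
      \<open>infnorm (x - y)\<close>, the right one because \<open>0 powr a = 0\<close>.\<close>
    proof (cases "infnorm (x - y) = 0")
      case False
      then have N: "infnorm (x - y) > 0" using infnorm_pos_le[of "x - y"] by simp
      let ?r = "infnorm (x - y)"
      have "(\<integral>\<^sup>+t. ennreal (t powr (- ?n - 1)) * (if ?r \<le> t then 1 else 0) \<partial>lborel) = (\<integral>\<^sup>+t\<in>{?r..}. ennreal (t powr (- ?n - 1)) \<partial>lborel)"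
        by (intro nn_integral_cong) (auto split: split_indicator)
      also have "\<dots> = ennreal (?r powr (- ?n) / ?n)"
        using N n by (subst nn_integral_powr_to_inf) auto
      finally have "(\<integral>\<^sup>+t. ennreal (?H y) * ennreal (?n * ?r) * (ennreal (t powr (- ?n - 1)) * (if ?r \<le> t then 1 else 0)) \<partial>lborel)
        = ennreal (?H y) * ennreal (?n * ?r) * ennreal (?r powr (- ?n) / ?n)"
        by (subst nn_integral_cmult) auto
      also have "\<dots> = ennreal (?H y) * ennreal (?n * ?r * (?r powr (- ?n) / ?n))"
      proof -
        have "ennreal (?n * ?r * (?r powr (- ?n) / ?n)) = ennreal (?n * ?r) * ennreal (?r powr (- ?n) / ?n)"
          using N by (intro ennreal_mult) auto
        then show ?thesis by (simp only: mult.assoc)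
      qed
      also have "?n * ?r * (?r powr (- ?n) / ?n) = ?r powr (1 - ?n)"
        using N n by (simp add: powr_diff powr_minus divide_inverse)
      finally show ?thesis by (simp add: mult.commute)
    qed simp
  qed
  finally show ?thesis .
qed

subsection \<open>The Schur test\<close>

text \<open>In logarithms this is a linear identity in \<open>lN\<close>, \<open>lb\<close>,
  \<open>lu\<close> and \<open>lH\<close>. The contributions of \<open>b\<close>, \<open>u\<close>
  and \<open>e\<close> cancel, and the remaining exponent \<open>Th - n / p' - n / q\<close> of
  \<open>N\<close> equals \<open>1 - n\<close> by the definition of \<open>Th\<close>.\<close>

lemma Schur_test_identity:
  fixes N b u H p q p' Th n e :: real
  assumes pos: "0 < N" "0 < b" "0 < u" "0 < H" "0 < n"
    and pq: "0 < p" "0 < q" "0 < p'" "1 / p + 1 / p' = 1"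
    and Th: "Th = 1 + n * (1 / q - 1 / p)"
    and W: "W = N powr (q * e / p' - n) * (H powr p * b powr (- (Th * p / n)) * u powr (p / q)) * (1 / u * b powr (- (q * e / (n * p'))))"
    and F: "F = H powr p * b powr (- (Th * p / n)) * u powr (p / q)"
  shows "N powr (1 - n) * H = (N powr (p' * Th - e - n) * b powr (p' * Th / n + e / n)) powr (1 / p') *
     (W powr (p / q) * F powr (1 - p / q)) powr (1 / p)"
proof -
  obtain lN lb lu lH where l: "N = exp lN" "b = exp lb" "u = exp lu" "H = exp lH"
    using pos by (metis exp_ln)
  have p': "1 / p' = 1 - 1 / p" using pq by simp
  have e1: "(p' * Th - e - n) * (1 / p') = Th - (e + n) * (1 / p')"
    using pq by (simp add: field_simps)
  have e2: "(p' * Th / n + e / n) * (1 / p') = Th / n + e / n * (1 / p')"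
    using pq by (simp add: field_simps)
  have rhs: "(N powr (p' * Th - e - n) * b powr (p' * Th / n + e / n)) powr (1 / p') =
     N powr (Th - (e + n) * (1 / p')) * b powr (Th / n + e / n * (1 / p'))"
    unfolding powr_mult powr_powr e1 e2 ..
  have F': "F = exp (p * lH - Th * p / n * lb + p / q * lu)"
    unfolding F l by (simp add: powr_def flip: exp_add)
  have W': "W = exp ((q * e * (1 / p') - n) * lN + (p * lH - Th * p / n * lb + p / q * lu) - lu - q * e / n * (1 / p') * lb)"
  proof -
    have a: "exp lN powr (q * e / p' - n) = exp ((q * e * (1 / p') - n) * lN)"
      by (simp add: powr_def)
    have b: "1 / exp lu * exp lb powr (- (q * e / (n * p'))) = exp (- lu - q * e / n * (1 / p') * lb)"
      by (simp add: powr_def exp_diff exp_minus divide_inverse)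
    have "W = exp ((q * e * (1 / p') - n) * lN) * exp (p * lH - Th * p / n * lb + p / q * lu) * exp (- lu - q * e / n * (1 / p') * lb)"
      unfolding W F[symmetric] F' unfolding l a b ..
    then show ?thesis by (simp only: exp_add[symmetric]) (simp add: algebra_simps)
  qed
  have "(W powr (p / q) * F powr (1 - p / q)) powr (1 / p) =
    exp (((p / q) * ((q * e * (1 / p') - n) * lN + (p * lH - Th * p / n * lb + p / q * lu) - lu - q * e / n * (1 / p') * lb)
      + (1 - p / q) * (p * lH - Th * p / n * lb + p / q * lu)) * (1 / p))"
    unfolding F' W' by (simp add: powr_def flip: exp_add)
  also have "((p / q) * ((q * e * (1 / p') - n) * lN + (p * lH - Th * p / n * lb + p / q * lu) - lu - q * e / n * (1 / p') * lb)
      + (1 - p / q) * (p * lH - Th * p / n * lb + p / q * lu)) * (1 / p)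
    = (e * (1 / p') - n / q) * lN + lH - Th / n * lb - e / n * (1 / p') * lb"
  proof -
    have "((p / q) * ((q * e * i - n) * lN + (p * lH - Th * p / n * lb + p / q * lu) - lu - q * e / n * i * lb)
      + (1 - p / q) * (p * lH - Th * p / n * lb + p / q * lu)) * (1 / p)
    = (e * i - n / q) * lN + lH - Th / n * lb - e / n * i * lb" for i
      using pq(1,2) pos(5) by (simp add: field_simps)
    then show ?thesis .
  qed
  finally have eWF: "(W powr (p / q) * F powr (1 - p / q)) powr (1 / p)
    = exp ((e * (1 / p') - n / q) * lN + lH - Th / n * lb - e / n * (1 / p') * lb)" .
  have "(N powr (p' * Th - e - n) * b powr (p' * Th / n + e / n)) powr (1 / p') *
     (W powr (p / q) * F powr (1 - p / q)) powr (1 / p)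
    = exp ((Th - (e + n) * (1 / p')) * lN + (Th / n + e / n * (1 / p')) * lb +
       ((e * (1 / p') - n / q) * lN + lH - Th / n * lb - e / n * (1 / p') * lb))"
    unfolding rhs eWF unfolding l by (simp add: powr_def flip: exp_add)
  also have "(Th - (e + n) * (1 / p')) * lN + (Th / n + e / n * (1 / p')) * lb +
       ((e * (1 / p') - n / q) * lN + lH - Th / n * lb - e / n * (1 / p') * lb) = (Th - n * (1 / p') - n / q) * lN + lH"
    by (simp add: algebra_simps add_divide_distrib)
  also have "Th - n * (1 / p') - n / q = 1 - n"
    unfolding p' Th using pq by (simp add: field_simps)
  finally show ?thesis
    unfolding l by (simp add: powr_def flip: exp_add)
qed

text \<open>The constant is quantified before \<open>u\<close>, \<open>h\<close>, \<open>f\<close>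
  and \<open>L\<close>, so apart from the fixed exponents and the dimension it depends only on
  \<open>A\<close>.\<close>

lemma weighted_Sobolev_lborel:
  fixes p q p' Th A :: real
  assumes n1: "CARD('n::finite) > 1"
    and pq: "1 < p" "p \<le> q" and conj: "1 / p + 1 / p' = 1"
    and Th: "Th = 1 + real CARD('n) * (1 / q - 1 / p)" "Th > 0" "Th * p' < real CARD('n)"
    and A: "1 \<le> A"
  shows "\<exists>C>0. \<forall>(u :: real ^ 'n \<Rightarrow> real) h f L. A1_bound A u \<longrightarrow> h \<in> borel_measurable borel \<longrightarrow>
     0 < L \<longrightarrow> (\<integral>\<^sup>+x. h x \<partial>lborel) = ennreal L \<longrightarrow> f \<in> C01 \<longrightarrow>
     epowr (\<integral>\<^sup>+x. ennreal (\<bar>f x\<bar> powr q * u x) \<partial>lborel) (1 / q)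
        \<le> ennreal C * ennreal (L powr (Th / real CARD('n)))
          * epowr (\<integral>\<^sup>+x. ennreal (norm (gradient f x) powr p)
                        * epowr (cube_max h x) (- (Th * p / real CARD('n)))
                        * ennreal (u x powr (p / q)) \<partial>lborel) (1 / p)"
proof -
  define n where "n = real CARD('n)"
  have n: "n > 1" using n1 by (simp add: n_def)
  have q: "q > 1" using pq by simp
  have p'1: "p' > 1"
  proof -
    have e: "1 / p' = 1 - 1 / p" using conj by simp
    have "1 / p > 0" "1 / p < 1" using pq by auto
    then have "0 < 1 / p'" "1 / p' < 1" using e by auto
    then show ?thesis by (simp add: zero_less_divide_iff divide_less_eq_1)
  qed
  obtain c0 where c0: "0 < c0" "c0 < 1"
    and av: "\<And>c. 0 < c \<Longrightarrow> c < c0 \<Longrightarrow> \<exists>D>0. \<forall>(u :: real ^ 'n \<Rightarrow> real) h. A1_bound A u \<longrightarrow> h \<in> borel_measurable borel \<longrightarrow>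
       (AE x in lborel. \<forall>r>0. (\<integral>\<^sup>+y\<in>cube x r. epowr (cube_max h y) c * ennreal (u y) \<partial>lborel) \<le>
          ennreal (D * u x * r ^ CARD('n)) * epowr (min (cube_max h x) ((\<integral>\<^sup>+z. h z \<partial>lborel) / ennreal (r ^ CARD('n)))) c)"
    using A1_cube_max_average[OF A, where 'n = 'n] by blast
  \<comment> \<open>The three bounds secure \<open>beta1 > 0\<close>, \<open>c1 < 1\<close> and
    \<open>c2 < c0\<close>; halving makes them strict.\<close>
  define e where "e = min (p' * Th) (min (n - p' * Th) (n * p' * c0 / (2 * q))) / 2"
  have pTh: "0 < p' * Th" "p' * Th < n" using Th p'1 by (auto simp: n_def mult.commute)
  have "n * p' * c0 / (2 * q) > 0" using n p'1 c0 q by simp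
  then have "e > 0" "2 * e \<le> p' * Th" "2 * e \<le> n - p' * Th" "2 * e \<le> n * p' * c0 / (2 * q)"
    using pTh unfolding e_def by auto
  then have e: "0 < e" "e < p' * Th" "e < n - p' * Th" "e < n * p' * c0 / (2 * q)"
    by linarith+
  define beta1 where "beta1 = p' * Th - e"
  define c1 where "c1 = p' * Th / n + e / n"
  define beta2 where "beta2 = q * e / p'"
  define c2 where "c2 = 2 * q * e / (n * p')"
  define gam where "gam = 2 * e / n"
  define del where "del = q * e / (n * p')"
  have b1: "0 < beta1" "beta1 < n" using e pTh by (auto simp: beta1_def)
  have c1: "0 < c1" "c1 < 1" "beta1 / n < c1" "c1 - beta1 / n = gam"
    using e n pTh by (auto simp: c1_def beta1_def gam_def field_simps)
  have gam0: "gam > 0" using e n by (simp add: gam_def)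
  have c2: "0 < c2" "c2 < c0"
  proof -
    show "0 < c2" using e n q p'1 by (simp add: c2_def)
    have "e * (2 * q) < n * p' * c0" using e(4) q by (simp add: pos_less_divide_eq)
    moreover have "n * p' > 0" using n p'1 by simp
    ultimately show "c2 < c0" by (simp add: c2_def pos_divide_less_eq mult_ac)
  qed
  have b2: "0 < beta2" "beta2 < n" "beta2 / n < c2" "c2 - beta2 / n = del"
  proof -
    show "0 < beta2" using e q p'1 by (simp add: beta2_def)
    show d: "c2 - beta2 / n = del" using n p'1 by (simp add: c2_def beta2_def del_def field_simps)
    have "del > 0" using e q p'1 n by (simp add: del_def)
    then show "beta2 / n < c2" using d by simp
    then have "beta2 / n < 1" using c2 c0 by simp
    then show "beta2 < n" using n by simp
  qed
  \<comment> \<open>\<open>gam\<close> is the power of \<open>b\<close> left by the first potential,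
    which enters with the exponent \<open>q / p'\<close>; this defines the power to be tested
    against the second kernel.\<close>
  have gq: "gam * (q / p') = c2" using n p'1 by (simp add: gam_def c2_def field_simps)
  obtain D1 where D1: "D1 > 0"
    "\<And>(h :: real ^ 'n \<Rightarrow> ennreal) x r. h \<in> borel_measurable borel \<Longrightarrow> r > 0 \<Longrightarrow>
       (\<integral>\<^sup>+y\<in>cube x r. epowr (cube_max h y) c1 \<partial>lborel) \<le> ennreal (D1 * r ^ CARD('n)) *
          epowr (min (cube_max h x) ((\<integral>\<^sup>+z. h z \<partial>lborel) / ennreal (r ^ CARD('n)))) c1"
    using cube_max_Kolmogorov[OF c1(1,2), where 'n = 'n] by blast
  obtain D2 where D2: "D2 > 0"
    "\<And>(u :: real ^ 'n \<Rightarrow> real) h. A1_bound A u \<Longrightarrow> h \<in> borel_measurable borel \<Longrightarrow>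
       (AE x in lborel. \<forall>r>0. (\<integral>\<^sup>+y\<in>cube x r. epowr (cube_max h y) c2 * ennreal (u y) \<partial>lborel) \<le>
          ennreal (D2 * u x * r ^ CARD('n)) * epowr (min (cube_max h x) ((\<integral>\<^sup>+z. h z \<partial>lborel) / ennreal (r ^ CARD('n)))) c2)"
    using av[OF c2] by blast
  define K1 where "K1 = (n - beta1) * (1 / beta1 + 1 / (n * c1 - beta1)) * D1"
  define K2 where "K2 = (n - beta2) * (1 / beta2 + 1 / (n * c2 - beta2)) * D2"
  have K1: "K1 > 0"
    unfolding K1_def using b1 c1 D1 n by (intro mult_pos_pos add_pos_pos) (auto simp: field_simps)
  have K2: "K2 > 0"
    unfolding K2_def using b2 c2 D2 n by (intro mult_pos_pos add_pos_pos) (auto simp: field_simps)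
  define C where "C = (K1 powr (q / p') * K2) powr (1 / q)"
  have C: "C > 0" using K1 K2 by (simp add: C_def)
  have main: "epowr (\<integral>\<^sup>+x. ennreal (\<bar>f x\<bar> powr q * u x) \<partial>lborel) (1 / q)
        \<le> ennreal C * ennreal (L powr (Th / n)) * epowr (\<integral>\<^sup>+x. ennreal (norm (gradient f x) powr p)
                        * epowr (cube_max h x) (- (Th * p / n)) * ennreal (u x powr (p / q)) \<partial>lborel) (1 / p)"
    if A1: "A1_bound A u" and h: "h \<in> borel_measurable borel" and L: "0 < L" "(\<integral>\<^sup>+x. h x \<partial>lborel) = ennreal L"
      and f: "f \<in> C01" for u :: "real ^ 'n \<Rightarrow> real" and h f L
  proof (cases "AE x in lborel. u x > 0")
    \<comment> \<open>If \<open>u\<close> is not positive almost everywhere, it vanishes at a point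
      where the pointwise A1 condition holds. All cubes centred there have zero integral, so
      \<open>u = 0\<close> almost everywhere and the left-hand side is 0. Afterwards division by
      \<open>u\<close> is legitimate.\<close>
    case False
    have "\<exists>x. (\<forall>r>0. (\<integral>\<^sup>+y\<in>cube x r. ennreal (u y) \<partial>lborel) \<le> ennreal (A * u x * (2 * r) ^ CARD('n))) \<and> \<not> u x > 0"
    proof (rule ccontr)
      assume "\<not> ?thesis"
      then have "AE x in lborel. u x > 0"
        by (intro eventually_mono[OF A1_bound_pointwise[OF A1]]) blast
      then show False using False by simp
    qed
    then obtain x where x: "\<And>r. r > 0 \<Longrightarrow> (\<integral>\<^sup>+y\<in>cube x r. ennreal (u y) \<partial>lborel) \<le> ennreal (A * u x * (2 * r) ^ CARD('n))" "u x \<le> 0"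
      unfolding not_less by blast
    have "u x = 0" using x(2) A1_boundD(3)[OF A1, of x] by simp
    then have "(\<integral>\<^sup>+y\<in>cube x r. ennreal (u y) \<partial>lborel) = 0" if "r > 0" for r
      using x(1)[OF that] by simp
    then have "AE y in lborel. ennreal (u y) = 0"
      by (rule AE_zero_if_cube_integrals_zero[rotated]) (use A1_boundD(2)[OF A1] in measurable)
    then have "AE y in lborel. ennreal (\<bar>f y\<bar> powr q * u y) = 0"
      by eventually_elim (simp add: ennreal_eq_0_iff mult_nonneg_nonpos)
    then have "(\<integral>\<^sup>+y. ennreal (\<bar>f y\<bar> powr q * u y) \<partial>lborel) = (\<integral>\<^sup>+(y :: real ^ 'n). 0 \<partial>lborel)"
      by (rule nn_integral_cong_AE)
    then show ?thesis using q by (simp add: epowr_zero_base)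
  next
    case upos: True
    note [measurable] = A1_boundD(2)[OF A1] h
    have [measurable]: "gradient f \<in> borel_measurable borel"
      using f by (auto simp: C01_def intro: borel_measurable_continuous_onI)
    have [measurable]: "f \<in> borel_measurable borel"
      using f by (auto simp: C01_def intro!: borel_measurable_continuous_onI continuous_at_imp_continuous_on differentiable_imp_continuous_within)
    define b where "b = cube_max h"
    have [measurable]: "b \<in> borel_measurable borel" by (simp add: b_def)
    have "\<not> (AE y in lborel. h y = 0)"
      using L by (subst nn_integral_0_iff_AE[symmetric]) auto
    then have b0: "b x > 0" for x unfolding b_def by (intro cube_max_pos) auto
    have bfin: "AE x in lborel. b x < top"
      unfolding b_def by (rule cube_max_finite_AE) (auto simp: L)
    have good: "AE x in lborel. u x > 0 \<and> (\<exists>r>0. b x = ennreal r)"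
      using upos bfin
    proof eventually_elim
      case (elim x)
      then show ?case using b0[of x] by (cases "b x" rule: ennreal_cases3) auto
    qed
    let ?H = "\<lambda>y. norm (gradient f y)"
    define F where "F = (\<lambda>y. ennreal (?H y powr p) * epowr (b y) (- (Th * p / n)) * ennreal (u y powr (p / q)))"
    \<comment> \<open>The reciprocal of the factor \<open>u y\<close> times \<open>b y\<close> to
      the power \<open>del\<close> that the second kernel produces in the dual integral.\<close>
    define w where "w = (\<lambda>y. ennreal (1 / u y) * epowr (b y) (- del))"
    define k1 where "k1 = (\<lambda>x y :: real ^ 'n. ennreal (infnorm (x - y) powr (beta1 - n)))"
    define k2 where "k2 = (\<lambda>x y :: real ^ 'n. ennreal (infnorm (x - y) powr (beta2 - n)))"
    define P where "P = (\<lambda>x. \<integral>\<^sup>+y. k1 x y * epowr (b y) c1 \<partial>lborel)"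
    define Q where "Q = (\<lambda>x. \<integral>\<^sup>+y. k2 x y * (F y * w y) \<partial>lborel)"
    define S where "S = (\<integral>\<^sup>+y. F y \<partial>lborel)"
    have [measurable]: "F \<in> borel_measurable borel" "w \<in> borel_measurable borel"
      unfolding F_def w_def by measurable
    have [measurable]: "case_prod k1 \<in> borel_measurable (borel \<Otimes>\<^sub>M borel)" "case_prod k2 \<in> borel_measurable (borel \<Otimes>\<^sub>M borel)"
      unfolding k1_def k2_def by measurable
    have [measurable]: "P \<in> borel_measurable borel" "Q \<in> borel_measurable borel"
      unfolding P_def Q_def by measurable
    \<comment> \<open>Hoelder is used twice: with \<open>1 / p'\<close> and \<open>1 / p\<close> to
      split off \<open>P\<close>, then with \<open>p / q\<close> and \<open>1 - p / q\<close> to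
      separate \<open>Q\<close> from \<open>S\<close>.\<close>
    have fbound: "ennreal \<bar>f x\<bar> \<le> epowr (P x) (1 / p') * epowr (epowr (Q x) (p / q) * epowr S (1 - p / q)) (1 / p)" for x
    proof -
      have "ennreal \<bar>f x\<bar> \<le> (\<integral>\<^sup>+y. ennreal (infnorm (x - y) powr (1 - n)) * ennreal (?H y) \<partial>lborel)"
        using C01_le_Riesz_potential[OF f] by (simp add: n_def)
      also have "\<dots> \<le> (\<integral>\<^sup>+y. epowr (k1 x y * epowr (b y) c1) (1 / p') *
           epowr (epowr (k2 x y * (F y * w y)) (p / q) * epowr (F y) (1 - p / q)) (1 - 1 / p') \<partial>lborel)"
      proof (rule nn_integral_mono_AE)
        show "AE y in lborel. ennreal (infnorm (x - y) powr (1 - n)) * ennreal (?H y) \<le> epowr (k1 x y * epowr (b y) c1) (1 / p') *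
           epowr (epowr (k2 x y * (F y * w y)) (p / q) * epowr (F y) (1 - p / q)) (1 - 1 / p')"
          using good AE_lborel_singleton[of x]
        proof eventually_elim
          case (elim y)
          then obtain r where r: "r > 0" "b y = ennreal r" by auto
          have u: "u y > 0" using elim by simp
          have N: "infnorm (x - y) > 0" using elim by (simp add: infnorm_pos_lt)
          show ?case
          \<comment> \<open>The identity needs positive factors; where the gradient vanishes, the
            left-hand side is 0.\<close>
          proof (cases "gradient f y = 0")
            case False
            then have H: "?H y > 0" by simp
            let ?N = "infnorm (x - y)"
            let ?F = "?H y powr p * r powr (- (Th * p / n)) * u y powr (p / q)"
            let ?W = "?N powr (q * e / p' - n) * ?F * (1 / u y * r powr (- (q * e / (n * p'))))"
            have F0: "?F > 0" using H r u by simp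
            have W0: "?W > 0" using F0 N r u by simp
            have eF: "F y = ennreal ?F"
              unfolding F_def using r by (simp add: epowr_ennreal ennreal_mult)
            have eW: "k2 x y * (F y * w y) = ennreal ?W"
            proof -
              have "w y = ennreal (1 / u y) * ennreal (r powr (- (q * e / (n * p'))))"
                unfolding w_def del_def using r by (simp add: epowr_ennreal)
              also have "\<dots> = ennreal (1 / u y * r powr (- (q * e / (n * p'))))"
                using u by (intro ennreal_mult[symmetric]) auto
              finally have "F y * w y = ennreal (?F * (1 / u y * r powr (- (q * e / (n * p')))))"
                unfolding eF using F0 u by (simp only:) (intro ennreal_mult[symmetric], auto)
              then have "k2 x y * (F y * w y) = ennreal (?N powr (q * e / p' - n) * (?F * (1 / u y * r powr (- (q * e / (n * p'))))))"
                unfolding k2_def beta2_def using F0 u by (simp only:) (intro ennreal_mult[symmetric], auto)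
              then show ?thesis by (simp only: mult.assoc)
            qed
            have "epowr (k1 x y * epowr (b y) c1) (1 / p') *
              epowr (epowr (k2 x y * (F y * w y)) (p / q) * epowr (F y) (1 - p / q)) (1 - 1 / p')
              = ennreal ((?N powr (p' * Th - e - n) * r powr (p' * Th / n + e / n)) powr (1 / p') *
                 (?W powr (p / q) * ?F powr (1 - p / q)) powr (1 / p))"
            proof -
              have 1: "epowr (k1 x y * epowr (b y) c1) (1 / p') = ennreal ((?N powr (p' * Th - e - n) * r powr (p' * Th / n + e / n)) powr (1 / p'))"
                unfolding k1_def beta1_def c1_def using r N by (simp add: epowr_ennreal flip: ennreal_mult)
              have 2: "epowr (epowr (k2 x y * (F y * w y)) (p / q) * epowr (F y) (1 - p / q)) (1 - 1 / p')
                = ennreal ((?W powr (p / q) * ?F powr (1 - p / q)) powr (1 / p))"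
              proof -
                have "epowr (epowr (k2 x y * (F y * w y)) (p / q) * epowr (F y) (1 - p / q)) (1 - 1 / p')
                  = epowr (ennreal (?W powr (p / q)) * ennreal (?F powr (1 - p / q))) (1 / p)"
                proof -
                  have cp: "1 - 1 / p' = 1 / p" using conj by simp
                  show ?thesis by (subst eW, subst eF) (simp only: epowr_ennreal[OF W0] epowr_ennreal[OF F0] cp)
                qed
                also have "\<dots> = epowr (ennreal (?W powr (p / q) * ?F powr (1 - p / q))) (1 / p)"
                  by (subst ennreal_mult) auto
                also have "\<dots> = ennreal ((?W powr (p / q) * ?F powr (1 - p / q)) powr (1 / p))"
                  using W0 F0 by (intro epowr_ennreal mult_pos_pos) (auto simp only: powr_gt_zero)
                finally show ?thesis .
              qed
              show ?thesis unfolding 1 2 by (rule ennreal_mult[symmetric]) auto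
            qed
            also have "\<dots> = ennreal (?N powr (1 - n) * ?H y)"
              by (rule arg_cong[where f = ennreal], rule Schur_test_identity[symmetric, OF N r(1) u H _ _ _ _ conj _ refl refl])
                 (use n pq q p'1 Th n_def in auto)
            also have "\<dots> = ennreal (?N powr (1 - n)) * ennreal (?H y)"
              by (rule ennreal_mult) auto
            finally show ?thesis by simp
          qed simp
        qed
      qed
      also have "\<dots> \<le> epowr (P x) (1 / p') * epowr (\<integral>\<^sup>+y. epowr (k2 x y * (F y * w y)) (p / q) * epowr (F y) (1 - p / q) \<partial>lborel) (1 - 1 / p')"
        unfolding P_def by (rule Holder_nn_integral) (use p'1 in auto)
      also have "1 - 1 / p' = 1 / p" using conj by simp
      also have "epowr (\<integral>\<^sup>+y. epowr (k2 x y * (F y * w y)) (p / q) * epowr (F y) (1 - p / q) \<partial>lborel) (1 / p)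
        \<le> epowr (epowr (Q x) (p / q) * epowr S (1 - p / q)) (1 / p)"
        unfolding Q_def S_def using pq q by (intro epowr_mono Holder_nn_integral) auto
      finally show ?thesis by (simp add: mult_left_mono)
    qed
    have fq: "ennreal (\<bar>f x\<bar> powr q) \<le> epowr (P x) (q / p') * Q x * epowr S (q / p - 1)" for x
    proof -
      have "ennreal (\<bar>f x\<bar> powr q) = epowr (ennreal \<bar>f x\<bar>) q"
        using q by (simp add: epowr_ennreal_nonneg)
      also have "\<dots> \<le> epowr (epowr (P x) (1 / p') * epowr (epowr (Q x) (p / q) * epowr S (1 - p / q)) (1 / p)) q"
        using q by (intro epowr_mono fbound) auto
      also have "\<dots> = epowr (P x) (1 / p' * q) * (epowr (Q x) (p / q * (1 / p) * q) * epowr S ((1 - p / q) * (1 / p) * q))"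
        using q pq by (simp add: epowr_mult epowr_epowr)
      also have "p / q * (1 / p) * q = 1" using q pq by simp
      also have "(1 - p / q) * (1 / p) * q = q / p - 1" using q pq by (simp add: field_simps)
      finally show ?thesis by (simp add: mult.assoc)
    qed
    have Pb: "AE x in lborel. epowr (P x) (q / p') \<le> ennreal (K1 powr (q / p') * L powr (beta1 / n * (q / p'))) * epowr (b x) c2"
      using good
    proof eventually_elim
      case (elim x)
      then obtain r where r: "r > 0" "b x = ennreal r" by auto
      have "P x \<le> ennreal (K1 * (r powr gam * L powr (beta1 / n)))"
        unfolding P_def k1_def K1_def n_def c1(4)[symmetric, unfolded n_def]
      proof (rule Riesz_kernel_bound)
        fix s :: real assume "0 < s"
        then show "(\<integral>\<^sup>+y\<in>cube x s. epowr (b y) c1 \<partial>lborel)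
          \<le> ennreal (D1 * s ^ CARD('n)) * epowr (min (ennreal r) (ennreal L / ennreal (s ^ CARD('n)))) c1"
          using D1(2)[OF h, of s x] r L by (simp add: b_def)
      qed (use r L D1 b1 c1 n_def in auto)
      then have "epowr (P x) (q / p') \<le> epowr (ennreal (K1 * (r powr gam * L powr (beta1 / n)))) (q / p')"
        using q p'1 by (intro epowr_mono) auto
      also have "\<dots> = ennreal ((K1 * (r powr gam * L powr (beta1 / n))) powr (q / p'))"
        using K1 r L by (intro epowr_ennreal) auto
      also have "(K1 * (r powr gam * L powr (beta1 / n))) powr (q / p') = K1 powr (q / p') * L powr (beta1 / n * (q / p')) * r powr c2"
        unfolding gq[symmetric] by (simp only: powr_mult powr_powr mult_ac)
      also have "ennreal (K1 powr (q / p') * L powr (beta1 / n * (q / p')) * r powr c2)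
         = ennreal (K1 powr (q / p') * L powr (beta1 / n * (q / p'))) * epowr (b x) c2"
        using r by (simp add: epowr_ennreal ennreal_mult)
      finally show ?case .
    qed
    define Z where "Z = K1 powr (q / p') * L powr (beta1 / n * (q / p'))"
    have Z: "Z > 0" using K1 L by (simp add: Z_def)
    have Qb: "(\<integral>\<^sup>+x. epowr (b x) c2 * ennreal (u x) * Q x \<partial>lborel) \<le> ennreal (K2 * L powr (beta2 / n)) * S"
    proof -
      have "(\<integral>\<^sup>+x. epowr (b x) c2 * ennreal (u x) * Q x \<partial>lborel)
        = (\<integral>\<^sup>+x. (\<integral>\<^sup>+y. epowr (b x) c2 * ennreal (u x) * (k2 x y * (F y * w y)) \<partial>lborel) \<partial>lborel)"
        unfolding Q_def by (intro nn_integral_cong nn_integral_cmult[symmetric]) measurable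
      \<comment> \<open>Interchanging the integrals moves the kernel onto \<open>b\<close> to the
        power \<open>c2\<close> times \<open>u\<close>, where the weighted averages apply;
        \<open>F\<close> is left outside as the integrand of the right-hand side.\<close>
      also have "\<dots> = (\<integral>\<^sup>+y. (\<integral>\<^sup>+x. epowr (b x) c2 * ennreal (u x) * (k2 x y * (F y * w y)) \<partial>lborel) \<partial>lborel)"
        by (rule lborel_pair.Fubini') measurable
      also have "\<dots> \<le> (\<integral>\<^sup>+y. ennreal (K2 * L powr (beta2 / n)) * F y \<partial>lborel)"
      proof (rule nn_integral_mono_AE)
        show "AE y in lborel. (\<integral>\<^sup>+x. epowr (b x) c2 * ennreal (u x) * (k2 x y * (F y * w y)) \<partial>lborel) \<le> ennreal (K2 * L powr (beta2 / n)) * F y"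
          using good D2(2)[OF A1 h]
        proof eventually_elim
          case (elim y)
          then obtain r where r: "r > 0" "b y = ennreal r" by auto
          have u: "u y > 0" using elim by simp
          have "(\<integral>\<^sup>+x. epowr (b x) c2 * ennreal (u x) * (k2 x y * (F y * w y)) \<partial>lborel)
            = (\<integral>\<^sup>+x. ennreal (infnorm (y - x) powr (beta2 - n)) * (epowr (b x) c2 * ennreal (u x)) * (F y * w y) \<partial>lborel)"
            by (intro nn_integral_cong) (simp add: k2_def infnorm_sub[of y] mult_ac)
          also have "\<dots> = (\<integral>\<^sup>+x. ennreal (infnorm (y - x) powr (beta2 - n)) * (epowr (b x) c2 * ennreal (u x)) \<partial>lborel) * (F y * w y)"
            by (rule nn_integral_multc) measurable
          also have "\<dots> \<le> ennreal (K2 * u y * (r powr del * L powr (beta2 / n))) * (F y * w y)"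
          proof (rule mult_right_mono)
            have "(\<integral>\<^sup>+x. ennreal (infnorm (y - x) powr (beta2 - n)) * (epowr (b x) c2 * ennreal (u x)) \<partial>lborel)
              \<le> ennreal ((n - beta2) * (1 / beta2 + 1 / (n * c2 - beta2)) * (D2 * u y) * (r powr del * L powr (beta2 / n)))"
              unfolding n_def b2(4)[symmetric, unfolded n_def]
            proof (rule Riesz_kernel_bound)
              fix s :: real assume "0 < s"
              then show "(\<integral>\<^sup>+x\<in>cube y s. epowr (b x) c2 * ennreal (u x) \<partial>lborel)
                \<le> ennreal (D2 * u y * s ^ CARD('n)) * epowr (min (ennreal r) (ennreal L / ennreal (s ^ CARD('n)))) c2"
                using elim(2) r L by (simp add: b_def)
            qed (use r L D2 b2 u n_def in auto)
            then show "(\<integral>\<^sup>+x. ennreal (infnorm (y - x) powr (beta2 - n)) * (epowr (b x) c2 * ennreal (u x)) \<partial>lborel)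
              \<le> ennreal (K2 * u y * (r powr del * L powr (beta2 / n)))"
              unfolding K2_def by (simp only: mult.assoc)
          qed simp
          also have "\<dots> = ennreal (K2 * L powr (beta2 / n)) * F y"
          proof -
            have w: "w y = ennreal (1 / u y * r powr (- del))"
            proof -
              have "w y = ennreal (1 / u y) * ennreal (r powr (- del))"
                unfolding w_def using r by (simp add: epowr_ennreal)
              also have "\<dots> = ennreal (1 / u y * r powr (- del))"
                using u by (intro ennreal_mult[symmetric]) auto
              finally show ?thesis .
            qed
            have "K2 * u y * (r powr del * L powr (beta2 / n)) * (1 / u y * r powr (- del)) = K2 * L powr (beta2 / n)"
              using u r by (simp add: powr_minus field_simps)
            then have "ennreal (K2 * u y * (r powr del * L powr (beta2 / n))) * w y = ennreal (K2 * L powr (beta2 / n))"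
              unfolding w using K2 u by (subst ennreal_mult[symmetric]) auto
            then show ?thesis by (simp add: mult_ac)
          qed
          finally show ?case .
        qed
      qed
      also have "\<dots> = ennreal (K2 * L powr (beta2 / n)) * S"
        unfolding S_def by (rule nn_integral_cmult) measurable
      finally show ?thesis .
    qed
    have "(\<integral>\<^sup>+x. ennreal (\<bar>f x\<bar> powr q * u x) \<partial>lborel)
      \<le> (\<integral>\<^sup>+x. (ennreal Z * epowr S (q / p - 1)) * (epowr (b x) c2 * ennreal (u x) * Q x) \<partial>lborel)"
    proof (rule nn_integral_mono_AE)
      show "AE x in lborel. ennreal (\<bar>f x\<bar> powr q * u x) \<le> (ennreal Z * epowr S (q / p - 1)) * (epowr (b x) c2 * ennreal (u x) * Q x)"
        using Pb
      proof eventually_elim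
        case (elim x)
        have "ennreal (\<bar>f x\<bar> powr q * u x) = ennreal (\<bar>f x\<bar> powr q) * ennreal (u x)"
          using A1_boundD(3)[OF A1, of x] by (intro ennreal_mult) auto
        also have "\<dots> \<le> epowr (P x) (q / p') * Q x * epowr S (q / p - 1) * ennreal (u x)"
          by (intro mult_right_mono fq) auto
        also have "\<dots> \<le> ennreal Z * epowr (b x) c2 * Q x * epowr S (q / p - 1) * ennreal (u x)"
          using elim unfolding Z_def by (intro mult_right_mono) auto
        finally show ?case by (simp add: mult_ac)
      qed
    qed
    also have "\<dots> = (ennreal Z * epowr S (q / p - 1)) * (\<integral>\<^sup>+x. epowr (b x) c2 * ennreal (u x) * Q x \<partial>lborel)"
      by (rule nn_integral_cmult) measurable
    also have "\<dots> \<le> (ennreal Z * epowr S (q / p - 1)) * (ennreal (K2 * L powr (beta2 / n)) * S)"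
      by (intro mult_left_mono Qb) auto
    also have "\<dots> = ennreal (Z * (K2 * L powr (beta2 / n))) * (epowr S (q / p - 1) * epowr S 1)"
      using Z K2 by (simp add: ennreal_mult mult_ac)
    also have "epowr S (q / p - 1) * epowr S 1 = epowr S (q / p)"
      using pq q by (subst epowr_add[symmetric]) auto
    finally have "epowr (\<integral>\<^sup>+x. ennreal (\<bar>f x\<bar> powr q * u x) \<partial>lborel) (1 / q)
       \<le> epowr (ennreal (Z * (K2 * L powr (beta2 / n))) * epowr S (q / p)) (1 / q)"
      using q by (intro epowr_mono) auto
    also have "\<dots> = ennreal ((Z * (K2 * L powr (beta2 / n))) powr (1 / q)) * epowr S (q / p * (1 / q))"
      using q Z K2 L by (simp add: epowr_mult epowr_epowr epowr_ennreal)
    also have "q / p * (1 / q) = 1 / p" using q by simp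
    also have "(Z * (K2 * L powr (beta2 / n))) powr (1 / q) = C * L powr (Th / n)"
    proof -
      have "Z * (K2 * L powr (beta2 / n)) = (K1 powr (q / p') * K2) * L powr (beta1 / n * (q / p') + beta2 / n)"
        by (simp add: Z_def powr_add mult_ac)
      then have "(Z * (K2 * L powr (beta2 / n))) powr (1 / q) = C * L powr ((beta1 / n * (q / p') + beta2 / n) * (1 / q))"
        unfolding C_def by (simp only: powr_mult powr_powr)
      \<comment> \<open>Here \<open>e\<close> drops out, since \<open>beta2\<close> equals
        \<open>e * (q / p')\<close>.\<close>
      also have "(beta1 / n * (q / p') + beta2 / n) * (1 / q) = Th / n"
        using q p'1 n by (simp add: beta1_def beta2_def field_simps)
      finally show ?thesis .
    qed
    also have "ennreal (C * L powr (Th / n)) = ennreal C * ennreal (L powr (Th / n))"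
      using C by (simp add: ennreal_mult)
    finally show ?thesis unfolding S_def F_def b_def .
  qed
  show ?thesis
    using C main unfolding n_def by blast
qed

subsection \<open>Passage to Lebesgue measurable data\<close>

text \<open>The supremum is the limit along a countable family of essential lower bounds, so only
  countably many null sets are discarded.\<close>

lemma AE_ess_inf_on_le:
  "AE x in lebesgue. x \<in> Q \<longrightarrow> ess_inf_on Q w \<le> ennreal (w x)"
proof -
  let ?S = "{c. AE x in lebesgue. x \<in> Q \<longrightarrow> c \<le> ennreal (w x)}"
  have "0 \<in> ?S" by simp
  then obtain F :: "nat \<Rightarrow> ennreal" where F: "range F \<subseteq> ?S" "Sup ?S = (SUP i. F i)"
    using ennreal_Sup_countable_SUP[of ?S] by blast
  have "AE x in lebesgue. \<forall>i. x \<in> Q \<longrightarrow> F i \<le> ennreal (w x)"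
    using F(1) by (subst AE_all_countable) auto
  then show ?thesis
    by eventually_elim (auto simp: ess_inf_on_def F(2) intro!: SUP_least)
qed

lemma weight_borel_measurable:
  fixes u :: "real ^ 'n \<Rightarrow> real"
  assumes "weight u"
  shows "u \<in> borel_measurable lebesgue"
proof (rule borel_measurable_LIMSEQ_real)
  show "(\<lambda>x. indicat_real (cball 0 (real k)) x *\<^sub>R u x) \<in> borel_measurable lebesgue" for k
  proof (rule borel_measurable_integrable)
    have "set_integrable lebesgue (cball 0 (real k)) u"
      using assms compact_cball unfolding weight_def by blast
    then show "integrable lebesgue (\<lambda>x. indicat_real (cball 0 (real k)) x *\<^sub>R u x)"
      unfolding set_integrable_def .
  qed
  fix x :: "real ^ 'n"
  obtain k0 where "norm x \<le> real k0" using real_arch_simple by blast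
  then have "indicat_real (cball 0 (real k)) x *\<^sub>R u x = u x" if "k \<ge> k0" for k
    using that by (auto split: split_indicator)
  then show "(\<lambda>k. indicat_real (cball 0 (real k)) x *\<^sub>R u x) \<longlonglongrightarrow> u x"
    by (intro tendsto_eventually) (auto simp: eventually_sequentially)
qed

text \<open>The positive part of a Borel representative changes the weight only on a null set. The
  maximum with 1 is taken because a weight vanishing almost everywhere has \<open>A1_const\<close>
  equal to 0.\<close>

lemma A1_imp_A1_bound:
  fixes u :: "real ^ 'n \<Rightarrow> real"
  assumes u: "u \<in> A1"
  obtains v where "A1_bound (max 1 (enn2real (A1_const u))) v" "AE x in lborel. u x = v x"
proof -
  have w: "weight u" and fin: "A1_const u < top" using u by (auto simp: A1_def)
  obtain u' where u': "u' \<in> borel_measurable lborel" "AE x in lborel. u x = u' x"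
    using completion_ex_borel_measurable_real[OF weight_borel_measurable[OF w]] by blast
  define v where "v = (\<lambda>x. max 0 (u' x))"
  have "AE x in lborel. u x \<ge> 0"
    using w by (simp add: weight_def AE_completion_iff)
  with u'(2) have uv: "AE x in lborel. u x = v x"
    by eventually_elim (simp add: v_def)
  define A where "A = max 1 (enn2real (A1_const u))"
  have A: "A \<ge> 1" by (simp add: A_def)
  have "A1_bound A v"
    unfolding A1_bound_def
  proof (intro conjI allI impI)
    show "1 \<le> A" by (rule A)
    show "v \<in> borel_measurable borel" using u'(1) by (simp add: v_def)
    show "0 \<le> v x" for x by (simp add: v_def)
    fix c :: "real ^ 'n" and r :: real assume r: "0 < r"
    let ?Q = "cube c r" and ?V = "ennreal ((2 * r) ^ CARD('n))"
    let ?E = "ess_inf_on ?Q u"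
    have V: "emeasure lebesgue ?Q = ?V" using r emeasure_cube[of r c] by simp
    have ess: "AE x in lborel. x \<in> ?Q \<longrightarrow> ?E \<le> ennreal (u x)"
      using AE_ess_inf_on_le[of ?Q u] by (simp add: AE_completion_iff)
    have "?E \<noteq> top"
    proof
      assume "?E = top"
      have "AE x in lborel. x \<notin> ?Q"
        using ess by eventually_elim (use \<open>?E = top\<close> in \<open>auto simp: top_unique\<close>)
      then have "emeasure lborel ?Q = 0"
        by (subst (asm) AE_iff_measurable[OF _ refl]) auto
      then show False using r emeasure_cube[of r c] by simp
    qed
    then obtain m where m: "m \<ge> 0" "?E = ennreal m" by (cases ?E) auto
    show "\<exists>m\<ge>0. (AE x in lborel. x \<in> ?Q \<longrightarrow> m \<le> v x) \<and> (\<integral>\<^sup>+x\<in>?Q. ennreal (v x) \<partial>lborel) \<le> ennreal (A * m * (2 * r) ^ CARD('n))"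
    proof (intro exI[of _ m] conjI m(1))
      show "AE x in lborel. x \<in> ?Q \<longrightarrow> m \<le> v x"
        using ess uv
      proof eventually_elim
        case (elim x)
        then show ?case using m by (auto simp: v_def)
      qed
      have "average ?Q u * inverse ?E \<le> A1_const u"
        unfolding A1_const_def by (rule SUP_upper) (use r in \<open>auto simp: cubes_eq\<close>)
      also have "\<dots> \<le> ennreal A"
        using fin by (cases "A1_const u") (auto simp: A_def intro!: ennreal_leI)
      finally have avA: "average ?Q u * inverse ?E \<le> ennreal A" .
      have avm: "average ?Q u \<le> ennreal A * ennreal m"
      \<comment> \<open>A zero essential infimum has inverse \<open>top\<close>, so finiteness of
        the constant forces the average to be 0.\<close>
      proof (cases "m = 0")
        case True
        have "average ?Q u = 0"
        proof (rule ccontr)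
          assume "average ?Q u \<noteq> 0"
          then have "average ?Q u * inverse ?E = top"
            using True m by (simp add: ennreal_mult_top)
          then show False using avA by (simp add: top_unique)
        qed
        then show ?thesis by simp
      next
        case False
        then have m0: "m > 0" using m by simp
        have "average ?Q u = average ?Q u * inverse ?E * ennreal m"
          using m m0 by (simp add: mult.assoc inverse_ennreal flip: ennreal_mult)
        also have "\<dots> \<le> ennreal A * ennreal m"
          using avA by (rule mult_right_mono) simp
        finally show ?thesis .
      qed
      have "(\<integral>\<^sup>+x\<in>?Q. ennreal (v x) \<partial>lborel) = (\<integral>\<^sup>+x\<in>?Q. ennreal (u x) \<partial>lborel)"
        by (rule nn_integral_cong_AE) (use uv in \<open>eventually_elim, simp\<close>)
      also have "\<dots> = average ?Q u * ?V"
      proof -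
        have "\<dots> = (\<integral>\<^sup>+x\<in>?Q. ennreal (u x) \<partial>lborel) / ?V * ?V"
          using r by (simp only: ennreal_divide_times) (simp add: divide_ennreal)
        then show ?thesis
          unfolding average_def V nn_integral_completion .
      qed
      also have "\<dots> \<le> ennreal A * ennreal m * ?V"
        using avm by (rule mult_right_mono) simp
      also have "\<dots> = ennreal (A * m * (2 * r) ^ CARD('n))"
        using A m r by (simp add: ennreal_mult)
      finally show "(\<integral>\<^sup>+x\<in>?Q. ennreal (v x) \<partial>lborel) \<le> ennreal (A * m * (2 * r) ^ CARD('n))" .
    qed
  qed
  then show ?thesis using that uv unfolding A_def by blast
qed

text \<open>Averages do not see null sets, so the two maximal functions agree at every point,
  although \<open>g\<close> and \<open>g'\<close> agree only almost everywhere.\<close>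

lemma maximal_fun_eq_cube_max:
  fixes g g' :: "real ^ 'n \<Rightarrow> real"
  assumes "AE x in lborel. g x = g' x"
  shows "maximal_fun g x = cube_max (\<lambda>y. ennreal \<bar>g' y\<bar>) x"
proof -
  have av: "average (cube c r) (\<lambda>y. \<bar>g y\<bar>) = (\<integral>\<^sup>+y\<in>cube c r. ennreal \<bar>g' y\<bar> \<partial>lborel) / ennreal ((2 * r) ^ CARD('n))"
    if "r > 0" for c r
  proof -
    have "(\<integral>\<^sup>+y\<in>cube c r. ennreal \<bar>g y\<bar> \<partial>lborel) = (\<integral>\<^sup>+y\<in>cube c r. ennreal \<bar>g' y\<bar> \<partial>lborel)"
      by (rule nn_integral_cong_AE) (use assms in \<open>eventually_elim, simp\<close>)
    moreover have "emeasure lebesgue (cube c r) = ennreal ((2 * r) ^ CARD('n))"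
      using that emeasure_cube[of r c] by simp
    ultimately show ?thesis
      unfolding average_def nn_integral_completion by simp
  qed
  have "{Q \<in> cubes. x \<in> Q} = (\<lambda>(c, r). cube c r) ` {(c, r). 0 < r \<and> x \<in> cube c r}"
    by (auto simp: cubes_eq)
  then have "maximal_fun g x = (SUP (c, r) \<in> {(c, r). 0 < r \<and> x \<in> cube c r}. average (cube c r) (\<lambda>y. \<bar>g y\<bar>))"
    unfolding maximal_fun_def by (simp add: image_image case_prod_beta)
  also have "\<dots> = cube_max (\<lambda>y. ennreal \<bar>g' y\<bar>) x"
    unfolding cube_max_def by (intro SUP_cong refl) (auto simp: av)
  finally show ?thesis .
qed

text \<open>The dependence of the constant is expressed by a function \<open>C\<close> of
  \<open>A1_const u\<close>, chosen before the weight. The case \<open>g = 0\<close> almost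
  everywhere is set apart because the right-hand side would then be \<open>0 * top\<close>, which
  \<open>ennreal\<close> evaluates to 0.\<close>

theorem theorem6p5:
  fixes p q p' \<Theta> :: real
  assumes "CARD('n::finite) > 1"
    and "1 < p" and "p \<le> q"
    and "1 / p + 1 / p' = 1"
    and "\<Theta> = 1 + real CARD('n) * (1 / q - 1 / p)"
    and "\<Theta> > 0" and "\<Theta> * p' < real CARD('n)"
  shows "\<exists>C :: ennreal \<Rightarrow> real. (\<forall>A. C A > 0) \<and>
    (\<forall>u :: real ^ 'n \<Rightarrow> real. u \<in> A1 \<longrightarrow>
      (\<forall>f \<in> C01. \<forall>g. integrable lebesgue g \<longrightarrow> \<not> (AE x in lebesgue. g x = 0) \<longrightarrow>
        epowr (\<integral>\<^sup>+x. ennreal (\<bar>f x\<bar> powr q * u x) \<partial>lebesgue) (1 / q)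
        \<le> ennreal (C (A1_const u))
          * ennreal ((LINT x|lebesgue. \<bar>g x\<bar>) powr (\<Theta> / real CARD('n)))
          * epowr (\<integral>\<^sup>+x. ennreal (norm (gradient f x) powr p)
                        * epowr (maximal_fun g x) (- (\<Theta> * p / real CARD('n)))
                        * ennreal (u x powr (p / q)) \<partial>lebesgue) (1 / p)))"
proof -
  let ?P = "\<lambda>A C. C > 0 \<and> (\<forall>(u :: real ^ 'n \<Rightarrow> real) h f L. A1_bound A u \<longrightarrow> h \<in> borel_measurable borel \<longrightarrow>
     0 < L \<longrightarrow> (\<integral>\<^sup>+x. h x \<partial>lborel) = ennreal L \<longrightarrow> f \<in> C01 \<longrightarrow>
     epowr (\<integral>\<^sup>+x. ennreal (\<bar>f x\<bar> powr q * u x) \<partial>lborel) (1 / q)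
        \<le> ennreal C * ennreal (L powr (\<Theta> / real CARD('n)))
          * epowr (\<integral>\<^sup>+x. ennreal (norm (gradient f x) powr p)
                        * epowr (cube_max h x) (- (\<Theta> * p / real CARD('n)))
                        * ennreal (u x powr (p / q)) \<partial>lborel) (1 / p))"
  have ex: "\<exists>C. ?P (max 1 (enn2real A)) C" for A
    by (rule weighted_Sobolev_lborel[OF assms max.cobounded1])
  \<comment> \<open>A constant is selected for each value of \<open>A1_const\<close>, so weights
    with the same value share it.\<close>
  define C where "C A = (SOME C. ?P (max 1 (enn2real A)) C)" for A
  have C: "?P (max 1 (enn2real A)) (C A)" for A
    unfolding C_def by (rule someI_ex[OF ex])
  show ?thesis
  proof (intro exI[of _ C] conjI allI ballI impI)
    show "C A > 0" for A using C by blast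
    fix u f g :: "real ^ 'n \<Rightarrow> real"
    assume u: "u \<in> A1" and f: "f \<in> C01" and g: "integrable lebesgue g" "\<not> (AE x in lebesgue. g x = 0)"
    obtain v where v: "A1_bound (max 1 (enn2real (A1_const u))) v" "AE x in lborel. u x = v x"
      using A1_imp_A1_bound[OF u] .
    obtain g' where g': "g' \<in> borel_measurable lborel" "AE x in lborel. g x = g' x"
      using completion_ex_borel_measurable_real[of g lborel] g(1) by blast
    let ?L = "LINT x|lebesgue. \<bar>g x\<bar>"
    have "(\<integral>\<^sup>+x. ennreal \<bar>g' x\<bar> \<partial>lborel) = (\<integral>\<^sup>+x. ennreal \<bar>g x\<bar> \<partial>lborel)"
      by (rule nn_integral_cong_AE) (use g'(2) in \<open>eventually_elim, simp\<close>)
    also have "\<dots> = (\<integral>\<^sup>+x. ennreal \<bar>g x\<bar> \<partial>lebesgue)"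
      by (simp add: nn_integral_completion)
    also have "\<dots> = ennreal ?L"
      by (rule nn_integral_eq_integral) (use g in auto)
    finally have L: "(\<integral>\<^sup>+x. ennreal \<bar>g' x\<bar> \<partial>lborel) = ennreal ?L" .
    have L0: "?L > 0"
    proof (rule ccontr)
      assume "\<not> ?L > 0"
      then have "(\<integral>\<^sup>+x. ennreal \<bar>g' x\<bar> \<partial>lborel) = 0" using L by (simp add: ennreal_neg)
      then have "AE x in lborel. ennreal \<bar>g' x\<bar> = 0"
        by (subst (asm) nn_integral_0_iff_AE) (use g'(1) in auto)
      with g'(2) have "AE x in lborel. g x = 0" by eventually_elim simp
      then show False using g(2) by (simp add: AE_completion_iff)
    qed
    have "epowr (\<integral>\<^sup>+x. ennreal (\<bar>f x\<bar> powr q * v x) \<partial>lborel) (1 / q)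
        \<le> ennreal (C (A1_const u)) * ennreal (?L powr (\<Theta> / real CARD('n)))
          * epowr (\<integral>\<^sup>+x. ennreal (norm (gradient f x) powr p)
                        * epowr (cube_max (\<lambda>y. ennreal \<bar>g' y\<bar>) x) (- (\<Theta> * p / real CARD('n)))
                        * ennreal (v x powr (p / q)) \<partial>lborel) (1 / p)"
    proof -
      have h: "(\<lambda>y. ennreal \<bar>g' y\<bar>) \<in> borel_measurable borel" using g'(1) by simp
      show ?thesis
        by (rule C[of "A1_const u", THEN conjunct2, rule_format, OF v(1) h L0 L f])
    qed
    also have "(\<integral>\<^sup>+x. ennreal (\<bar>f x\<bar> powr q * v x) \<partial>lborel) = (\<integral>\<^sup>+x. ennreal (\<bar>f x\<bar> powr q * u x) \<partial>lborel)"
      by (rule nn_integral_cong_AE) (use v(2) in \<open>eventually_elim, simp\<close>)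
    also have "(\<integral>\<^sup>+x. ennreal (norm (gradient f x) powr p)
                        * epowr (cube_max (\<lambda>y. ennreal \<bar>g' y\<bar>) x) (- (\<Theta> * p / real CARD('n)))
                        * ennreal (v x powr (p / q)) \<partial>lborel)
      = (\<integral>\<^sup>+x. ennreal (norm (gradient f x) powr p)
                        * epowr (maximal_fun g x) (- (\<Theta> * p / real CARD('n)))
                        * ennreal (u x powr (p / q)) \<partial>lborel)"
      by (rule nn_integral_cong_AE)
         (use v(2) in \<open>eventually_elim, simp add: maximal_fun_eq_cube_max[OF g'(2)]\<close>)
    finally show "epowr (\<integral>\<^sup>+x. ennreal (\<bar>f x\<bar> powr q * u x) \<partial>lebesgue) (1 / q)
        \<le> ennreal (C (A1_const u)) * ennreal (?L powr (\<Theta> / real CARD('n)))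
          * epowr (\<integral>\<^sup>+x. ennreal (norm (gradient f x) powr p)
                        * epowr (maximal_fun g x) (- (\<Theta> * p / real CARD('n)))
                        * ennreal (u x powr (p / q)) \<partial>lebesgue) (1 / p)"
      unfolding nn_integral_completion .
  qed
qed

end
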